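(* Let $k$ be a field. Every hereditary $k$-coalgebra is non-singular. In particular, every path $k$-coalgebra of a directed graph is non-singular.
   Context: A coalgebra $C$ over $k$ is hereditary if $C$ is cohereditary as a left (equivalently, right) $C$-comodule, i.e. every factor comodule of $C$ is an injective comodule. A coalgebra $C$ is called non-singular if the dual algebra $C^*=\mathrm{Hom}_k(C,k)$ (convolution product) is a left non-singular ring, i.e. no non-zero element of $C^*$ has a left annihilator that is an essential left ideal. The path $k$-coalgebra of a directed graph $\Gamma$ is the vector space with basis all (finite, including length zero) paths in $\Gamma$, comultiplication $\Delta(w)=\sum_{uv=w}u\otimes v$ and counit equal to $1$ on paths of length zero and $0$ on all other paths. *)

theory Defs
  imports "Graph_Theory.Arc_Walk" "HOL-Algebra.AbelCoset" "HOL-Algebra.Module"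
begin

section \<open>Linear algebra\<close>

text \<open>Vector spaces over \<open>K\<close> are \<open>module K M\<close> with \<open>field K\<close>. The components \<^const>\<open>mult\<close> and
  \<^const>\<open>one\<close> that a module record inherits from a ring record carry no information, and are
  left undefined below.\<close>

definition lin_hom ::
    "('k, 'r) ring_scheme \<Rightarrow> ('k, 'm, 'x) module_scheme \<Rightarrow> ('k, 'n, 'y) module_scheme \<Rightarrow> ('m \<Rightarrow> 'n) set"
  where "lin_hom K M N =
    {f \<in> carrier M \<rightarrow> carrier N.
      (\<forall>x\<in>carrier M. \<forall>y\<in>carrier M. f (x \<oplus>\<^bsub>M\<^esub> y) = f x \<oplus>\<^bsub>N\<^esub> f y) \<and>
      (\<forall>a\<in>carrier K. \<forall>x\<in>carrier M. f (a \<odot>\<^bsub>M\<^esub> x) = a \<odot>\<^bsub>N\<^esub> f x)}"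

definition scalar_module :: "('k, 'r) ring_scheme \<Rightarrow> ('k, 'k) module"
  where "scalar_module K =
    \<lparr>carrier = carrier K, mult = undefined, one = undefined, zero = \<zero>\<^bsub>K\<^esub>, add = add K,
     smult = mult K\<rparr>"

definition lin_span ::
    "('k, 'r) ring_scheme \<Rightarrow> ('k, 'm, 'x) module_scheme \<Rightarrow> 'm set \<Rightarrow> 'm set"
  where "lin_span K M S = \<Inter>{H. submodule H K M \<and> S \<subseteq> H}"

definition quot_module :: "('k, 'm, 'x) module_scheme \<Rightarrow> 'm set \<Rightarrow> ('k, 'm set) module"
  where "quot_module M D =
    \<lparr>carrier = a_rcosets\<^bsub>M\<^esub> D, mult = undefined, one = undefined, zero = D, add = set_add M,
     smult = (\<lambda>a X. \<Union>x\<in>X. D +>\<^bsub>M\<^esub> (a \<odot>\<^bsub>M\<^esub> x))\<rparr>"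

definition free_module :: "('k, 'r) ring_scheme \<Rightarrow> 'i set \<Rightarrow> ('k, 'i \<Rightarrow> 'k) module"
  where "free_module K I =
    \<lparr>carrier = {\<phi>. (\<forall>i\<in>I. \<phi> i \<in> carrier K) \<and> (\<forall>i. i \<notin> I \<longrightarrow> \<phi> i = \<zero>\<^bsub>K\<^esub>) \<and>
                   finite {i. \<phi> i \<noteq> \<zero>\<^bsub>K\<^esub>}},
     mult = undefined, one = undefined, zero = (\<lambda>i. \<zero>\<^bsub>K\<^esub>), add = (\<lambda>\<phi> \<psi> i. \<phi> i \<oplus>\<^bsub>K\<^esub> \<psi> i),
     smult = (\<lambda>a \<phi> i. a \<otimes>\<^bsub>K\<^esub> \<phi> i)\<rparr>"

definition basis_vec :: "('k, 'r) ring_scheme \<Rightarrow> 'i \<Rightarrow> 'i \<Rightarrow> 'k"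
  where "basis_vec K i = (\<lambda>j. if j = i then \<one>\<^bsub>K\<^esub> else \<zero>\<^bsub>K\<^esub>)"


section \<open>Tensor products\<close>

text \<open>\<open>M \<otimes> N\<close> is the free module on \<open>carrier M \<times> carrier N\<close> modulo the bilinearity relations.\<close>

definition tensor_relators ::
    "('k, 'r) ring_scheme \<Rightarrow> ('k, 'm, 'x) module_scheme \<Rightarrow> ('k, 'n, 'y) module_scheme \<Rightarrow>
     ('m \<times> 'n \<Rightarrow> 'k) set"
  where "tensor_relators K M N =
    (let F = free_module K (carrier M \<times> carrier N); e = basis_vec K in
      {e (x \<oplus>\<^bsub>M\<^esub> x', y) \<ominus>\<^bsub>F\<^esub> (e (x, y) \<oplus>\<^bsub>F\<^esub> e (x', y)) | x x' y.
         x \<in> carrier M \<and> x' \<in> carrier M \<and> y \<in> carrier N} \<union>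
      {e (x, y \<oplus>\<^bsub>N\<^esub> y') \<ominus>\<^bsub>F\<^esub> (e (x, y) \<oplus>\<^bsub>F\<^esub> e (x, y')) | x y y'.
         x \<in> carrier M \<and> y \<in> carrier N \<and> y' \<in> carrier N} \<union>
      {e (a \<odot>\<^bsub>M\<^esub> x, y) \<ominus>\<^bsub>F\<^esub> a \<odot>\<^bsub>F\<^esub> e (x, y) | a x y.
         a \<in> carrier K \<and> x \<in> carrier M \<and> y \<in> carrier N} \<union>
      {e (x, a \<odot>\<^bsub>N\<^esub> y) \<ominus>\<^bsub>F\<^esub> a \<odot>\<^bsub>F\<^esub> e (x, y) | a x y.
         a \<in> carrier K \<and> x \<in> carrier M \<and> y \<in> carrier N})"

definition tensor_kernel ::
    "('k, 'r) ring_scheme \<Rightarrow> ('k, 'm, 'x) module_scheme \<Rightarrow> ('k, 'n, 'y) module_scheme \<Rightarrow>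
     ('m \<times> 'n \<Rightarrow> 'k) set"
  where "tensor_kernel K M N =
    lin_span K (free_module K (carrier M \<times> carrier N)) (tensor_relators K M N)"

type_synonym ('k, 'm, 'n) tensor = "('m \<times> 'n \<Rightarrow> 'k) set"

definition tensor ::
    "('k, 'r) ring_scheme \<Rightarrow> ('k, 'm, 'x) module_scheme \<Rightarrow> ('k, 'n, 'y) module_scheme \<Rightarrow>
     ('k, ('k, 'm, 'n) tensor) module"
  where "tensor K M N =
    quot_module (free_module K (carrier M \<times> carrier N)) (tensor_kernel K M N)"

definition pure_tensor ::
    "('k, 'r) ring_scheme \<Rightarrow> ('k, 'm, 'x) module_scheme \<Rightarrow> ('k, 'n, 'y) module_scheme \<Rightarrow>
     'm \<Rightarrow> 'n \<Rightarrow> ('k, 'm, 'n) tensor"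
  where "pure_tensor K M N x y =
    tensor_kernel K M N +>\<^bsub>free_module K (carrier M \<times> carrier N)\<^esub> basis_vec K (x, y)"

text \<open>The linear map \<open>M \<otimes> N \<rightarrow> P\<close> with \<open>x \<otimes> y \<mapsto> \<beta> x y\<close>, evaluated on a representative. It is
  meaningful for bilinear \<open>\<beta>\<close> only, in which case the choice of representative is immaterial.\<close>

definition tensor_lift ::
    "('k, 'r) ring_scheme \<Rightarrow> ('k, 'p, 'z) module_scheme \<Rightarrow>
     ('m \<Rightarrow> 'n \<Rightarrow> 'p) \<Rightarrow> ('k, 'm, 'n) tensor \<Rightarrow> 'p"
  where "tensor_lift K P \<beta> t =
    (let \<phi> = (SOME \<phi>. \<phi> \<in> t)
     in \<Oplus>\<^bsub>P\<^esub>z\<in>{z. \<phi> z \<noteq> \<zero>\<^bsub>K\<^esub>}. \<phi> z \<odot>\<^bsub>P\<^esub> \<beta> (fst z) (snd z))"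

definition tensor_map ::
    "('k, 'r) ring_scheme \<Rightarrow> ('k, 'm, 'x) module_scheme \<Rightarrow> ('k, 'n, 'y) module_scheme \<Rightarrow>
     ('a \<Rightarrow> 'm) \<Rightarrow> ('b \<Rightarrow> 'n) \<Rightarrow> ('k, 'a, 'b) tensor \<Rightarrow> ('k, 'm, 'n) tensor"
  where "tensor_map K M N f g =
    tensor_lift K (tensor K M N) (\<lambda>x y. pure_tensor K M N (f x) (g y))"

text \<open>The canonical isomorphism from \<open>(L \<otimes> M) \<otimes> N\<close> to \<open>L \<otimes> (M \<otimes> N)\<close>.\<close>

definition tensor_assoc ::
    "('k, 'r) ring_scheme \<Rightarrow> ('k, 'l, 'w) module_scheme \<Rightarrow> ('k, 'm, 'x) module_scheme \<Rightarrow>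
     ('k, 'n, 'y) module_scheme \<Rightarrow>
     ('k, ('k, 'l, 'm) tensor, 'n) tensor \<Rightarrow> ('k, 'l, ('k, 'm, 'n) tensor) tensor"
  where "tensor_assoc K L M N =
    (let T = tensor K L (tensor K M N)
     in tensor_lift K T (\<lambda>t z. tensor_lift K T
          (\<lambda>x y. pure_tensor K L (tensor K M N) x (pure_tensor K M N y z)) t))"


section \<open>Coalgebras and comodules\<close>

record ('k, 'c) coalgebra = "('k, 'c) module" +
  comult :: "'c \<Rightarrow> ('k, 'c, 'c) tensor"
  counit :: "'c \<Rightarrow> 'k"

locale coalgebra = field K + module K C
  for K :: "('k, 'r) ring_scheme" and C :: "('k, 'c) coalgebra" +
  assumes comult_linear: "comult C \<in> lin_hom K C (tensor K C C)"
    and counit_linear: "counit C \<in> lin_hom K C (scalar_module K)"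
    and coassoc: "c \<in> carrier C \<Longrightarrow>
      tensor_assoc K C C C (tensor_map K (tensor K C C) C (comult C) (\<lambda>x. x) (comult C c)) =
      tensor_map K C (tensor K C C) (\<lambda>x. x) (comult C) (comult C c)"
    and counit_left: "c \<in> carrier C \<Longrightarrow>
      tensor_lift K C (\<lambda>x y. counit C x \<odot>\<^bsub>C\<^esub> y) (comult C c) = c"
    and counit_right: "c \<in> carrier C \<Longrightarrow>
      tensor_lift K C (\<lambda>x y. counit C y \<odot>\<^bsub>C\<^esub> x) (comult C c) = c"

record ('k, 'c, 'm) comodule = "('k, 'm) module" +
  coact :: "'m \<Rightarrow> ('k, 'c, 'm) tensor"

locale left_comodule = C?: coalgebra K C + M?: module K M
  for K :: "('k, 'r) ring_scheme" and C :: "('k, 'c) coalgebra"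
    and M :: "('k, 'c, 'm) comodule" +
  assumes coact_linear: "coact M \<in> lin_hom K M (tensor K C M)"
    and coact_coassoc: "m \<in> carrier M \<Longrightarrow>
      tensor_assoc K C C M (tensor_map K (tensor K C C) M (comult C) (\<lambda>x. x) (coact M m)) =
      tensor_map K C (tensor K C M) (\<lambda>x. x) (coact M) (coact M m)"
    and coact_counit: "m \<in> carrier M \<Longrightarrow>
      tensor_lift K M (\<lambda>x y. counit C x \<odot>\<^bsub>M\<^esub> y) (coact M m) = m"

definition comodule_hom ::
    "('k, 'r) ring_scheme \<Rightarrow> ('k, 'c) coalgebra \<Rightarrow> ('k, 'c, 'm) comodule \<Rightarrow> ('k, 'c, 'n) comodule \<Rightarrow>
     ('m \<Rightarrow> 'n) set"
  where "comodule_hom K C M N =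
    {f \<in> lin_hom K M N.
      \<forall>m\<in>carrier M. coact N (f m) = tensor_map K C N (\<lambda>x. x) f (coact M m)}"

definition regular_comodule :: "('k, 'c) coalgebra \<Rightarrow> ('k, 'c, 'c) comodule"
  where "regular_comodule C = module.extend (module.truncate C) (comodule.fields (comult C))"

text \<open>\<open>D\<close> is a subcomodule of \<open>M\<close> if the coaction maps it into (the image of) \<open>C \<otimes> D\<close>.\<close>

definition subcomodule ::
    "'m set \<Rightarrow> ('k, 'r) ring_scheme \<Rightarrow> ('k, 'c) coalgebra \<Rightarrow> ('k, 'c, 'm) comodule \<Rightarrow> bool"
  where "subcomodule D K C M \<longleftrightarrow>
    submodule D K M \<and>
    (\<forall>d\<in>D. coact M d \<in>
      lin_span K (tensor K C M) {pure_tensor K C M c x | c x. c \<in> carrier C \<and> x \<in> D})"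

text \<open>For a subcomodule \<open>D\<close>, the coaction on \<open>M / D\<close> is the one for which the projection is a
  comodule homomorphism; it does not depend on the representative chosen.\<close>

definition quot_comodule ::
    "('k, 'r) ring_scheme \<Rightarrow> ('k, 'c) coalgebra \<Rightarrow> ('k, 'c, 'm) comodule \<Rightarrow> 'm set \<Rightarrow>
     ('k, 'c, 'm set) comodule"
  where "quot_comodule K C M D =
    module.extend (quot_module M D)
      (comodule.fields (\<lambda>X. tensor_map K C (quot_module M D) (\<lambda>x. x) (\<lambda>x. D +>\<^bsub>M\<^esub> x)
         (coact M (SOME x. x \<in> X))))"

text \<open>HOL cannot quantify over comodules on all types inside a formula, so the test comodules have
  their carriers in the type \<^typ>\<open>'c set\<close>. No generality is lost: comodules are locally
  finite, so by the Baer argument a comodule \<open>Q\<close> is injective as soon as homomorphisms into it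
  extend along monomorphisms into comodules \<open>N\<close> generated by a single element. Such an \<open>N\<close> is
  finite-dimensional, and \<open>dim N \<le> dim C\<close>, as \<open>N\<close> is a quotient of the dual of its coefficient
  coalgebra, a subcoalgebra of \<open>C\<close>. Hence \<open>N\<close> has at most as many elements as \<open>C\<close>, and a
  copy of it has its carrier in \<^typ>\<open>'c set\<close>.\<close>

definition injective_comodule ::
    "('k, 'r) ring_scheme \<Rightarrow> ('k, 'c) coalgebra \<Rightarrow> ('k, 'c, 'c set) comodule \<Rightarrow> bool"
  where "injective_comodule K C Q \<longleftrightarrow>
    left_comodule K C Q \<and>
    (\<forall>(M :: ('k, 'c, 'c set) comodule) (N :: ('k, 'c, 'c set) comodule) i f.
      left_comodule K C M \<and> left_comodule K C N \<and>
      i \<in> comodule_hom K C M N \<and> inj_on i (carrier M) \<and> f \<in> comodule_hom K C M Q \<longrightarrow>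
      (\<exists>g \<in> comodule_hom K C N Q. \<forall>x\<in>carrier M. g (i x) = f x))"

definition hereditary_coalgebra :: "('k, 'r) ring_scheme \<Rightarrow> ('k, 'c) coalgebra \<Rightarrow> bool"
  where "hereditary_coalgebra K C \<longleftrightarrow>
    coalgebra K C \<and>
    (\<forall>D. subcomodule D K C (regular_comodule C) \<longrightarrow>
      injective_comodule K C (quot_comodule K C (regular_comodule C) D))"


section \<open>Non-singularity\<close>

definition left_ideal :: "'a set \<Rightarrow> ('a, 'x) ring_scheme \<Rightarrow> bool"
  where "left_ideal I R \<longleftrightarrow>
    additive_subgroup I R \<and> (\<forall>r\<in>carrier R. \<forall>x\<in>I. r \<otimes>\<^bsub>R\<^esub> x \<in> I)"

definition essential_left_ideal :: "'a set \<Rightarrow> ('a, 'x) ring_scheme \<Rightarrow> bool"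
  where "essential_left_ideal I R \<longleftrightarrow>
    left_ideal I R \<and> (\<forall>J. left_ideal J R \<and> J \<noteq> {\<zero>\<^bsub>R\<^esub>} \<longrightarrow> I \<inter> J \<noteq> {\<zero>\<^bsub>R\<^esub>})"

definition left_annihilator :: "('a, 'x) ring_scheme \<Rightarrow> 'a \<Rightarrow> 'a set"
  where "left_annihilator R x = {r \<in> carrier R. r \<otimes>\<^bsub>R\<^esub> x = \<zero>\<^bsub>R\<^esub>}"

definition left_nonsingular :: "('a, 'x) ring_scheme \<Rightarrow> bool"
  where "left_nonsingular R \<longleftrightarrow>
    \<not> (\<exists>x\<in>carrier R. x \<noteq> \<zero>\<^bsub>R\<^esub> \<and> essential_left_ideal (left_annihilator R x) R)"

text \<open>Linear forms are made extensional so that each is represented by exactly one function.\<close>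

definition dual_algebra :: "('k, 'r) ring_scheme \<Rightarrow> ('k, 'c) coalgebra \<Rightarrow> ('c \<Rightarrow> 'k) ring"
  where "dual_algebra K C =
    \<lparr>carrier = lin_hom K C (scalar_module K) \<inter> extensional (carrier C),
     mult = (\<lambda>f g. \<lambda>c\<in>carrier C.
       tensor_lift K (scalar_module K) (\<lambda>x y. f x \<otimes>\<^bsub>K\<^esub> g y) (comult C c)),
     one = (\<lambda>c\<in>carrier C. counit C c),
     zero = (\<lambda>c\<in>carrier C. \<zero>\<^bsub>K\<^esub>),
     add = (\<lambda>f g. \<lambda>c\<in>carrier C. f c \<oplus>\<^bsub>K\<^esub> g c)\<rparr>"

definition nonsingular_coalgebra :: "('k, 'r) ring_scheme \<Rightarrow> ('k, 'c) coalgebra \<Rightarrow> bool"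
  where "nonsingular_coalgebra K C \<longleftrightarrow> left_nonsingular (dual_algebra K C)"


section \<open>Path coalgebras\<close>

text \<open>A path from \<open>u\<close> to \<open>v\<close> is a triple \<open>(u, p, v)\<close> with \<open>p\<close> its list of arcs; the empty list
  gives the path of length zero at \<open>u = v\<close>.\<close>

type_synonym ('v, 'e) path = "'v \<times> 'e list \<times> 'v"

definition paths :: "('v, 'e) pre_digraph \<Rightarrow> ('v, 'e) path set"
  where "paths G = {(u, p, v). pre_digraph.awalk G u p v}"

definition path_splits ::
    "('v, 'e) pre_digraph \<Rightarrow> ('v, 'e) path \<Rightarrow> (('v, 'e) path \<times> ('v, 'e) path) set"
  where "path_splits G w =
    {((u, p, x), (x', q, v)) | u p x x' q v.
      (u, p, x) \<in> paths G \<and> (x', q, v) \<in> paths G \<and> x = x' \<and> w = (u, p @ q, v)}"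

definition path_comult ::
    "('k, 'r) ring_scheme \<Rightarrow> ('v, 'e) pre_digraph \<Rightarrow> (('v, 'e) path \<Rightarrow> 'k) \<Rightarrow>
     ('k, ('v, 'e) path \<Rightarrow> 'k, ('v, 'e) path \<Rightarrow> 'k) tensor"
  where "path_comult K G \<phi> =
    (let F = free_module K (paths G); T = tensor K F F
     in \<Oplus>\<^bsub>T\<^esub>w\<in>{w. \<phi> w \<noteq> \<zero>\<^bsub>K\<^esub>}. \<phi> w \<odot>\<^bsub>T\<^esub>
          (\<Oplus>\<^bsub>T\<^esub>s\<in>path_splits G w. pure_tensor K F F (basis_vec K (fst s)) (basis_vec K (snd s))))"

definition path_counit :: "('k, 'r) ring_scheme \<Rightarrow> (('v, 'e) path \<Rightarrow> 'k) \<Rightarrow> 'k"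
  where "path_counit K \<phi> = (\<Oplus>\<^bsub>K\<^esub>w\<in>{w. \<phi> w \<noteq> \<zero>\<^bsub>K\<^esub> \<and> fst (snd w) = []}. \<phi> w)"

definition path_coalgebra ::
    "('k, 'r) ring_scheme \<Rightarrow> ('v, 'e) pre_digraph \<Rightarrow> ('k, ('v, 'e) path \<Rightarrow> 'k) coalgebra"
  where "path_coalgebra K G =
    module.extend (free_module K (paths G)) (coalgebra.fields (path_comult K G) (path_counit K))"

end

theory Submission
  imports Defs
begin

text \<open>Let \<open>C\<close> be hereditary and \<open>x \<in> C*\<close>. Then \<open>c \<mapsto> c\<^sub>1 x(c\<^sub>2)\<close> is an endomorphism of the left
  comodule \<open>C\<close>, and \<open>(r x)(c) = r(c\<^sub>1 x(c\<^sub>2))\<close>, so the left annihilator of \<open>x\<close> consists of the forms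
  vanishing on its image. The image is isomorphic to a quotient of \<open>C\<close>, hence injective, hence the
  image of an idempotent endomorphism \<open>e\<close>. Composition with \<open>e\<close> fixes the forms in the left ideal
  generated by \<open>\<epsilon> \<circ> e\<close>, so this ideal meets the annihilator of \<open>x\<close> trivially; it is nonzero if
  \<open>x \<noteq> 0\<close>.

  For a path coalgebra no injectivity is needed: if \<open>w\<close> is a path of minimal length with
  \<open>x(w) \<noteq> 0\<close>, starting at \<open>s\<close>, and \<open>f \<noteq> 0\<close> is supported on the paths ending at \<open>s\<close>, then
  \<open>f x\<close> does not vanish on \<open>u w\<close>, for \<open>u\<close> of minimal length with \<open>f(u) \<noteq> 0\<close>.\<close>

section \<open>Linear maps and submodules\<close>

text \<open>Tensors are cosets in a free module and have no coordinates. The remedy is to contract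
  the left factor with linear forms: over a field these contractions determine a tensor, and even
  detect whether its right factors can be taken in a given subspace
  (\<open>tensor_separation\<close>). A coaction thereby becomes an action of linear forms:
  stability under it suffices for a subcomodule of C, and the homomorphisms are the linear maps that
  commute with it. Coassociativity then enters as one fact: the translations f(c_1) c_2 and c_1
  x(c_2) commute.

  The idempotent arises as follows. Let D be the kernel of \<open>right_act x\<close>. The injective
  comodule C/D embeds in C through \<open>right_act x\<close>, so its identity extends to a
  retraction of C onto C/D, and e is this retraction followed by the embedding. Injectivity is
  tested on carriers in \<open>'c set\<close>, so C takes part as C/0; its comodule laws, like those
  of C/D, come with the heredity hypothesis.\<close>

lemma lin_homI:
  assumes "\<And>x. x \<in> carrier M \<Longrightarrow> f x \<in> carrier N"
    and "\<And>x y. x \<in> carrier M \<Longrightarrow> y \<in> carrier M \<Longrightarrow> f (x \<oplus>\<^bsub>M\<^esub> y) = f x \<oplus>\<^bsub>N\<^esub> f y"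
    and "\<And>a x. a \<in> carrier K \<Longrightarrow> x \<in> carrier M \<Longrightarrow> f (a \<odot>\<^bsub>M\<^esub> x) = a \<odot>\<^bsub>N\<^esub> f x"
  shows "f \<in> lin_hom K M N"
  using assms by (auto simp: lin_hom_def)

lemma lin_hom_closed: "f \<in> lin_hom K M N \<Longrightarrow> x \<in> carrier M \<Longrightarrow> f x \<in> carrier N"
  and lin_hom_add: "f \<in> lin_hom K M N \<Longrightarrow> x \<in> carrier M \<Longrightarrow> y \<in> carrier M \<Longrightarrow>
    f (x \<oplus>\<^bsub>M\<^esub> y) = f x \<oplus>\<^bsub>N\<^esub> f y"
  and lin_hom_smult: "f \<in> lin_hom K M N \<Longrightarrow> a \<in> carrier K \<Longrightarrow> x \<in> carrier M \<Longrightarrow>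
    f (a \<odot>\<^bsub>M\<^esub> x) = a \<odot>\<^bsub>N\<^esub> f x"
  by (auto simp: lin_hom_def)

lemma lin_hom_id: "(\<lambda>x. x) \<in> lin_hom K M M"
  by (simp add: lin_hom_def)

lemma lin_hom_comp:
  "f \<in> lin_hom K M N \<Longrightarrow> g \<in> lin_hom K N P \<Longrightarrow> (\<lambda>x. g (f x)) \<in> lin_hom K M P"
  by (auto simp: lin_hom_def Pi_iff)

lemma lin_hom_cong:
  assumes "f \<in> lin_hom K M N" and "module K M" and "\<And>x. x \<in> carrier M \<Longrightarrow> g x = f x"
  shows "g \<in> lin_hom K M N"
proof -
  interpret M: module K M by fact
  show ?thesis
    using assms by (auto simp: lin_hom_def Pi_iff)
qed

lemma lin_hom_zero:
  assumes "f \<in> lin_hom K M N" "module K M" "module K N"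
  shows "f \<zero>\<^bsub>M\<^esub> = \<zero>\<^bsub>N\<^esub>"
proof -
  interpret M: module K M by fact
  interpret N: module K N by fact
  have "f (\<zero>\<^bsub>K\<^esub> \<odot>\<^bsub>M\<^esub> \<zero>\<^bsub>M\<^esub>) = \<zero>\<^bsub>K\<^esub> \<odot>\<^bsub>N\<^esub> f \<zero>\<^bsub>M\<^esub>"
    using assms(1) by (intro lin_hom_smult) auto
  then show ?thesis
    using lin_hom_closed[OF assms(1)] by simp
qed

lemma lin_hom_a_inv:
  assumes "f \<in> lin_hom K M N" "module K M" "module K N" "x \<in> carrier M"
  shows "f (\<ominus>\<^bsub>M\<^esub> x) = \<ominus>\<^bsub>N\<^esub> f x"
proof -
  interpret M: module K M by fact
  interpret N: module K N by fact
  have "f (\<ominus>\<^bsub>M\<^esub> x) \<oplus>\<^bsub>N\<^esub> f x = \<zero>\<^bsub>N\<^esub>"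
    using assms lin_hom_add[OF assms(1), of "\<ominus>\<^bsub>M\<^esub> x" x] lin_hom_zero[OF assms(1-3)]
    by (simp add: M.M.l_neg)
  then show ?thesis
    using assms lin_hom_closed[OF assms(1)] by (simp add: N.M.minus_equality)
qed

lemma lin_hom_minus:
  assumes "f \<in> lin_hom K M N" "module K M" "module K N" "x \<in> carrier M" "y \<in> carrier M"
  shows "f (x \<ominus>\<^bsub>M\<^esub> y) = f x \<ominus>\<^bsub>N\<^esub> f y"
proof -
  interpret M: module K M by fact
  show ?thesis
    using assms by (simp add: a_minus_def lin_hom_add[OF assms(1)] lin_hom_a_inv[OF assms(1-3)])
qed

lemma lin_hom_finsum:
  assumes "f \<in> lin_hom K M N" "module K M" "module K N" "finite A" "h \<in> A \<rightarrow> carrier M"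
  shows "f (\<Oplus>\<^bsub>M\<^esub>i\<in>A. h i) = (\<Oplus>\<^bsub>N\<^esub>i\<in>A. f (h i))"
proof -
  interpret M: module K M by fact
  interpret N: module K N by fact
  show ?thesis
    using assms(4,5)
  proof (induction rule: finite_induct)
    case empty
    show ?case using lin_hom_zero[OF assms(1-3)] by simp
  next
    case (insert x F)
    then have "h x \<in> carrier M" "h \<in> F \<rightarrow> carrier M" by auto
    moreover from this have "(\<lambda>i. f (h i)) \<in> F \<rightarrow> carrier N" "f (h x) \<in> carrier N"
      using lin_hom_closed[OF assms(1)] by auto
    ultimately show ?case
      using insert by (simp add: lin_hom_add[OF assms(1)])
  qed
qed

lemma submodule_crit:
  assumes "module K M" "H \<subseteq> carrier M" "\<zero>\<^bsub>M\<^esub> \<in> H"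
    and "\<And>x y. x \<in> H \<Longrightarrow> y \<in> H \<Longrightarrow> x \<oplus>\<^bsub>M\<^esub> y \<in> H"
    and smult: "\<And>a x. a \<in> carrier K \<Longrightarrow> x \<in> H \<Longrightarrow> a \<odot>\<^bsub>M\<^esub> x \<in> H"
  shows "submodule H K M"
proof -
  interpret M: module K M by fact
  show ?thesis
  proof (rule M.submoduleI)
    fix x assume "x \<in> H"
    moreover from this have "\<ominus>\<^bsub>M\<^esub> x = (\<ominus>\<^bsub>K\<^esub> \<one>\<^bsub>K\<^esub>) \<odot>\<^bsub>M\<^esub> x"
      using assms(2) by (subst M.smult_l_minus) auto
    ultimately show "\<ominus>\<^bsub>M\<^esub> x \<in> H" using smult by simp
  qed (use assms in auto)
qed

lemma submoduleD:
  assumes "module K M" "submodule H K M"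
  shows "x \<in> H \<Longrightarrow> x \<in> carrier M" "\<zero>\<^bsub>M\<^esub> \<in> H" "x \<in> H \<Longrightarrow> y \<in> H \<Longrightarrow> x \<oplus>\<^bsub>M\<^esub> y \<in> H"
    "a \<in> carrier K \<Longrightarrow> x \<in> H \<Longrightarrow> a \<odot>\<^bsub>M\<^esub> x \<in> H" "x \<in> H \<Longrightarrow> \<ominus>\<^bsub>M\<^esub> x \<in> H"
    "x \<in> H \<Longrightarrow> y \<in> H \<Longrightarrow> x \<ominus>\<^bsub>M\<^esub> y \<in> H"
proof -
  interpret M: module K M by fact
  interpret H: submodule H K M by fact
  note * = M.submoduleE[OF assms(2)]
  show "x \<in> H \<Longrightarrow> x \<in> carrier M" "x \<in> H \<Longrightarrow> y \<in> H \<Longrightarrow> x \<oplus>\<^bsub>M\<^esub> y \<in> H"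
    "a \<in> carrier K \<Longrightarrow> x \<in> H \<Longrightarrow> a \<odot>\<^bsub>M\<^esub> x \<in> H" "x \<in> H \<Longrightarrow> \<ominus>\<^bsub>M\<^esub> x \<in> H"
    "x \<in> H \<Longrightarrow> y \<in> H \<Longrightarrow> x \<ominus>\<^bsub>M\<^esub> y \<in> H"
    using * by (auto simp: a_minus_def)
  show "\<zero>\<^bsub>M\<^esub> \<in> H" using H.one_closed by simp
qed

lemma submodule_vimage:
  assumes "f \<in> lin_hom K M N" "module K M" "module K N" "submodule D K N"
  shows "submodule {x \<in> carrier M. f x \<in> D} K M"
proof -
  interpret M: module K M by fact
  show ?thesis
    using assms submoduleD[OF assms(3,4)] lin_hom_zero[OF assms(1-3)]
    by (intro submodule_crit) (auto simp: lin_hom_add[OF assms(1)] lin_hom_smult[OF assms(1)])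
qed

lemma submodule_zero: "module K M \<Longrightarrow> submodule {\<zero>\<^bsub>M\<^esub>} K M"
proof -
  assume "module K M"
  then interpret M: module K M .
  show ?thesis by (rule submodule_crit) (auto intro: M.module_axioms)
qed

lemma lin_span_mono: "x \<in> S \<Longrightarrow> x \<in> lin_span K M S"
  by (auto simp: lin_span_def)

lemma lin_span_minimal: "submodule H K M \<Longrightarrow> S \<subseteq> H \<Longrightarrow> lin_span K M S \<subseteq> H"
  by (auto simp: lin_span_def)

lemma lin_span_submodule:
  assumes "module K M" "S \<subseteq> carrier M"
  shows "submodule (lin_span K M S) K M"
proof -
  interpret M: module K M by fact
  show ?thesis
    using lin_span_minimal[OF M.carrier_is_submodule assms(2)] submoduleD[OF assms(1)]
    by (intro submodule_crit assms(1)) (auto simp: lin_span_def)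
qed

text \<open>The axioms are equations and the existence of negatives, and both pass along any
  surjection \<open>h\<close> that respects the operations. Quotients use this with the coset map;
  records that differ only in extra fields use it with \<open>h\<close> the identity.\<close>

lemma module_image:
  assumes "module K M" and carr: "carrier Q = h ` carrier M" and zero: "\<zero>\<^bsub>Q\<^esub> = h \<zero>\<^bsub>M\<^esub>"
    and add: "\<And>x y. x \<in> carrier M \<Longrightarrow> y \<in> carrier M \<Longrightarrow> h x \<oplus>\<^bsub>Q\<^esub> h y = h (x \<oplus>\<^bsub>M\<^esub> y)"
    and smult: "\<And>a x. a \<in> carrier K \<Longrightarrow> x \<in> carrier M \<Longrightarrow> a \<odot>\<^bsub>Q\<^esub> h x = h (a \<odot>\<^bsub>M\<^esub> x)"
  shows "module K Q"
proof -
  interpret M: module K M by fact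
  have inv: "h x \<oplus>\<^bsub>Q\<^esub> h (\<ominus>\<^bsub>M\<^esub> x) = \<zero>\<^bsub>Q\<^esub>" "h (\<ominus>\<^bsub>M\<^esub> x) \<oplus>\<^bsub>Q\<^esub> h x = \<zero>\<^bsub>Q\<^esub>" if "x \<in> carrier M" for x
    using that by (simp_all add: add zero M.M.r_neg M.M.l_neg)
  show ?thesis
  proof (rule moduleI)
    show "abelian_group Q"
    proof (rule abelian_groupI)
      fix x assume "x \<in> carrier Q"
      then show "\<exists>y\<in>carrier Q. y \<oplus>\<^bsub>Q\<^esub> x = \<zero>\<^bsub>Q\<^esub>"
        using inv unfolding carr by blast
    qed (auto simp: carr add zero M.M.a_ac)
  qed (auto simp: carr add smult M.R.cring_axioms M.smult_l_distr M.smult_r_distr M.smult_assoc1)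
qed

lemma scalar_module_simps [simp]:
  "carrier (scalar_module K) = carrier K" "\<zero>\<^bsub>scalar_module K\<^esub> = \<zero>\<^bsub>K\<^esub>"
  "x \<oplus>\<^bsub>scalar_module K\<^esub> y = x \<oplus>\<^bsub>K\<^esub> y" "a \<odot>\<^bsub>scalar_module K\<^esub> x = a \<otimes>\<^bsub>K\<^esub> x"
  by (simp_all add: scalar_module_def)

lemma scalar_module_module:
  assumes "cring K"
  shows "module K (scalar_module K)"
proof -
  interpret K: cring K by fact
  show ?thesis
    by (rule moduleI; (rule abelian_groupI)?)
      (auto simp: K.cring_axioms K.a_ac K.l_distr K.r_distr K.m_assoc
        intro: exI[of _ "\<ominus>\<^bsub>K\<^esub> _"] bexI[of _ "\<ominus>\<^bsub>K\<^esub> _"] K.l_neg)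
qed

section \<open>Free modules\<close>

lemma free_module_simps [simp]:
  "\<zero>\<^bsub>free_module K I\<^esub> = (\<lambda>i. \<zero>\<^bsub>K\<^esub>)"
  "\<phi> \<oplus>\<^bsub>free_module K I\<^esub> \<psi> = (\<lambda>i. \<phi> i \<oplus>\<^bsub>K\<^esub> \<psi> i)"
  "a \<odot>\<^bsub>free_module K I\<^esub> \<phi> = (\<lambda>i. a \<otimes>\<^bsub>K\<^esub> \<phi> i)"
  by (simp_all add: free_module_def)

lemma free_module_carrier:
  "\<phi> \<in> carrier (free_module K I) \<longleftrightarrow>
    (\<forall>i\<in>I. \<phi> i \<in> carrier K) \<and> (\<forall>i. i \<notin> I \<longrightarrow> \<phi> i = \<zero>\<^bsub>K\<^esub>) \<and> finite {i. \<phi> i \<noteq> \<zero>\<^bsub>K\<^esub>}"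
  by (simp add: free_module_def)

lemma free_module_eval_closed:
  "cring K \<Longrightarrow> \<phi> \<in> carrier (free_module K I) \<Longrightarrow> \<phi> i \<in> carrier K"
  by (metis free_module_carrier cring.cring_simprules(2))

lemma free_module_module:
  assumes "cring K"
  shows "module K (free_module K I)"
proof -
  interpret K: cring K by fact
  let ?F = "free_module K I"
  note closed = free_module_eval_closed[OF assms, of _ I]
  have add: "\<phi> \<oplus>\<^bsub>?F\<^esub> \<psi> \<in> carrier ?F" if "\<phi> \<in> carrier ?F" "\<psi> \<in> carrier ?F" for \<phi> \<psi>
  proof -
    have "{i. \<phi> i \<oplus>\<^bsub>K\<^esub> \<psi> i \<noteq> \<zero>\<^bsub>K\<^esub>} \<subseteq> {i. \<phi> i \<noteq> \<zero>\<^bsub>K\<^esub>} \<union> {i. \<psi> i \<noteq> \<zero>\<^bsub>K\<^esub>}" by auto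
    then have "finite {i. \<phi> i \<oplus>\<^bsub>K\<^esub> \<psi> i \<noteq> \<zero>\<^bsub>K\<^esub>}"
      using that by (auto simp: free_module_carrier elim: finite_subset)
    then show ?thesis using that by (auto simp: free_module_carrier)
  qed
  have smult: "a \<odot>\<^bsub>?F\<^esub> \<phi> \<in> carrier ?F" if "a \<in> carrier K" "\<phi> \<in> carrier ?F" for a \<phi>
  proof -
    have "{i. a \<otimes>\<^bsub>K\<^esub> \<phi> i \<noteq> \<zero>\<^bsub>K\<^esub>} \<subseteq> {i. \<phi> i \<noteq> \<zero>\<^bsub>K\<^esub>}" using that by auto
    then have "finite {i. a \<otimes>\<^bsub>K\<^esub> \<phi> i \<noteq> \<zero>\<^bsub>K\<^esub>}"
      using that by (auto simp: free_module_carrier elim: finite_subset)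
    then show ?thesis using that by (auto simp: free_module_carrier)
  qed
  show ?thesis
  proof (rule moduleI)
    show "abelian_group ?F"
    proof (rule abelian_groupI)
      fix \<phi> assume \<phi>: "\<phi> \<in> carrier ?F"
      then have "(\<ominus>\<^bsub>K\<^esub> \<one>\<^bsub>K\<^esub>) \<odot>\<^bsub>?F\<^esub> \<phi> \<oplus>\<^bsub>?F\<^esub> \<phi> = \<zero>\<^bsub>?F\<^esub>"
        using closed[OF \<phi>] by (simp add: K.l_minus K.l_neg)
      then show "\<exists>\<psi>\<in>carrier ?F. \<psi> \<oplus>\<^bsub>?F\<^esub> \<phi> = \<zero>\<^bsub>?F\<^esub>"
        using smult[OF _ \<phi>, of "\<ominus>\<^bsub>K\<^esub> \<one>\<^bsub>K\<^esub>"] by auto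
    next
      show "\<zero>\<^bsub>?F\<^esub> \<in> carrier ?F" by (simp add: free_module_carrier)
    next
      fix \<phi> \<psi> assume "\<phi> \<in> carrier ?F" "\<psi> \<in> carrier ?F"
      then show "\<phi> \<oplus>\<^bsub>?F\<^esub> \<psi> \<in> carrier ?F" by (rule add)
    qed (use closed in \<open>auto simp: K.a_ac fun_eq_iff\<close>)
  qed (use add smult closed in \<open>auto simp: K.cring_axioms K.l_distr K.r_distr K.m_assoc\<close>)
qed

lemma basis_vec_closed:
  "cring K \<Longrightarrow> i \<in> I \<Longrightarrow> basis_vec K i \<in> carrier (free_module K I)"
proof -
  assume "cring K" "i \<in> I"
  then interpret K: cring K by simp
  have "{j. basis_vec K i j \<noteq> \<zero>\<^bsub>K\<^esub>} \<subseteq> {i}" by (auto simp: basis_vec_def)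
  then show ?thesis
    using \<open>i \<in> I\<close> finite_subset by (auto simp: free_module_carrier basis_vec_def)
qed

text \<open>Remove one point of the support at a time: \<phi> is a multiple of a basis vector plus
  \<phi> with that coordinate set to zero.\<close>

lemma free_module_induct [consumes 2, case_names zero basis add]:
  assumes "cring K" "\<phi> \<in> carrier (free_module K I)"
    and zero: "P \<zero>\<^bsub>free_module K I\<^esub>"
    and basis: "\<And>a i. a \<in> carrier K \<Longrightarrow> i \<in> I \<Longrightarrow> P (a \<odot>\<^bsub>free_module K I\<^esub> basis_vec K i)"
    and add: "\<And>\<phi> \<psi>. \<phi> \<in> carrier (free_module K I) \<Longrightarrow> \<psi> \<in> carrier (free_module K I) \<Longrightarrow>
      P \<phi> \<Longrightarrow> P \<psi> \<Longrightarrow> P (\<phi> \<oplus>\<^bsub>free_module K I\<^esub> \<psi>)"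
  shows "P \<phi>"
proof -
  interpret K: cring K by fact
  let ?F = "free_module K I"
  interpret F: module K ?F by (rule free_module_module) fact
  \<comment> \<open>The set \<open>A\<close> may exceed the support and may leave \<open>I\<close>;
    points outside \<open>I\<close> carry the value zero and are simply dropped.\<close>
  have "finite A \<Longrightarrow> {i. \<phi> i \<noteq> \<zero>\<^bsub>K\<^esub>} \<subseteq> A \<Longrightarrow> \<phi> \<in> carrier ?F \<Longrightarrow> P \<phi>" for A \<phi>
  proof (induction arbitrary: \<phi> rule: finite_induct)
    case empty
    then have "\<phi> = \<zero>\<^bsub>?F\<^esub>" by (auto simp: fun_eq_iff)
    then show ?case using zero by simp
  next
    case (insert i A)
    note closed = free_module_eval_closed[OF assms(1) \<open>\<phi> \<in> carrier ?F\<close>]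
    show ?case
    proof (cases "i \<in> I")
      case False
      then have "\<phi> i = \<zero>\<^bsub>K\<^esub>" using insert.prems(2) by (simp add: free_module_carrier)
      then have "{j. \<phi> j \<noteq> \<zero>\<^bsub>K\<^esub>} \<subseteq> A" using insert.prems(1) by auto
      then show ?thesis using insert by blast
    next
      case True
      define \<psi> where "\<psi> = \<phi>(i := \<zero>\<^bsub>K\<^esub>)"
      have sub: "{j. \<psi> j \<noteq> \<zero>\<^bsub>K\<^esub>} \<subseteq> A" using insert.prems(1) by (auto simp: \<psi>_def)
      then have \<psi>: "\<psi> \<in> carrier ?F"
        using insert.prems(2) insert.hyps(1) finite_subset[OF sub]
        by (auto simp: free_module_carrier \<psi>_def)
      have "\<phi> = \<phi> i \<odot>\<^bsub>?F\<^esub> basis_vec K i \<oplus>\<^bsub>?F\<^esub> \<psi>"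
        using closed by (auto simp: fun_eq_iff \<psi>_def basis_vec_def)
      moreover have "P (\<phi> i \<odot>\<^bsub>?F\<^esub> basis_vec K i \<oplus>\<^bsub>?F\<^esub> \<psi>)"
        using insert.IH[OF sub \<psi>] \<psi> True closed basis_vec_closed[OF assms(1) True]
        by (intro add basis F.smult_closed) auto
      ultimately show ?thesis by simp
    qed
  qed
  then show ?thesis using assms(2) by (auto simp: free_module_carrier)
qed

text \<open>This is the sum inside \<open>tensor_lift\<close> once a representative is fixed.
  Isolating it allows linearity to be proved before the choice of representative is
  discussed.\<close>

definition free_lift ::
    "('k, 'r) ring_scheme \<Rightarrow> ('k, 'p, 'z) module_scheme \<Rightarrow> ('i \<Rightarrow> 'p) \<Rightarrow> ('i \<Rightarrow> 'k) \<Rightarrow> 'p"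
  where "free_lift K P b \<phi> = (\<Oplus>\<^bsub>P\<^esub>z\<in>{z. \<phi> z \<noteq> \<zero>\<^bsub>K\<^esub>}. \<phi> z \<odot>\<^bsub>P\<^esub> b z)"

text \<open>The index set of \<open>free_lift\<close> varies with \<phi>, which obstructs
  additivity. Padding with zero terms lets several vectors be summed over one common finite
  set.\<close>

lemma free_lift_superset:
  assumes "module K P" "b \<in> I \<rightarrow> carrier P" "\<phi> \<in> carrier (free_module K I)"
    "finite A" "A \<subseteq> I" "{z. \<phi> z \<noteq> \<zero>\<^bsub>K\<^esub>} \<subseteq> A"
  shows "free_lift K P b \<phi> = (\<Oplus>\<^bsub>P\<^esub>z\<in>A. \<phi> z \<odot>\<^bsub>P\<^esub> b z)"
proof -
  interpret P: module K P by fact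
  note closed = free_module_eval_closed[OF P.R.cring_axioms assms(3)]
  show ?thesis
    unfolding free_lift_def
    by (rule P.M.add.finprod_mono_neutral_cong_left) (use assms closed in \<open>auto simp: Pi_iff\<close>)
qed

lemma free_lift_lin:
  assumes "module K P" "b \<in> I \<rightarrow> carrier P"
  shows "free_lift K P b \<in> lin_hom K (free_module K I) P"
proof -
  interpret P: module K P by fact
  let ?F = "free_module K I"
  interpret F: module K ?F by (rule free_module_module) (rule P.R.cring_axioms)
  note closed = free_module_eval_closed[OF P.R.cring_axioms, of _ I]
  let ?supp = "\<lambda>\<phi>. {z. \<phi> z \<noteq> \<zero>\<^bsub>K\<^esub>}"
  have supp: "finite (?supp \<phi>)" "?supp \<phi> \<subseteq> I" if "\<phi> \<in> carrier ?F" for \<phi>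
    using that by (auto simp: free_module_carrier)
  show ?thesis
  proof (rule lin_homI)
    fix \<phi> assume "\<phi> \<in> carrier ?F"
    then show "free_lift K P b \<phi> \<in> carrier P"
      unfolding free_lift_def using supp(2) assms(2) closed
      by (intro P.M.finsum_closed) (auto 0 3 simp: Pi_iff subset_iff)
  next
    fix \<phi> \<psi> assume c: "\<phi> \<in> carrier ?F" "\<psi> \<in> carrier ?F"
    let ?A = "?supp \<phi> \<union> ?supp \<psi>"
    have A: "finite ?A" "?A \<subseteq> I" "?supp \<phi> \<subseteq> ?A" "?supp \<psi> \<subseteq> ?A" "?supp (\<phi> \<oplus>\<^bsub>?F\<^esub> \<psi>) \<subseteq> ?A"
      using supp[OF c(1)] supp[OF c(2)] by auto
    have b: "b z \<in> carrier P" if "z \<in> ?A" for z using A(2) that assms(2) by blast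
    have "(\<Oplus>\<^bsub>P\<^esub>z\<in>?A. (\<phi> \<oplus>\<^bsub>?F\<^esub> \<psi>) z \<odot>\<^bsub>P\<^esub> b z) =
        (\<Oplus>\<^bsub>P\<^esub>z\<in>?A. \<phi> z \<odot>\<^bsub>P\<^esub> b z \<oplus>\<^bsub>P\<^esub> \<psi> z \<odot>\<^bsub>P\<^esub> b z)"
      using c b closed by (intro P.M.finsum_cong') (auto simp: P.smult_l_distr)
    also have "\<dots> = (\<Oplus>\<^bsub>P\<^esub>z\<in>?A. \<phi> z \<odot>\<^bsub>P\<^esub> b z) \<oplus>\<^bsub>P\<^esub> (\<Oplus>\<^bsub>P\<^esub>z\<in>?A. \<psi> z \<odot>\<^bsub>P\<^esub> b z)"
      using c b closed by (intro P.M.finsum_addf) auto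
    finally show "free_lift K P b (\<phi> \<oplus>\<^bsub>?F\<^esub> \<psi>) = free_lift K P b \<phi> \<oplus>\<^bsub>P\<^esub> free_lift K P b \<psi>"
      unfolding free_lift_superset[OF assms F.M.a_closed[OF c] A(1,2,5)]
        free_lift_superset[OF assms c(1) A(1-3)] free_lift_superset[OF assms c(2) A(1,2,4)] .
  next
    fix a \<phi> assume c: "a \<in> carrier K" "\<phi> \<in> carrier ?F"
    have A: "finite (?supp \<phi>)" "?supp \<phi> \<subseteq> I" "?supp (a \<odot>\<^bsub>?F\<^esub> \<phi>) \<subseteq> ?supp \<phi>"
      using supp[OF c(2)] c(1) by auto
    have b: "b z \<in> carrier P" if "z \<in> ?supp \<phi>" for z using A(2) that assms(2) by blast
    show "free_lift K P b (a \<odot>\<^bsub>?F\<^esub> \<phi>) = a \<odot>\<^bsub>P\<^esub> free_lift K P b \<phi>"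
      unfolding free_lift_superset[OF assms F.smult_closed[OF c] A]
        free_lift_superset[OF assms c(2) A(1,2) order_refl]
      using c b closed A(1)
      by (subst P.finsum_smult_ldistr)
        (auto simp: Pi_iff P.smult_assoc1 intro!: P.M.finsum_cong')
  qed
qed

lemma free_lift_basis:
  assumes "module K P" "b \<in> I \<rightarrow> carrier P" "i \<in> I"
  shows "free_lift K P b (basis_vec K i) = b i"
proof -
  interpret P: module K P by fact
  have "b i \<in> carrier P" using assms by auto
  moreover have "{z. basis_vec K i z \<noteq> \<zero>\<^bsub>K\<^esub>} \<subseteq> {i}" by (auto simp: basis_vec_def)
  ultimately show ?thesis
    using free_lift_superset[OF assms(1,2) basis_vec_closed[OF P.R.cring_axioms assms(3)], of "{i}"]
      assms(3)
    by (simp add: basis_vec_def)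
qed

lemma free_hom_ext:
  assumes "cring K" "module K P" "f \<in> lin_hom K (free_module K I) P" "g \<in> lin_hom K (free_module K I) P"
    and "\<And>i. i \<in> I \<Longrightarrow> f (basis_vec K i) = g (basis_vec K i)"
    and "\<phi> \<in> carrier (free_module K I)"
  shows "f \<phi> = g \<phi>"
  using assms(1,6)
proof (induction rule: free_module_induct)
  case zero
  show ?case
    using lin_hom_zero[OF assms(3) free_module_module[OF assms(1)] assms(2)]
      lin_hom_zero[OF assms(4) free_module_module[OF assms(1)] assms(2)] by metis
next
  case (basis a i)
  then show ?case
    using assms(5) basis_vec_closed[OF assms(1)]
    by (metis lin_hom_smult[OF assms(3)] lin_hom_smult[OF assms(4)])
next
  case (add \<phi> \<psi>)
  then show ?case by (metis lin_hom_add[OF assms(3)] lin_hom_add[OF assms(4)])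
qed

declare free_module_simps [simp del]

section \<open>Quotients\<close>

lemma mem_coset: "z \<in> D +>\<^bsub>M\<^esub> x \<longleftrightarrow> (\<exists>d\<in>D. z = d \<oplus>\<^bsub>M\<^esub> x)"
  by (auto simp: a_r_coset_def')

lemma coset_self:
  assumes "module K M" "submodule D K M" "x \<in> carrier M"
  shows "x \<in> D +>\<^bsub>M\<^esub> x"
proof -
  interpret M: module K M by fact
  show ?thesis using submoduleD[OF assms(1,2)] assms(3)
    by (auto simp: mem_coset intro!: bexI[of _ "\<zero>\<^bsub>M\<^esub>"])
qed

lemma coset_eq_iff:
  assumes "module K M" "submodule D K M" "x \<in> carrier M" "y \<in> carrier M"
  shows "D +>\<^bsub>M\<^esub> x = D +>\<^bsub>M\<^esub> y \<longleftrightarrow> x \<ominus>\<^bsub>M\<^esub> y \<in> D"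
proof -
  interpret M: module K M by fact
  note D = submoduleD[OF assms(1,2)]
  show ?thesis
  proof
    assume "D +>\<^bsub>M\<^esub> x = D +>\<^bsub>M\<^esub> y"
    then obtain d where "d \<in> D" "x = d \<oplus>\<^bsub>M\<^esub> y"
      using coset_self[OF assms(1-3)] by (auto simp: mem_coset)
    then show "x \<ominus>\<^bsub>M\<^esub> y \<in> D"
      using assms(4) D by (simp add: a_minus_def M.M.a_assoc M.M.r_neg)
  next
    assume *: "x \<ominus>\<^bsub>M\<^esub> y \<in> D"
    have "x = (x \<ominus>\<^bsub>M\<^esub> y) \<oplus>\<^bsub>M\<^esub> y"
      using assms by (simp add: a_minus_def M.M.a_assoc M.M.l_neg)
    then have "x \<in> D +>\<^bsub>M\<^esub> y" using * by (auto simp: mem_coset)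
    then show "D +>\<^bsub>M\<^esub> x = D +>\<^bsub>M\<^esub> y"
      using M.M.a_repr_independence[of x D y] assms(2,4) unfolding submodule_def by auto
  qed
qed

lemma mem_coset_iff:
  assumes "module K M" "submodule D K M" "x \<in> carrier M"
  shows "z \<in> D +>\<^bsub>M\<^esub> x \<longleftrightarrow> z \<in> carrier M \<and> D +>\<^bsub>M\<^esub> z = D +>\<^bsub>M\<^esub> x"
proof -
  interpret M: module K M by fact
  note D = submoduleD[OF assms(1,2)]
  have "z \<in> carrier M" if "z \<in> D +>\<^bsub>M\<^esub> x" using that assms(3) D by (auto simp: mem_coset)
  moreover have "D +>\<^bsub>M\<^esub> z = D +>\<^bsub>M\<^esub> x" if "z \<in> D +>\<^bsub>M\<^esub> x"
    using M.M.a_repr_independence[of z D x] assms(2,3) that unfolding submodule_def by auto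
  ultimately show ?thesis using coset_self[OF assms(1,2)] by blast
qed

lemma quot_module_carrier: "carrier (quot_module M D) = (\<lambda>x. D +>\<^bsub>M\<^esub> x) ` carrier M"
  by (auto simp: quot_module_def A_RCOSETS_def')

text \<open>The scalar product in \<open>quot_module\<close> is a union over all representatives of
  the coset; it collapses to one coset because the multiples of two representatives differ by a
  multiple of an element of \<open>D\<close>. Writing the zero as a coset fits the form asked for by
  \<open>module_image\<close>.\<close>

lemma quot_module_ops:
  assumes "module K M" "submodule D K M"
  shows "\<zero>\<^bsub>quot_module M D\<^esub> = D +>\<^bsub>M\<^esub> \<zero>\<^bsub>M\<^esub>"
    and "x \<in> carrier M \<Longrightarrow> y \<in> carrier M \<Longrightarrow>
      (D +>\<^bsub>M\<^esub> x) \<oplus>\<^bsub>quot_module M D\<^esub> (D +>\<^bsub>M\<^esub> y) = D +>\<^bsub>M\<^esub> (x \<oplus>\<^bsub>M\<^esub> y)"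
    and "a \<in> carrier K \<Longrightarrow> x \<in> carrier M \<Longrightarrow>
      a \<odot>\<^bsub>quot_module M D\<^esub> (D +>\<^bsub>M\<^esub> x) = D +>\<^bsub>M\<^esub> (a \<odot>\<^bsub>M\<^esub> x)"
proof -
  interpret M: module K M by fact
  note D = submoduleD[OF assms(1,2)]
  interpret D: abelian_subgroup D M
    by (rule abelian_subgroupI3)
      (use assms in \<open>auto intro: additive_subgroup.intro simp: submodule_def M.M.abelian_group_axioms\<close>)
  show "\<zero>\<^bsub>quot_module M D\<^esub> = D +>\<^bsub>M\<^esub> \<zero>\<^bsub>M\<^esub>"
    using D by (simp add: quot_module_def D.a_subset)
  show "(D +>\<^bsub>M\<^esub> x) \<oplus>\<^bsub>quot_module M D\<^esub> (D +>\<^bsub>M\<^esub> y) = D +>\<^bsub>M\<^esub> (x \<oplus>\<^bsub>M\<^esub> y)"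
    if "x \<in> carrier M" "y \<in> carrier M"
    using that by (simp add: quot_module_def D.a_rcos_sum)
  show "a \<odot>\<^bsub>quot_module M D\<^esub> (D +>\<^bsub>M\<^esub> x) = D +>\<^bsub>M\<^esub> (a \<odot>\<^bsub>M\<^esub> x)"
    if a: "a \<in> carrier K" and x: "x \<in> carrier M"
  proof -
    have "D +>\<^bsub>M\<^esub> (a \<odot>\<^bsub>M\<^esub> z) = D +>\<^bsub>M\<^esub> (a \<odot>\<^bsub>M\<^esub> x)" if z: "z \<in> D +>\<^bsub>M\<^esub> x" for z
    proof -
      obtain d where d: "d \<in> D" "z = d \<oplus>\<^bsub>M\<^esub> x" using z by (auto simp: mem_coset)
      then have "a \<odot>\<^bsub>M\<^esub> z \<ominus>\<^bsub>M\<^esub> a \<odot>\<^bsub>M\<^esub> x = a \<odot>\<^bsub>M\<^esub> d"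
        using a x D by (simp add: M.smult_r_distr a_minus_def M.M.a_assoc M.M.r_neg)
      then show ?thesis
        using a x d D by (subst coset_eq_iff[OF assms]) auto
    qed
    moreover have "D +>\<^bsub>M\<^esub> x \<noteq> {}" using coset_self[OF assms x] by auto
    ultimately show ?thesis by (auto simp: quot_module_def)
  qed
qed

lemma quot_module_module: "module K M \<Longrightarrow> submodule D K M \<Longrightarrow> module K (quot_module M D)"
  by (rule module_image[OF _ quot_module_carrier])
    (auto simp: quot_module_ops)

lemma quot_proj_lin:
  "module K M \<Longrightarrow> submodule D K M \<Longrightarrow> (\<lambda>x. D +>\<^bsub>M\<^esub> x) \<in> lin_hom K M (quot_module M D)"
  by (rule lin_homI) (auto simp: quot_module_ops quot_module_carrier)

section \<open>Tensor products\<close>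

definition bilinear_map ::
    "('k, 'r) ring_scheme \<Rightarrow> ('k, 'm, 'x) module_scheme \<Rightarrow> ('k, 'n, 'y) module_scheme \<Rightarrow>
     ('k, 'p, 'z) module_scheme \<Rightarrow> ('m \<Rightarrow> 'n \<Rightarrow> 'p) \<Rightarrow> bool"
  where "bilinear_map K M N P \<beta> \<longleftrightarrow>
    (\<forall>y\<in>carrier N. (\<lambda>x. \<beta> x y) \<in> lin_hom K M P) \<and> (\<forall>x\<in>carrier M. \<beta> x \<in> lin_hom K N P)"

lemma bilinear_mapD:
  assumes "bilinear_map K M N P \<beta>"
  shows "y \<in> carrier N \<Longrightarrow> (\<lambda>x. \<beta> x y) \<in> lin_hom K M P"
    and "x \<in> carrier M \<Longrightarrow> \<beta> x \<in> lin_hom K N P"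
    and "x \<in> carrier M \<Longrightarrow> y \<in> carrier N \<Longrightarrow> \<beta> x y \<in> carrier P"
  using assms by (auto simp: bilinear_map_def lin_hom_def)

lemma bilinear_map_simps:
  assumes "bilinear_map K M N P \<beta>"
  shows "x \<in> carrier M \<Longrightarrow> x' \<in> carrier M \<Longrightarrow> y \<in> carrier N \<Longrightarrow> \<beta> (x \<oplus>\<^bsub>M\<^esub> x') y = \<beta> x y \<oplus>\<^bsub>P\<^esub> \<beta> x' y"
    and "x \<in> carrier M \<Longrightarrow> y \<in> carrier N \<Longrightarrow> y' \<in> carrier N \<Longrightarrow> \<beta> x (y \<oplus>\<^bsub>N\<^esub> y') = \<beta> x y \<oplus>\<^bsub>P\<^esub> \<beta> x y'"
    and "a \<in> carrier K \<Longrightarrow> x \<in> carrier M \<Longrightarrow> y \<in> carrier N \<Longrightarrow> \<beta> (a \<odot>\<^bsub>M\<^esub> x) y = a \<odot>\<^bsub>P\<^esub> \<beta> x y"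
    and "a \<in> carrier K \<Longrightarrow> x \<in> carrier M \<Longrightarrow> y \<in> carrier N \<Longrightarrow> \<beta> x (a \<odot>\<^bsub>N\<^esub> y) = a \<odot>\<^bsub>P\<^esub> \<beta> x y"
  using assms by (auto simp: bilinear_map_def lin_hom_def)

lemma bilinear_map_pre:
  "bilinear_map K M' N' P \<beta> \<Longrightarrow> f \<in> lin_hom K M M' \<Longrightarrow> g \<in> lin_hom K N N' \<Longrightarrow>
    bilinear_map K M N P (\<lambda>x y. \<beta> (f x) (g y))"
  by (simp add: bilinear_map_def lin_hom_def Pi_iff)

lemma bilinear_map_post:
  "bilinear_map K M N P \<beta> \<Longrightarrow> h \<in> lin_hom K P Q \<Longrightarrow> bilinear_map K M N Q (\<lambda>x y. h (\<beta> x y))"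
  by (simp add: bilinear_map_def lin_hom_def Pi_iff)

lemma tensor_relators_mem:
  fixes K M N
  defines "F \<equiv> free_module K (carrier M \<times> carrier N)"
  shows "x \<in> carrier M \<Longrightarrow> x' \<in> carrier M \<Longrightarrow> y \<in> carrier N \<Longrightarrow>
      basis_vec K (x \<oplus>\<^bsub>M\<^esub> x', y) \<ominus>\<^bsub>F\<^esub> (basis_vec K (x, y) \<oplus>\<^bsub>F\<^esub> basis_vec K (x', y))
      \<in> tensor_relators K M N"
    and "x \<in> carrier M \<Longrightarrow> y \<in> carrier N \<Longrightarrow> y' \<in> carrier N \<Longrightarrow>
      basis_vec K (x, y \<oplus>\<^bsub>N\<^esub> y') \<ominus>\<^bsub>F\<^esub> (basis_vec K (x, y) \<oplus>\<^bsub>F\<^esub> basis_vec K (x, y'))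
      \<in> tensor_relators K M N"
    and "a \<in> carrier K \<Longrightarrow> x \<in> carrier M \<Longrightarrow> y \<in> carrier N \<Longrightarrow>
      basis_vec K (a \<odot>\<^bsub>M\<^esub> x, y) \<ominus>\<^bsub>F\<^esub> a \<odot>\<^bsub>F\<^esub> basis_vec K (x, y) \<in> tensor_relators K M N"
    and "a \<in> carrier K \<Longrightarrow> x \<in> carrier M \<Longrightarrow> y \<in> carrier N \<Longrightarrow>
      basis_vec K (x, a \<odot>\<^bsub>N\<^esub> y) \<ominus>\<^bsub>F\<^esub> a \<odot>\<^bsub>F\<^esub> basis_vec K (x, y) \<in> tensor_relators K M N"
  unfolding tensor_relators_def Let_def F_def by blast+

lemma tensor_relators_cases:
  fixes K M N
  defines "F \<equiv> free_module K (carrier M \<times> carrier N)"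
  assumes "\<rho> \<in> tensor_relators K M N"
  obtains (addl) x x' y where "x \<in> carrier M" "x' \<in> carrier M" "y \<in> carrier N"
      "\<rho> = basis_vec K (x \<oplus>\<^bsub>M\<^esub> x', y) \<ominus>\<^bsub>F\<^esub> (basis_vec K (x, y) \<oplus>\<^bsub>F\<^esub> basis_vec K (x', y))"
    | (addr) x y y' where "x \<in> carrier M" "y \<in> carrier N" "y' \<in> carrier N"
      "\<rho> = basis_vec K (x, y \<oplus>\<^bsub>N\<^esub> y') \<ominus>\<^bsub>F\<^esub> (basis_vec K (x, y) \<oplus>\<^bsub>F\<^esub> basis_vec K (x, y'))"
    | (smultl) a x y where "a \<in> carrier K" "x \<in> carrier M" "y \<in> carrier N"
      "\<rho> = basis_vec K (a \<odot>\<^bsub>M\<^esub> x, y) \<ominus>\<^bsub>F\<^esub> a \<odot>\<^bsub>F\<^esub> basis_vec K (x, y)"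
    | (smultr) a x y where "a \<in> carrier K" "x \<in> carrier M" "y \<in> carrier N"
      "\<rho> = basis_vec K (x, a \<odot>\<^bsub>N\<^esub> y) \<ominus>\<^bsub>F\<^esub> a \<odot>\<^bsub>F\<^esub> basis_vec K (x, y)"
  using assms(2) unfolding tensor_relators_def Let_def F_def by blast

section \<open>The universal property of the tensor product\<close>

context
  fixes K :: "('k, 'r) ring_scheme" and M :: "('k, 'm, 'x) module_scheme"
    and N :: "('k, 'n, 'y) module_scheme"
  assumes M: "module K M" and N: "module K N"
begin

interpretation M: module K M by (rule M)
interpretation N: module K N by (rule N)

abbreviation (input) "free_pairs \<equiv> free_module K (carrier M \<times> carrier N)"

interpretation F: module K free_pairs
  by (rule free_module_module) (rule M.R.cring_axioms)

lemma basis_pair_closed: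
  "x \<in> carrier M \<Longrightarrow> y \<in> carrier N \<Longrightarrow> basis_vec K (x, y) \<in> carrier free_pairs"
  by (rule basis_vec_closed) (auto simp: M.R.cring_axioms)

lemma tensor_relators_closed: "tensor_relators K M N \<subseteq> carrier free_pairs"
proof
  fix \<rho> assume "\<rho> \<in> tensor_relators K M N"
  then show "\<rho> \<in> carrier free_pairs"
    by (cases rule: tensor_relators_cases) (auto intro!: basis_pair_closed)
qed

lemma tensor_kernel_submodule: "submodule (tensor_kernel K M N) K free_pairs"
  unfolding tensor_kernel_def
  by (rule lin_span_submodule[OF F.module_axioms tensor_relators_closed])

lemma tensor_kernel_relator: "\<rho> \<in> tensor_relators K M N \<Longrightarrow> \<rho> \<in> tensor_kernel K M N"
  unfolding tensor_kernel_def by (rule lin_span_mono)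

lemma tensor_module: "module K (tensor K M N)"
  unfolding tensor_def by (rule quot_module_module[OF F.module_axioms tensor_kernel_submodule])

interpretation T: module K "tensor K M N" by (rule tensor_module)

lemma tensor_proj_lin: "(\<lambda>\<phi>. tensor_kernel K M N +>\<^bsub>free_pairs\<^esub> \<phi>) \<in> lin_hom K free_pairs (tensor K M N)"
  unfolding tensor_def by (rule quot_proj_lin[OF F.module_axioms tensor_kernel_submodule])

lemma tensor_carrierE:
  assumes "t \<in> carrier (tensor K M N)"
  obtains \<phi> where "\<phi> \<in> carrier free_pairs" "t = tensor_kernel K M N +>\<^bsub>free_pairs\<^esub> \<phi>"
  using assms by (auto simp: tensor_def quot_module_carrier)

lemma pure_tensor_closed:
  "x \<in> carrier M \<Longrightarrow> y \<in> carrier N \<Longrightarrow> pure_tensor K M N x y \<in> carrier (tensor K M N)"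
  unfolding pure_tensor_def by (rule lin_hom_closed[OF tensor_proj_lin basis_pair_closed])

text \<open>Each identity is an equality of two cosets whose representatives differ by one of the
  bilinearity relators.\<close>

lemma pure_tensor_linear:
  shows pure_tensor_add_left: "x \<in> carrier M \<Longrightarrow> x' \<in> carrier M \<Longrightarrow> y \<in> carrier N \<Longrightarrow>
      pure_tensor K M N (x \<oplus>\<^bsub>M\<^esub> x') y =
      pure_tensor K M N x y \<oplus>\<^bsub>tensor K M N\<^esub> pure_tensor K M N x' y"
    and pure_tensor_add_right: "x \<in> carrier M \<Longrightarrow> y \<in> carrier N \<Longrightarrow> y' \<in> carrier N \<Longrightarrow>
      pure_tensor K M N x (y \<oplus>\<^bsub>N\<^esub> y') =
      pure_tensor K M N x y \<oplus>\<^bsub>tensor K M N\<^esub> pure_tensor K M N x y'"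
    and pure_tensor_smult_left: "a \<in> carrier K \<Longrightarrow> x \<in> carrier M \<Longrightarrow> y \<in> carrier N \<Longrightarrow>
      pure_tensor K M N (a \<odot>\<^bsub>M\<^esub> x) y = a \<odot>\<^bsub>tensor K M N\<^esub> pure_tensor K M N x y"
    and pure_tensor_smult_right: "a \<in> carrier K \<Longrightarrow> x \<in> carrier M \<Longrightarrow> y \<in> carrier N \<Longrightarrow>
      pure_tensor K M N x (a \<odot>\<^bsub>N\<^esub> y) = a \<odot>\<^bsub>tensor K M N\<^esub> pure_tensor K M N x y"
  unfolding pure_tensor_def
  by (simp_all add: lin_hom_add[OF tensor_proj_lin, symmetric] lin_hom_smult[OF tensor_proj_lin, symmetric]
      basis_pair_closed coset_eq_iff[OF F.module_axioms tensor_kernel_submodule]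
      tensor_kernel_relator tensor_relators_mem)

lemma pure_tensor_bilinear: "bilinear_map K M N (tensor K M N) (pure_tensor K M N)"
  unfolding bilinear_map_def by (auto intro!: lin_homI pure_tensor_closed simp: pure_tensor_linear)

text \<open>There is no case for scalars: a multiple of a pure tensor is again pure, the scalar
  being moved into the left factor.\<close>

lemma tensor_induct [consumes 1, case_names zero pure add]:
  assumes "t \<in> carrier (tensor K M N)"
    and zero: "P \<zero>\<^bsub>tensor K M N\<^esub>"
    and pure: "\<And>x y. x \<in> carrier M \<Longrightarrow> y \<in> carrier N \<Longrightarrow> P (pure_tensor K M N x y)"
    and add: "\<And>t u. t \<in> carrier (tensor K M N) \<Longrightarrow> u \<in> carrier (tensor K M N) \<Longrightarrow> P t \<Longrightarrow> P u \<Longrightarrow>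
      P (t \<oplus>\<^bsub>tensor K M N\<^esub> u)"
  shows "P t"
proof -
  let ?\<pi> = "\<lambda>\<phi>. tensor_kernel K M N +>\<^bsub>free_pairs\<^esub> \<phi>"
  have "P (?\<pi> \<phi>)" if "\<phi> \<in> carrier free_pairs" for \<phi>
    using M.R.cring_axioms that
  proof (induction rule: free_module_induct)
    case zero
    then show ?case
      using assms(2) lin_hom_zero[OF tensor_proj_lin F.module_axioms T.module_axioms] by simp
  next
    case (basis a i)
    then obtain x y where i: "i = (x, y)" "x \<in> carrier M" "y \<in> carrier N" by auto
    have "?\<pi> (a \<odot>\<^bsub>free_pairs\<^esub> basis_vec K i) = a \<odot>\<^bsub>tensor K M N\<^esub> pure_tensor K M N x y"
      using i basis unfolding pure_tensor_def
      by (simp add: lin_hom_smult[OF tensor_proj_lin] basis_pair_closed)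
    also have "\<dots> = pure_tensor K M N (a \<odot>\<^bsub>M\<^esub> x) y"
      using i basis by (simp add: pure_tensor_smult_left)
    finally show ?case using pure i basis by simp
  next
    case (add \<phi> \<psi>)
    then show ?case
      using assms(4) by (simp add: lin_hom_add[OF tensor_proj_lin] lin_hom_closed[OF tensor_proj_lin])
  qed
  then show ?thesis using assms(1) by (auto elim: tensor_carrierE)
qed

lemma tensor_ext:
  assumes P: "module K P"
    and f: "f \<in> lin_hom K (tensor K M N) P" and g: "g \<in> lin_hom K (tensor K M N) P"
    and eq: "\<And>x y. x \<in> carrier M \<Longrightarrow> y \<in> carrier N \<Longrightarrow>
      f (pure_tensor K M N x y) = g (pure_tensor K M N x y)"
    and t: "t \<in> carrier (tensor K M N)"
  shows "f t = g t"
  using t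
proof (induction rule: tensor_induct)
  case zero
  show ?case
    using lin_hom_zero[OF f tensor_module P] lin_hom_zero[OF g tensor_module P] by simp
qed (auto simp: eq lin_hom_add[OF f] lin_hom_add[OF g])

text \<open>Bilinearity makes \<open>free_lift\<close> vanish on the relators, hence on their span.
  The value is therefore the same at every representative of the coset.\<close>

lemma tensor_lift_coset:
  assumes P: "module K P" and \<beta>: "bilinear_map K M N P \<beta>" and \<phi>: "\<phi> \<in> carrier free_pairs"
  shows "tensor_lift K P \<beta> (tensor_kernel K M N +>\<^bsub>free_pairs\<^esub> \<phi>) =
    free_lift K P (\<lambda>z. \<beta> (fst z) (snd z)) \<phi>"
proof -
  interpret P: module K P by (rule P)
  let ?b = "\<lambda>z. \<beta> (fst z) (snd z)"
  note \<beta>D = bilinear_mapD[OF \<beta>]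
  have b: "?b \<in> carrier M \<times> carrier N \<rightarrow> carrier P" using \<beta>D by auto
  note L = free_lift_lin[OF P b]
  note L_simps = lin_hom_minus[OF L F.module_axioms P] lin_hom_add[OF L] lin_hom_smult[OF L]
  have e: "free_lift K P ?b (basis_vec K (x, y)) = \<beta> x y" if "x \<in> carrier M" "y \<in> carrier N" for x y
    using that by (simp add: free_lift_basis[OF P b])
  have diff: "p \<ominus>\<^bsub>P\<^esub> p = \<zero>\<^bsub>P\<^esub>" if "p \<in> carrier P" for p
    using that by (simp add: a_minus_def P.M.r_neg)
  let ?H = "{\<psi> \<in> carrier free_pairs. free_lift K P ?b \<psi> \<in> {\<zero>\<^bsub>P\<^esub>}}"
  have "tensor_relators K M N \<subseteq> ?H"
  proof
    fix \<rho> assume "\<rho> \<in> tensor_relators K M N"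
    then have "free_lift K P ?b \<rho> = \<zero>\<^bsub>P\<^esub>"
      by (cases rule: tensor_relators_cases)
        (simp_all add: L_simps basis_pair_closed e bilinear_map_simps[OF \<beta>] \<beta>D diff)
    then show "\<rho> \<in> ?H" using tensor_relators_closed \<open>\<rho> \<in> _\<close> by auto
  qed
  then have ker: "tensor_kernel K M N \<subseteq> ?H"
    unfolding tensor_kernel_def
    by (intro lin_span_minimal submodule_vimage[OF L F.module_axioms P submodule_zero] P)
  \<comment> \<open>\<psi> is the representative that \<open>tensor_lift\<close> itself
    picks.\<close>
  define \<psi> where "\<psi> = (SOME \<psi>. \<psi> \<in> tensor_kernel K M N +>\<^bsub>free_pairs\<^esub> \<phi>)"
  have "\<psi> \<in> tensor_kernel K M N +>\<^bsub>free_pairs\<^esub> \<phi>"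
    unfolding \<psi>_def some_in_eq
    using coset_self[OF F.module_axioms tensor_kernel_submodule \<phi>] by auto
  then obtain d where d: "d \<in> tensor_kernel K M N" "\<psi> = d \<oplus>\<^bsub>free_pairs\<^esub> \<phi>" by (auto simp: mem_coset)
  then have "free_lift K P ?b \<psi> = free_lift K P ?b \<phi>"
    using ker \<phi> lin_hom_closed[OF L \<phi>] by (auto simp: L_simps)
  then show ?thesis
    unfolding tensor_lift_def \<psi>_def[symmetric] Let_def by (simp add: free_lift_def)
qed

lemma tensor_lift_pure:
  assumes P: "module K P" and \<beta>: "bilinear_map K M N P \<beta>" and "x \<in> carrier M" "y \<in> carrier N"
  shows "tensor_lift K P \<beta> (pure_tensor K M N x y) = \<beta> x y"
  unfolding pure_tensor_def using assms
  by (subst tensor_lift_coset[OF P \<beta>])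
    (auto simp: basis_pair_closed bilinear_mapD[OF \<beta>] intro: free_lift_basis[OF P, THEN trans])

lemma tensor_lift_lin:
  assumes P: "module K P" and \<beta>: "bilinear_map K M N P \<beta>"
  shows "tensor_lift K P \<beta> \<in> lin_hom K (tensor K M N) P"
proof -
  let ?b = "\<lambda>z. \<beta> (fst z) (snd z)"
  have b: "?b \<in> carrier M \<times> carrier N \<rightarrow> carrier P" using bilinear_mapD[OF \<beta>] by auto
  note L = free_lift_lin[OF P b]
  show ?thesis
  proof (rule lin_homI)
    fix t assume "t \<in> carrier (tensor K M N)"
    then show "tensor_lift K P \<beta> t \<in> carrier P"
      by (auto elim!: tensor_carrierE simp: tensor_lift_coset[OF P \<beta>] lin_hom_closed[OF L])
  next
    fix t u assume "t \<in> carrier (tensor K M N)" "u \<in> carrier (tensor K M N)"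
    then show "tensor_lift K P \<beta> (t \<oplus>\<^bsub>tensor K M N\<^esub> u) = tensor_lift K P \<beta> t \<oplus>\<^bsub>P\<^esub> tensor_lift K P \<beta> u"
      by (auto elim!: tensor_carrierE simp: lin_hom_add[OF tensor_proj_lin, symmetric]
          tensor_lift_coset[OF P \<beta>] lin_hom_add[OF L])
  next
    fix a t assume "a \<in> carrier K" "t \<in> carrier (tensor K M N)"
    then show "tensor_lift K P \<beta> (a \<odot>\<^bsub>tensor K M N\<^esub> t) = a \<odot>\<^bsub>P\<^esub> tensor_lift K P \<beta> t"
      by (auto elim!: tensor_carrierE simp: lin_hom_smult[OF tensor_proj_lin, symmetric]
          tensor_lift_coset[OF P \<beta>] lin_hom_smult[OF L])
  qed
qed

end

text \<open>Both orders occur: the form sits on the left factor in \<open>contract\<close> and on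
  the right factor in \<open>right_act\<close>. With \<open>h\<close> the identity these are plain
  contractions; other choices of \<open>h\<close> give products of forms and contractions of
  threefold tensors.\<close>

lemma smult_form_bilinear:
  assumes "module K M" "module K N" "module K P" "f \<in> lin_hom K M (scalar_module K)" "h \<in> lin_hom K N P"
  shows "bilinear_map K M N P (\<lambda>x y. f x \<odot>\<^bsub>P\<^esub> h y)"
    and "bilinear_map K N M P (\<lambda>y x. f x \<odot>\<^bsub>P\<^esub> h y)"
proof -
  interpret P: module K P by fact
  have f: "f x \<in> carrier K" if "x \<in> carrier M" for x using lin_hom_closed[OF assms(4) that] by simp
  have *: "(\<lambda>x. f x \<odot>\<^bsub>P\<^esub> h y) \<in> lin_hom K M P" if "y \<in> carrier N" for y
    using lin_hom_closed[OF assms(5) that] f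
    by (intro lin_homI)
      (auto simp: lin_hom_add[OF assms(4)] lin_hom_smult[OF assms(4)] P.smult_l_distr P.smult_assoc1)
  have **: "(\<lambda>y. f x \<odot>\<^bsub>P\<^esub> h y) \<in> lin_hom K N P" if "x \<in> carrier M" for x
    using lin_hom_closed[OF assms(5)] f[OF that]
    by (intro lin_homI)
      (auto simp: lin_hom_add[OF assms(5)] lin_hom_smult[OF assms(5)] P.smult_r_distr
        P.smult_assoc1[symmetric] P.R.m_comm)
  show "bilinear_map K M N P (\<lambda>x y. f x \<odot>\<^bsub>P\<^esub> h y)" "bilinear_map K N M P (\<lambda>y x. f x \<odot>\<^bsub>P\<^esub> h y)"
    using * ** by (auto simp: bilinear_map_def)
qed

lemma pure_tensor_map_bilinear:
  assumes "module K M" "module K N" "module K M'" "module K N'"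
    "f \<in> lin_hom K M M'" "g \<in> lin_hom K N N'"
  shows "bilinear_map K M N (tensor K M' N') (\<lambda>x y. pure_tensor K M' N' (f x) (g y))"
  by (rule bilinear_map_pre[OF pure_tensor_bilinear[OF assms(3,4)] assms(5,6)])

lemma tensor_map_lin:
  assumes "module K M" "module K N" "module K M'" "module K N'"
    "f \<in> lin_hom K M M'" "g \<in> lin_hom K N N'"
  shows "tensor_map K M' N' f g \<in> lin_hom K (tensor K M N) (tensor K M' N')"
  unfolding tensor_map_def
  by (rule tensor_lift_lin[OF assms(1,2) tensor_module[OF assms(3,4)] pure_tensor_map_bilinear[OF assms]])

lemma tensor_lift_map:
  assumes "module K M" "module K N" "module K M'" "module K N'" "module K P"
    and "f \<in> lin_hom K M M'" "g \<in> lin_hom K N N'" "bilinear_map K M' N' P \<beta>"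
    and "t \<in> carrier (tensor K M N)"
  shows "tensor_lift K P \<beta> (tensor_map K M' N' f g t) = tensor_lift K P (\<lambda>x y. \<beta> (f x) (g y)) t"
proof -
  have \<beta>: "bilinear_map K M N P (\<lambda>x y. \<beta> (f x) (g y))"
    by (rule bilinear_map_pre[OF assms(8,6,7)])
  note map = tensor_map_lin[OF assms(1-4,6,7)]
  note lift = tensor_lift_lin[OF assms(3-5,8)]
  show ?thesis
  proof (rule tensor_ext[OF assms(1,2,5) lin_hom_comp[OF map lift] tensor_lift_lin[OF assms(1,2,5) \<beta>] _ assms(9)])
    fix x y assume xy: "x \<in> carrier M" "y \<in> carrier N"
    then show "tensor_lift K P \<beta> (tensor_map K M' N' f g (pure_tensor K M N x y)) =
        tensor_lift K P (\<lambda>x y. \<beta> (f x) (g y)) (pure_tensor K M N x y)"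
      using lin_hom_closed[OF assms(6)] lin_hom_closed[OF assms(7)]
      by (simp add: tensor_map_def tensor_lift_pure[OF assms(1,2,5) \<beta>]
          tensor_lift_pure[OF assms(1,2) tensor_module[OF assms(3,4)] pure_tensor_map_bilinear[OF assms(1-4,6,7)]]
          tensor_lift_pure[OF assms(3-5,8)])
  qed
qed

lemma lin_hom_tensor_lift:
  assumes "module K M" "module K N" "module K P" "module K Q"
    and "bilinear_map K M N P \<beta>" "h \<in> lin_hom K P Q" "t \<in> carrier (tensor K M N)"
  shows "h (tensor_lift K P \<beta> t) = tensor_lift K Q (\<lambda>x y. h (\<beta> x y)) t"
proof -
  have \<beta>: "bilinear_map K M N Q (\<lambda>x y. h (\<beta> x y))"
    by (rule bilinear_map_post[OF assms(5,6)])
  show ?thesis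
    by (rule tensor_ext[OF assms(1,2,4) lin_hom_comp[OF tensor_lift_lin[OF assms(1-3,5)] assms(6)]
          tensor_lift_lin[OF assms(1,2,4) \<beta>] _ assms(7)])
      (simp add: tensor_lift_pure[OF assms(1-3,5)] tensor_lift_pure[OF assms(1,2,4) \<beta>])
qed

lemma tensor_lift_cong:
  assumes "module K M" "module K N" "module K P" "bilinear_map K M N P \<beta>" "bilinear_map K M N P \<beta>'"
    and "\<And>x y. x \<in> carrier M \<Longrightarrow> y \<in> carrier N \<Longrightarrow> \<beta> x y = \<beta>' x y"
    and "t \<in> carrier (tensor K M N)"
  shows "tensor_lift K P \<beta> t = tensor_lift K P \<beta>' t"
  by (rule tensor_ext[OF assms(1-3) tensor_lift_lin[OF assms(1-4)] tensor_lift_lin[OF assms(1-3,5)] _ assms(7)])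
    (simp add: tensor_lift_pure[OF assms(1-4)] tensor_lift_pure[OF assms(1-3,5)] assms(6))

section \<open>Separation by linear forms\<close>

text \<open>Zorn's lemma gives \<open>W\<close> maximal among the subspaces that contain
  \<open>H\<close> and miss \<open>x\<close>. Maximality makes every vector congruent modulo
  \<open>W\<close> to exactly one multiple of \<open>x\<close>, and \<open>f\<close> reads off the
  coefficient.\<close>

lemma linear_form_separation:
  assumes "field K" "module K M" "submodule H K M" "x \<in> carrier M" "x \<notin> H"
  obtains f where "f \<in> lin_hom K M (scalar_module K)" "\<And>h. h \<in> H \<Longrightarrow> f h = \<zero>\<^bsub>K\<^esub>" "f x = \<one>\<^bsub>K\<^esub>"
proof -
  interpret K: field K by fact
  interpret M: module K M by fact
  define \<A> where "\<A> = {W. submodule W K M \<and> H \<subseteq> W \<and> x \<notin> W}"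
  have "\<exists>W\<in>\<A>. \<forall>X\<in>\<A>. W \<subseteq> X \<longrightarrow> X = W"
  proof (rule subset_Zorn_nonempty)
    show "\<A> \<noteq> {}" using assms by (auto simp: \<A>_def)
  next
    fix \<C> assume ne: "\<C> \<noteq> {}" and ch: "subset.chain \<A> \<C>"
    have sub: "submodule W K M" if "W \<in> \<C>" for W
      using ch that by (auto simp: subset_chain_def \<A>_def)
    note D = submoduleD[OF assms(2) sub]
    have "submodule (\<Union>\<C>) K M"
    proof (rule submodule_crit[OF assms(2)])
      show "\<Union>\<C> \<subseteq> carrier M" "\<zero>\<^bsub>M\<^esub> \<in> \<Union>\<C>" using D ne by blast+
      show "u \<oplus>\<^bsub>M\<^esub> v \<in> \<Union>\<C>" if uv: "u \<in> \<Union>\<C>" "v \<in> \<Union>\<C>" for u v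
      proof -
        obtain U V where *: "U \<in> \<C>" "V \<in> \<C>" "u \<in> U" "v \<in> V" using uv by blast
        then have "U \<subseteq> V \<or> V \<subseteq> U" using ch by (auto simp: subset_chain_def)
        then show ?thesis using * D(3) by (metis UnionI subsetD)
      qed
      show "a \<odot>\<^bsub>M\<^esub> u \<in> \<Union>\<C>" if "a \<in> carrier K" "u \<in> \<Union>\<C>" for a u
        using that D(4) by blast
    qed
    then show "\<Union>\<C> \<in> \<A>" using ch ne by (auto simp: subset_chain_def \<A>_def)
  qed
  then obtain W where W: "submodule W K M" "H \<subseteq> W" "x \<notin> W"
    and max: "\<And>X. submodule X K M \<Longrightarrow> W \<subseteq> X \<Longrightarrow> x \<notin> X \<Longrightarrow> X = W"
    unfolding \<A>_def by (metis (mono_tags, lifting) mem_Collect_eq subset_trans)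
  note D = submoduleD[OF assms(2) W(1)]
  have inv: "inv\<^bsub>K\<^esub> b \<in> carrier K" "inv\<^bsub>K\<^esub> b \<otimes>\<^bsub>K\<^esub> b = \<one>\<^bsub>K\<^esub>" if "b \<in> carrier K" "b \<noteq> \<zero>\<^bsub>K\<^esub>" for b
    using that K.field_Units by auto
  have minus_zero: "\<ominus>\<^bsub>M\<^esub> \<zero>\<^bsub>M\<^esub> = \<zero>\<^bsub>M\<^esub>" by (simp add: M.M.minus_equality)
  have ex: "\<exists>a\<in>carrier K. v \<ominus>\<^bsub>M\<^esub> a \<odot>\<^bsub>M\<^esub> x \<in> W" if v: "v \<in> carrier M" for v
  proof (cases "v \<in> W")
    case True
    then show ?thesis using assms(4) v by (intro bexI[of _ "\<zero>\<^bsub>K\<^esub>"]) (auto simp: a_minus_def minus_zero)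
  next
    case False
    \<comment> \<open>\<open>V\<close> is W + K v. It is strictly larger than \<open>W\<close>, so
      maximality puts \<open>x\<close> into it; solving x = w + b v for v gives the coefficient
      inverse to b.\<close>
    define V where "V = {w \<oplus>\<^bsub>M\<^esub> b \<odot>\<^bsub>M\<^esub> v | w b. w \<in> W \<and> b \<in> carrier K}"
    have VI: "w \<oplus>\<^bsub>M\<^esub> b \<odot>\<^bsub>M\<^esub> v \<in> V" if "w \<in> W" "b \<in> carrier K" for w b
      using that by (auto simp: V_def)
    have "submodule V K M"
    proof (rule submodule_crit[OF assms(2)])
      show "V \<subseteq> carrier M" using v D(1) by (auto simp: V_def)
      show "\<zero>\<^bsub>M\<^esub> \<in> V" using VI[OF D(2) K.zero_closed] v by simp
    next
      fix p q assume "p \<in> V" "q \<in> V"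
      then obtain w b w' b' where *: "w \<in> W" "b \<in> carrier K" "p = w \<oplus>\<^bsub>M\<^esub> b \<odot>\<^bsub>M\<^esub> v"
        "w' \<in> W" "b' \<in> carrier K" "q = w' \<oplus>\<^bsub>M\<^esub> b' \<odot>\<^bsub>M\<^esub> v"
        by (auto simp: V_def)
      then have "p \<oplus>\<^bsub>M\<^esub> q = (w \<oplus>\<^bsub>M\<^esub> w') \<oplus>\<^bsub>M\<^esub> (b \<oplus>\<^bsub>K\<^esub> b') \<odot>\<^bsub>M\<^esub> v"
        using v D(1) by (simp add: M.smult_l_distr M.M.a_ac)
      then show "p \<oplus>\<^bsub>M\<^esub> q \<in> V" using VI * D(3) by simp
    next
      fix a p assume a: "a \<in> carrier K" and "p \<in> V"
      then obtain w b where *: "w \<in> W" "b \<in> carrier K" "p = w \<oplus>\<^bsub>M\<^esub> b \<odot>\<^bsub>M\<^esub> v"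
        by (auto simp: V_def)
      then have "a \<odot>\<^bsub>M\<^esub> p = a \<odot>\<^bsub>M\<^esub> w \<oplus>\<^bsub>M\<^esub> (a \<otimes>\<^bsub>K\<^esub> b) \<odot>\<^bsub>M\<^esub> v"
        using a v D(1) by (simp add: M.smult_r_distr M.smult_assoc1)
      then show "a \<odot>\<^bsub>M\<^esub> p \<in> V" using VI * D(4) a by simp
    qed
    moreover have "W \<subseteq> V"
    proof
      fix w assume "w \<in> W"
      then show "w \<in> V" using VI[OF _ K.zero_closed, of w] v D(1) by simp
    qed
    moreover have "v \<in> V" using VI[OF D(2) K.one_closed] v by simp
    ultimately have "x \<in> V" using max False by blast
    then obtain w b where wb: "w \<in> W" "b \<in> carrier K" "x = w \<oplus>\<^bsub>M\<^esub> b \<odot>\<^bsub>M\<^esub> v"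
      by (auto simp: V_def)
    have "b \<noteq> \<zero>\<^bsub>K\<^esub>" using wb W(3) v D(1) by auto
    note inv = inv[OF wb(2) this]
    have "inv\<^bsub>K\<^esub> b \<odot>\<^bsub>M\<^esub> x = inv\<^bsub>K\<^esub> b \<odot>\<^bsub>M\<^esub> w \<oplus>\<^bsub>M\<^esub> v"
      using wb inv v D(1) by (simp add: M.smult_r_distr M.smult_assoc1[symmetric])
    then have "v \<ominus>\<^bsub>M\<^esub> inv\<^bsub>K\<^esub> b \<odot>\<^bsub>M\<^esub> x = \<ominus>\<^bsub>M\<^esub> (inv\<^bsub>K\<^esub> b \<odot>\<^bsub>M\<^esub> w)"
      using wb inv v D(1) by (simp add: a_minus_def M.M.minus_add M.M.a_ac M.M.r_neg2)
    then show ?thesis using inv wb D(4,5) by (intro bexI[of _ "inv\<^bsub>K\<^esub> b"]) auto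
  qed
  \<comment> \<open>Two different coefficients would put a non-zero multiple of \<open>x\<close>,
    hence \<open>x\<close> itself, into \<open>W\<close>.\<close>
  have uniq: "a = b" if ab: "a \<in> carrier K" "b \<in> carrier K" "v \<in> carrier M"
    "v \<ominus>\<^bsub>M\<^esub> a \<odot>\<^bsub>M\<^esub> x \<in> W" "v \<ominus>\<^bsub>M\<^esub> b \<odot>\<^bsub>M\<^esub> x \<in> W" for a b v
  proof (rule ccontr)
    assume "a \<noteq> b"
    moreover have "b = (b \<ominus>\<^bsub>K\<^esub> a) \<oplus>\<^bsub>K\<^esub> a"
      using ab by (simp add: a_minus_def K.a_assoc K.l_neg)
    ultimately have ne: "b \<ominus>\<^bsub>K\<^esub> a \<noteq> \<zero>\<^bsub>K\<^esub>" using ab by auto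
    have cl: "b \<ominus>\<^bsub>K\<^esub> a \<in> carrier K" using ab by simp
    have "(v \<ominus>\<^bsub>M\<^esub> a \<odot>\<^bsub>M\<^esub> x) \<ominus>\<^bsub>M\<^esub> (v \<ominus>\<^bsub>M\<^esub> b \<odot>\<^bsub>M\<^esub> x) =
        (v \<oplus>\<^bsub>M\<^esub> \<ominus>\<^bsub>M\<^esub> v) \<oplus>\<^bsub>M\<^esub> (b \<odot>\<^bsub>M\<^esub> x \<oplus>\<^bsub>M\<^esub> \<ominus>\<^bsub>M\<^esub> (a \<odot>\<^bsub>M\<^esub> x))"
      using ab assms(4) by (simp add: a_minus_def M.M.minus_add M.M.a_ac del: M.M.r_neg)
    also have "\<dots> = (b \<ominus>\<^bsub>K\<^esub> a) \<odot>\<^bsub>M\<^esub> x"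
      using ab assms(4) by (simp add: a_minus_def M.smult_l_distr M.smult_l_minus M.M.r_neg)
    finally have "(b \<ominus>\<^bsub>K\<^esub> a) \<odot>\<^bsub>M\<^esub> x \<in> W" using D(6)[OF ab(4,5)] by simp
    then have "inv\<^bsub>K\<^esub> (b \<ominus>\<^bsub>K\<^esub> a) \<odot>\<^bsub>M\<^esub> ((b \<ominus>\<^bsub>K\<^esub> a) \<odot>\<^bsub>M\<^esub> x) \<in> W"
      using inv[OF cl ne] D(4) by blast
    then show False
      using inv[OF cl ne] cl assms(4) W(3) by (simp add: M.smult_assoc1[symmetric])
  qed
  define f where "f = (\<lambda>v. THE a. a \<in> carrier K \<and> v \<ominus>\<^bsub>M\<^esub> a \<odot>\<^bsub>M\<^esub> x \<in> W)"
  have f_eq: "f v = a" if "v \<in> carrier M" "a \<in> carrier K" "v \<ominus>\<^bsub>M\<^esub> a \<odot>\<^bsub>M\<^esub> x \<in> W" for v a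
    unfolding f_def by (rule the_equality) (use that uniq in blast)+
  have f_mem: "f v \<in> carrier K" "v \<ominus>\<^bsub>M\<^esub> f v \<odot>\<^bsub>M\<^esub> x \<in> W" if "v \<in> carrier M" for v
    using ex[OF that] f_eq[OF that] by auto
  show thesis
  proof (rule that)
    show "f \<in> lin_hom K M (scalar_module K)"
    proof (rule lin_homI)
      fix u v assume uv: "u \<in> carrier M" "v \<in> carrier M"
      have "(u \<oplus>\<^bsub>M\<^esub> v) \<ominus>\<^bsub>M\<^esub> (f u \<oplus>\<^bsub>K\<^esub> f v) \<odot>\<^bsub>M\<^esub> x =
          (u \<ominus>\<^bsub>M\<^esub> f u \<odot>\<^bsub>M\<^esub> x) \<oplus>\<^bsub>M\<^esub> (v \<ominus>\<^bsub>M\<^esub> f v \<odot>\<^bsub>M\<^esub> x)"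
        using uv f_mem(1) assms(4) by (simp add: a_minus_def M.smult_l_distr M.M.minus_add M.M.a_ac)
      then show "f (u \<oplus>\<^bsub>M\<^esub> v) = f u \<oplus>\<^bsub>scalar_module K\<^esub> f v"
        using f_eq[of "u \<oplus>\<^bsub>M\<^esub> v" "f u \<oplus>\<^bsub>K\<^esub> f v"] uv f_mem D(3) by simp
    next
      fix a v assume av: "a \<in> carrier K" "v \<in> carrier M"
      have "a \<odot>\<^bsub>M\<^esub> v \<ominus>\<^bsub>M\<^esub> (a \<otimes>\<^bsub>K\<^esub> f v) \<odot>\<^bsub>M\<^esub> x = a \<odot>\<^bsub>M\<^esub> (v \<ominus>\<^bsub>M\<^esub> f v \<odot>\<^bsub>M\<^esub> x)"
        using av f_mem(1) assms(4)
        by (simp add: a_minus_def M.smult_r_distr M.smult_assoc1 M.smult_r_minus)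
      then show "f (a \<odot>\<^bsub>M\<^esub> v) = a \<odot>\<^bsub>scalar_module K\<^esub> f v"
        using f_eq[of "a \<odot>\<^bsub>M\<^esub> v" "a \<otimes>\<^bsub>K\<^esub> f v"] av f_mem D(4) by simp
    qed (use f_mem in auto)
    show "f h = \<zero>\<^bsub>K\<^esub>" if "h \<in> H" for h
      using that W(2) D(1) assms(4) by (intro f_eq) (auto simp: a_minus_def minus_zero)
    show "f x = \<one>\<^bsub>K\<^esub>"
      using assms(4) D(2) by (intro f_eq) (auto simp: a_minus_def M.M.r_neg)
  qed
qed

text \<open>This is f \<otimes> id, followed by the identification of K \<otimes> N with N.\<close>

definition contract ::
    "('k, 'r) ring_scheme \<Rightarrow> ('k, 'n, 'y) module_scheme \<Rightarrow> ('m \<Rightarrow> 'k) \<Rightarrow> ('k, 'm, 'n) tensor \<Rightarrow> 'n"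
  where "contract K N f = tensor_lift K N (\<lambda>x y. f x \<odot>\<^bsub>N\<^esub> y)"

lemma contract_bilinear:
  assumes "module K M" "module K N" "f \<in> lin_hom K M (scalar_module K)"
  shows "bilinear_map K M N N (\<lambda>x y. f x \<odot>\<^bsub>N\<^esub> y)"
  using smult_form_bilinear(1)[OF assms(1,2,2,3) lin_hom_id] .

lemma contract_lin:
  assumes "module K M" "module K N" "f \<in> lin_hom K M (scalar_module K)"
  shows "contract K N f \<in> lin_hom K (tensor K M N) N"
  unfolding contract_def
  by (rule tensor_lift_lin[OF assms(1,2,2) contract_bilinear[OF assms]])

lemma contract_pure:
  assumes "module K M" "module K N" "f \<in> lin_hom K M (scalar_module K)"
    "x \<in> carrier M" "y \<in> carrier N"
  shows "contract K N f (pure_tensor K M N x y) = f x \<odot>\<^bsub>N\<^esub> y"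
  unfolding contract_def
  by (rule tensor_lift_pure[OF assms(1,2,2) contract_bilinear[OF assms(1-3)] assms(4,5)])

section \<open>Linear forms on the left factor separate tensors\<close>

context
  fixes K :: "('k, 'r) ring_scheme" and M :: "('k, 'm, 'x) module_scheme"
    and N :: "('k, 'n, 'y) module_scheme"
  assumes K: "field K" and M: "module K M" and N: "module K N"
begin

interpretation K: field K by (rule K)
interpretation M: module K M by (rule M)
interpretation N: module K N by (rule N)
interpretation T: module K "tensor K M N" by (rule tensor_module[OF M N])

text \<open>Lists, rather than finite sets of pairs, allow the left factors to be kept position by
  position, repetitions included, while the right factors change.\<close>

definition tensor_sum :: "('m \<times> 'n) list \<Rightarrow> ('k, 'm, 'n) tensor"
  where "tensor_sum ps =
    foldr (\<lambda>(x, y) t. pure_tensor K M N x y \<oplus>\<^bsub>tensor K M N\<^esub> t) ps \<zero>\<^bsub>tensor K M N\<^esub>"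

lemma tensor_sum_simps [simp]:
  "tensor_sum [] = \<zero>\<^bsub>tensor K M N\<^esub>"
  "tensor_sum ((x, y) # ps) = pure_tensor K M N x y \<oplus>\<^bsub>tensor K M N\<^esub> tensor_sum ps"
  by (simp_all add: tensor_sum_def)

lemma tensor_sum_closed:
  "set ps \<subseteq> carrier M \<times> carrier N \<Longrightarrow> tensor_sum ps \<in> carrier (tensor K M N)"
  by (induction ps) (auto simp: pure_tensor_closed[OF M N])

lemma tensor_sum_append:
  "set ps \<subseteq> carrier M \<times> carrier N \<Longrightarrow> set qs \<subseteq> carrier M \<times> carrier N \<Longrightarrow>
    tensor_sum (ps @ qs) = tensor_sum ps \<oplus>\<^bsub>tensor K M N\<^esub> tensor_sum qs"
  by (induction ps) (auto simp: pure_tensor_closed[OF M N] tensor_sum_closed T.M.a_assoc)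

lemma tensor_sum_ex:
  assumes "t \<in> carrier (tensor K M N)"
  obtains ps where "set ps \<subseteq> carrier M \<times> carrier N" "t = tensor_sum ps"
proof -
  have "\<exists>ps. set ps \<subseteq> carrier M \<times> carrier N \<and> t = tensor_sum ps"
    using assms
  proof (induction rule: tensor_induct[OF M N, consumes 1, case_names zero pure add])
    case zero
    show ?case by (intro exI[of _ "[]"]) auto
  next
    case (pure x y)
    then show ?case by (intro exI[of _ "[(x, y)]"]) (auto simp: pure_tensor_closed[OF M N])
  next
    case (add t u)
    then obtain ps qs where "set ps \<subseteq> carrier M \<times> carrier N" "t = tensor_sum ps"
      "set qs \<subseteq> carrier M \<times> carrier N" "u = tensor_sum qs" by blast
    then show ?case by (intro exI[of _ "ps @ qs"]) (auto simp: tensor_sum_append)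
  qed
  then show thesis using that by blast
qed

text \<open>Plays the role of the span of \<open>us\<close>, without mentioning coefficients.\<close>

definition absorbable :: "'m list \<Rightarrow> 'm set"
  where "absorbable us = {x \<in> carrier M. \<forall>ps y. map fst ps = us \<longrightarrow> set ps \<subseteq> carrier M \<times> carrier N \<longrightarrow>
    y \<in> carrier N \<longrightarrow> (\<exists>qs. map fst qs = us \<and> set qs \<subseteq> carrier M \<times> carrier N \<and>
      tensor_sum qs = pure_tensor K M N x y \<oplus>\<^bsub>tensor K M N\<^esub> tensor_sum ps)}"

lemma absorbableD:
  assumes "x \<in> absorbable (map fst ps)" "set ps \<subseteq> carrier M \<times> carrier N" "y \<in> carrier N"
  obtains qs where "map fst qs = map fst ps" "set qs \<subseteq> carrier M \<times> carrier N"
    "tensor_sum qs = pure_tensor K M N x y \<oplus>\<^bsub>tensor K M N\<^esub> tensor_sum ps"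
  using assms unfolding absorbable_def by blast

text \<open>A sum is absorbed in two rounds, the second into the list produced by the first. A
  scalar moves to the right factor, which is arbitrary anyway.\<close>

lemma absorbable_submodule: "submodule (absorbable us) K M"
proof (rule submodule_crit[OF M])
  show "absorbable us \<subseteq> carrier M" by (auto simp: absorbable_def)
  have "pure_tensor K M N \<zero>\<^bsub>M\<^esub> y = \<zero>\<^bsub>tensor K M N\<^esub>" if "y \<in> carrier N" for y
    using lin_hom_zero[OF bilinear_mapD(1)[OF pure_tensor_bilinear[OF M N] that] M T.module_axioms] .
  then show "\<zero>\<^bsub>M\<^esub> \<in> absorbable us"
    by (auto simp: absorbable_def tensor_sum_closed)
next
  fix x x' assume x: "x \<in> absorbable us" and x': "x' \<in> absorbable us"
  then have c: "x \<in> carrier M" "x' \<in> carrier M" by (auto simp: absorbable_def)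
  have "\<exists>qs. map fst qs = us \<and> set qs \<subseteq> carrier M \<times> carrier N \<and>
      tensor_sum qs = pure_tensor K M N (x \<oplus>\<^bsub>M\<^esub> x') y \<oplus>\<^bsub>tensor K M N\<^esub> tensor_sum ps"
    if ps: "map fst ps = us" "set ps \<subseteq> carrier M \<times> carrier N" "y \<in> carrier N" for ps y
  proof -
    obtain qs where qs: "map fst qs = us" "set qs \<subseteq> carrier M \<times> carrier N"
      "tensor_sum qs = pure_tensor K M N x' y \<oplus>\<^bsub>tensor K M N\<^esub> tensor_sum ps"
      using absorbableD[of x' ps y] x' ps by metis
    obtain rs where rs: "map fst rs = us" "set rs \<subseteq> carrier M \<times> carrier N"
      "tensor_sum rs = pure_tensor K M N x y \<oplus>\<^bsub>tensor K M N\<^esub> tensor_sum qs"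
      using absorbableD[of x qs y] x qs ps by metis
    then show ?thesis
      using qs ps c
      by (intro exI[of _ rs])
        (simp add: pure_tensor_add_left[OF M N] pure_tensor_closed[OF M N] tensor_sum_closed T.M.a_assoc)
  qed
  then show "x \<oplus>\<^bsub>M\<^esub> x' \<in> absorbable us" using c by (auto simp: absorbable_def)
next
  fix a x assume a: "a \<in> carrier K" and x: "x \<in> absorbable us"
  then have c: "x \<in> carrier M" by (auto simp: absorbable_def)
  have "pure_tensor K M N (a \<odot>\<^bsub>M\<^esub> x) y = pure_tensor K M N x (a \<odot>\<^bsub>N\<^esub> y)" if "y \<in> carrier N" for y
    using that a c by (simp add: pure_tensor_smult_left[OF M N] pure_tensor_smult_right[OF M N])
  then show "a \<odot>\<^bsub>M\<^esub> x \<in> absorbable us" using a x by (simp add: absorbable_def)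
qed

text \<open>At a position where \<open>u\<close> is the left factor, add \<open>y\<close> to the
  right factor.\<close>

lemma absorbable_mem:
  assumes "u \<in> set us" "u \<in> carrier M"
  shows "u \<in> absorbable us"
proof -
  have "\<exists>qs. map fst qs = us \<and> set qs \<subseteq> carrier M \<times> carrier N \<and>
      tensor_sum qs = pure_tensor K M N u y \<oplus>\<^bsub>tensor K M N\<^esub> tensor_sum ps"
    if ps: "map fst ps = us" "set ps \<subseteq> carrier M \<times> carrier N" "y \<in> carrier N" for ps y
  proof -
    have "u \<in> fst ` set ps" using assms(1) ps(1) by auto
    then obtain z where "(u, z) \<in> set ps" by auto
    then obtain ps1 ps2 where split: "ps = ps1 @ (u, z) # ps2" by (meson split_list)
    have "tensor_sum (ps1 @ (u, z \<oplus>\<^bsub>N\<^esub> y) # ps2) =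
        pure_tensor K M N u y \<oplus>\<^bsub>tensor K M N\<^esub> tensor_sum ps"
      using ps split assms(2)
      by (simp add: tensor_sum_append pure_tensor_add_right[OF M N] pure_tensor_closed[OF M N]
          tensor_sum_closed T.M.a_ac)
    then show ?thesis
      using ps split by (intro exI[of _ "ps1 @ (u, z \<oplus>\<^bsub>N\<^esub> y) # ps2"]) auto
  qed
  then show ?thesis using assms(2) by (auto simp: absorbable_def)
qed

text \<open>If the left factor of the first summand depends on the later ones, the summand can be absorbed
  by them; otherwise some linear form singles it out and contracts the tensor to its right factor,
  which hence lies in \<open>D\<close>.\<close>

theorem tensor_separation:
  assumes D: "submodule D K N" and t: "t \<in> carrier (tensor K M N)"
    and contr: "\<And>f. f \<in> lin_hom K M (scalar_module K) \<Longrightarrow> contract K N f t \<in> D"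
  shows "t \<in> lin_span K (tensor K M N) {pure_tensor K M N x y | x y. x \<in> carrier M \<and> y \<in> D}"
    (is "_ \<in> lin_span K ?T ?P")
proof -
  note D_simps = submoduleD[OF N D]
  have "?P \<subseteq> carrier ?T" using D_simps(1) by (auto intro: pure_tensor_closed[OF M N])
  note S = submoduleD[OF T.module_axioms lin_span_submodule[OF T.module_axioms this]]
  have "tensor_sum ps \<in> lin_span K ?T ?P"
    if "set ps \<subseteq> carrier M \<times> carrier N"
      and "\<And>f. f \<in> lin_hom K M (scalar_module K) \<Longrightarrow> contract K N f (tensor_sum ps) \<in> D" for ps
    using that
  proof (induction "length ps" arbitrary: ps)
    case 0
    then show ?case using S(2) by simp
  next
    case (Suc n)
    then obtain x y ps' where ps: "ps = (x, y) # ps'" and n: "n = length ps'" by (cases ps) auto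
    have c: "x \<in> carrier M" "y \<in> carrier N" "set ps' \<subseteq> carrier M \<times> carrier N"
      using Suc.prems(1) ps by auto
    note cl = pure_tensor_closed[OF M N c(1,2)] tensor_sum_closed[OF c(3)]
    show ?case
    proof (cases "x \<in> absorbable (map fst ps')")
      case True
      \<comment> \<open>The same tensor is now written with one summand fewer, and the induction is
        on the number of summands.\<close>
      then obtain qs where qs: "map fst qs = map fst ps'" "set qs \<subseteq> carrier M \<times> carrier N"
        "tensor_sum qs = tensor_sum ps"
        using absorbableD[of x ps' y] c ps by auto
      then have "n = length qs" using n by (metis length_map)
      then show ?thesis using Suc.hyps(1)[of qs] qs Suc.prems(2) by simp
    next
      case False
      obtain f where f: "f \<in> lin_hom K M (scalar_module K)" "f x = \<one>\<^bsub>K\<^esub>"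
        and f0: "\<And>u. u \<in> absorbable (map fst ps') \<Longrightarrow> f u = \<zero>\<^bsub>K\<^esub>"
        using linear_form_separation[OF K M absorbable_submodule c(1) False] by metis
      note f_lin = contract_lin[OF M N f(1)]
      \<comment> \<open>Stated for all lists with entries from \<open>ps'\<close>, so that the
        induction may shorten the list while \<open>f\<close> stays fixed.\<close>
      have "contract K N f (tensor_sum qs) = \<zero>\<^bsub>N\<^esub>" if "set qs \<subseteq> set ps'" for qs
        using that
      proof (induction qs)
        case Nil
        then show ?case using lin_hom_zero[OF f_lin T.module_axioms N] by simp
      next
        case (Cons q qs)
        obtain u v where q: "q = (u, v)" by force
        then have uv: "u \<in> carrier M" "v \<in> carrier N" "set qs \<subseteq> carrier M \<times> carrier N"
          using Cons.prems c(3) by auto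
        have "u \<in> set (map fst ps')" using Cons.prems q by force
        then have "f u = \<zero>\<^bsub>K\<^esub>" using f0 absorbable_mem uv(1) by blast
        then show ?case
          using Cons uv q
          by (simp add: lin_hom_add[OF f_lin] pure_tensor_closed[OF M N] tensor_sum_closed
              contract_pure[OF M N f(1)])
      qed
      then have "contract K N f (tensor_sum ps) = y"
        using ps c f(2) cl
        by (simp add: lin_hom_add[OF f_lin] contract_pure[OF M N f(1)])
      then have y: "y \<in> D" using Suc.prems(2)[OF f(1)] by simp
      \<comment> \<open>With \<open>y\<close> known to lie in \<open>D\<close>, removing the first
        summand changes each contraction by an element of \<open>D\<close>, so the hypothesis passes
        to the shorter list.\<close>
      have "contract K N g (tensor_sum ps') \<in> D" if g: "g \<in> lin_hom K M (scalar_module K)" for g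
      proof -
        note g_lin = contract_lin[OF M N g]
        have gx: "g x \<in> carrier K" using lin_hom_closed[OF g c(1)] by simp
        have "contract K N g (tensor_sum ps) = g x \<odot>\<^bsub>N\<^esub> y \<oplus>\<^bsub>N\<^esub> contract K N g (tensor_sum ps')"
          using ps c cl by (simp add: lin_hom_add[OF g_lin] contract_pure[OF M N g])
        then have "contract K N g (tensor_sum ps') =
            \<ominus>\<^bsub>N\<^esub> (g x \<odot>\<^bsub>N\<^esub> y) \<oplus>\<^bsub>N\<^esub> contract K N g (tensor_sum ps)"
          using c gx lin_hom_closed[OF g_lin cl(2)] by (simp add: N.M.r_neg1)
        then show ?thesis
          using Suc.prems(2)[OF g] D_simps(3) D_simps(5) D_simps(4)[OF gx y] by simp
      qed
      then have "tensor_sum ps' \<in> lin_span K ?T ?P" using Suc.hyps(1) n c by blast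
      moreover have "pure_tensor K M N x y \<in> lin_span K ?T ?P"
        using c y by (intro lin_span_mono) auto
      ultimately show ?thesis using ps S(3) by simp
    qed
  qed
  moreover obtain ps where "set ps \<subseteq> carrier M \<times> carrier N" "t = tensor_sum ps"
    using tensor_sum_ex[OF t] by blast
  ultimately show ?thesis using contr by blast
qed

text \<open>Separation for the zero subspace, applied to the difference: the pure tensors with right
  factor zero span only zero.\<close>

corollary tensor_eqI:
  assumes t: "t \<in> carrier (tensor K M N)" and u: "u \<in> carrier (tensor K M N)"
    and eq: "\<And>f. f \<in> lin_hom K M (scalar_module K) \<Longrightarrow> contract K N f t = contract K N f u"
  shows "t = u"
proof -
  have "t \<ominus>\<^bsub>tensor K M N\<^esub> u \<in>
      lin_span K (tensor K M N) {pure_tensor K M N x y | x y. x \<in> carrier M \<and> y \<in> {\<zero>\<^bsub>N\<^esub>}}"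
  proof (rule tensor_separation[OF submodule_zero[OF N]])
    fix f assume f: "f \<in> lin_hom K M (scalar_module K)"
    show "contract K N f (t \<ominus>\<^bsub>tensor K M N\<^esub> u) \<in> {\<zero>\<^bsub>N\<^esub>}"
      using lin_hom_closed[OF contract_lin[OF M N f]] t u eq[OF f]
      by (simp add: lin_hom_minus[OF contract_lin[OF M N f] T.module_axioms N])
        (simp add: a_minus_def N.M.r_neg)
  qed (use t u in simp)
  also have "\<dots> \<subseteq> {\<zero>\<^bsub>tensor K M N\<^esub>}"
    by (rule lin_span_minimal[OF submodule_zero[OF T.module_axioms]])
      (auto simp: lin_hom_zero[OF bilinear_mapD(2)[OF pure_tensor_bilinear[OF M N]] N T.module_axioms])
  finally have "t \<ominus>\<^bsub>tensor K M N\<^esub> u = \<zero>\<^bsub>tensor K M N\<^esub>" by simp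
  moreover have "t = (t \<ominus>\<^bsub>tensor K M N\<^esub> u) \<oplus>\<^bsub>tensor K M N\<^esub> u"
    using t u by (simp add: a_minus_def T.M.a_assoc T.M.l_neg)
  ultimately show ?thesis using u by simp
qed

end

section \<open>The dual algebra\<close>

text \<open>Such a \<open>J\<close> meets the left annihilator of \<open>x\<close> only in zero, so
  the annihilator is not essential. For the dual algebra it remains to exhibit \<open>J\<close> and
  to check closure under the additive structure and under left multiplication.\<close>

lemma left_nonsingularI:
  assumes "\<And>x. x \<in> carrier R \<Longrightarrow> x \<noteq> \<zero>\<^bsub>R\<^esub> \<Longrightarrow>
    \<exists>J. left_ideal J R \<and> J \<noteq> {\<zero>\<^bsub>R\<^esub>} \<and> (\<forall>r\<in>J. r \<otimes>\<^bsub>R\<^esub> x = \<zero>\<^bsub>R\<^esub> \<longrightarrow> r = \<zero>\<^bsub>R\<^esub>)"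
  shows "left_nonsingular R"
  unfolding left_nonsingular_def
proof
  assume "\<exists>x\<in>carrier R. x \<noteq> \<zero>\<^bsub>R\<^esub> \<and> essential_left_ideal (left_annihilator R x) R"
  then obtain x where x: "x \<in> carrier R" "x \<noteq> \<zero>\<^bsub>R\<^esub>"
    and ess: "essential_left_ideal (left_annihilator R x) R" by blast
  obtain J where J: "left_ideal J R" "J \<noteq> {\<zero>\<^bsub>R\<^esub>}"
    and inj: "\<forall>r\<in>J. r \<otimes>\<^bsub>R\<^esub> x = \<zero>\<^bsub>R\<^esub> \<longrightarrow> r = \<zero>\<^bsub>R\<^esub>" using assms[OF x] by blast
  have "\<zero>\<^bsub>R\<^esub> \<in> left_annihilator R x" "\<zero>\<^bsub>R\<^esub> \<in> J"
    using ess J(1) by (auto simp: essential_left_ideal_def left_ideal_def additive_subgroup.zero_closed)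
  then have "left_annihilator R x \<inter> J = {\<zero>\<^bsub>R\<^esub>}"
    using inj by (auto simp: left_annihilator_def)
  then show False using ess J by (auto simp: essential_left_ideal_def)
qed

lemma dual_algebra_carrier:
  "f \<in> carrier (dual_algebra K C) \<longleftrightarrow> f \<in> lin_hom K C (scalar_module K) \<and> f \<in> extensional (carrier C)"
  by (simp add: dual_algebra_def)

lemma dual_algebra_simps:
  "\<zero>\<^bsub>dual_algebra K C\<^esub> = (\<lambda>c\<in>carrier C. \<zero>\<^bsub>K\<^esub>)"
  "f \<oplus>\<^bsub>dual_algebra K C\<^esub> g = (\<lambda>c\<in>carrier C. f c \<oplus>\<^bsub>K\<^esub> g c)"
  "f \<otimes>\<^bsub>dual_algebra K C\<^esub> g = (\<lambda>c\<in>carrier C.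
    tensor_lift K (scalar_module K) (\<lambda>x y. f x \<otimes>\<^bsub>K\<^esub> g y) (comult C c))"
  by (simp_all add: dual_algebra_def)

lemma dual_algebra_closed:
  "f \<in> carrier (dual_algebra K C) \<Longrightarrow> c \<in> carrier C \<Longrightarrow> f c \<in> carrier K"
  using lin_hom_closed[of f K C "scalar_module K"] by (simp add: dual_algebra_carrier)

lemma dual_algebra_eqI:
  assumes "f \<in> carrier (dual_algebra K C)" "g \<in> carrier (dual_algebra K C)"
    "\<And>c. c \<in> carrier C \<Longrightarrow> f c = g c"
  shows "f = g"
  using assms by (auto simp: dual_algebra_carrier intro: extensionalityI)

lemma restrict_dual:
  assumes "f \<in> lin_hom K C (scalar_module K)" "module K C"
  shows "restrict f (carrier C) \<in> carrier (dual_algebra K C)"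
  using lin_hom_cong[OF assms, of "restrict f (carrier C)"] by (simp add: dual_algebra_carrier)

lemma dual_mult_bilinear:
  assumes "module K M" "f \<in> lin_hom K M (scalar_module K)" "g \<in> lin_hom K M (scalar_module K)"
  shows "bilinear_map K M M (scalar_module K) (\<lambda>x y. f x \<otimes>\<^bsub>K\<^esub> g y)"
proof -
  interpret M: module K M by fact
  show ?thesis
    using smult_form_bilinear(1)[OF assms(1,1) scalar_module_module[OF M.R.cring_axioms] assms(2,3)]
    by simp
qed

text \<open>\<open>M\<close> is kept apart from \<open>C\<close> because the path comultiplication
  takes its values in a tensor square of the free module, not of the coalgebra record built on it.
  For a general coalgebra both are \<open>C\<close>.\<close>

lemma dual_mult_closed:
  assumes "module K C" "module K M" "comult C \<in> lin_hom K C (tensor K M M)"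
    and "f \<in> lin_hom K M (scalar_module K)" "g \<in> lin_hom K M (scalar_module K)"
  shows "f \<otimes>\<^bsub>dual_algebra K C\<^esub> g \<in> carrier (dual_algebra K C)"
proof -
  interpret M: module K M by fact
  show ?thesis
    unfolding dual_algebra_simps
    by (intro restrict_dual lin_hom_comp[OF assms(3)] tensor_lift_lin[OF assms(2,2)]
        scalar_module_module M.R.cring_axioms dual_mult_bilinear assms)
qed

context
  fixes K :: "('k, 'r) ring_scheme" and C :: "('k, 'c) coalgebra"
  assumes K: "cring K" and C: "module K C"
begin

interpretation K: cring K by (rule K)
interpretation C: module K C by (rule C)

lemma dual_algebra_neg:
  assumes "f \<in> carrier (dual_algebra K C)"
  shows "(\<lambda>c\<in>carrier C. \<ominus>\<^bsub>K\<^esub> f c) \<in> carrier (dual_algebra K C)"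
  using assms dual_algebra_closed[OF assms]
  by (intro restrict_dual[OF lin_homI C])
    (auto simp: dual_algebra_carrier lin_hom_add lin_hom_smult K.minus_add K.r_minus)

lemma dual_algebra_abelian_group: "abelian_group (dual_algebra K C)"
proof (rule abelian_groupI)
  fix f g assume fg: "f \<in> carrier (dual_algebra K C)" "g \<in> carrier (dual_algebra K C)"
  show "f \<oplus>\<^bsub>dual_algebra K C\<^esub> g \<in> carrier (dual_algebra K C)"
    unfolding dual_algebra_simps using fg dual_algebra_closed[OF fg(1)] dual_algebra_closed[OF fg(2)]
    by (intro restrict_dual[OF lin_homI C])
      (auto simp: dual_algebra_carrier lin_hom_add lin_hom_smult K.r_distr K.a_ac)
  show "f \<oplus>\<^bsub>dual_algebra K C\<^esub> g = g \<oplus>\<^bsub>dual_algebra K C\<^esub> f"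
    using dual_algebra_closed[OF fg(1)] dual_algebra_closed[OF fg(2)]
    by (auto simp: dual_algebra_simps K.a_comm restrict_def)
  fix h assume h: "h \<in> carrier (dual_algebra K C)"
  show "f \<oplus>\<^bsub>dual_algebra K C\<^esub> g \<oplus>\<^bsub>dual_algebra K C\<^esub> h = f \<oplus>\<^bsub>dual_algebra K C\<^esub> (g \<oplus>\<^bsub>dual_algebra K C\<^esub> h)"
    using dual_algebra_closed[OF fg(1)] dual_algebra_closed[OF fg(2)] dual_algebra_closed[OF h]
    by (auto simp: dual_algebra_simps K.a_assoc restrict_def)
next
  show "\<zero>\<^bsub>dual_algebra K C\<^esub> \<in> carrier (dual_algebra K C)"
    unfolding dual_algebra_simps by (intro restrict_dual[OF lin_homI C]) auto
next
  fix f assume f: "f \<in> carrier (dual_algebra K C)"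
  show "\<zero>\<^bsub>dual_algebra K C\<^esub> \<oplus>\<^bsub>dual_algebra K C\<^esub> f = f"
    using f dual_algebra_closed[OF f]
    by (auto simp: dual_algebra_simps fun_eq_iff dual_algebra_carrier extensional_def)
  show "\<exists>g\<in>carrier (dual_algebra K C). g \<oplus>\<^bsub>dual_algebra K C\<^esub> f = \<zero>\<^bsub>dual_algebra K C\<^esub>"
    using dual_algebra_neg[OF f] dual_algebra_closed[OF f]
    by (intro bexI[of _ "\<lambda>c\<in>carrier C. \<ominus>\<^bsub>K\<^esub> f c"]) (auto simp: dual_algebra_simps K.l_neg restrict_def)
qed

lemma dual_left_idealI:
  assumes sub: "J \<subseteq> carrier (dual_algebra K C)" and zero: "(\<lambda>c\<in>carrier C. \<zero>\<^bsub>K\<^esub>) \<in> J"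
    and add: "\<And>f g. f \<in> J \<Longrightarrow> g \<in> J \<Longrightarrow> (\<lambda>c\<in>carrier C. f c \<oplus>\<^bsub>K\<^esub> g c) \<in> J"
    and neg: "\<And>f. f \<in> J \<Longrightarrow> (\<lambda>c\<in>carrier C. \<ominus>\<^bsub>K\<^esub> f c) \<in> J"
    and mult: "\<And>r f. r \<in> carrier (dual_algebra K C) \<Longrightarrow> f \<in> J \<Longrightarrow> r \<otimes>\<^bsub>dual_algebra K C\<^esub> f \<in> J"
  shows "left_ideal J (dual_algebra K C)"
proof -
  let ?A = "dual_algebra K C"
  interpret A: abelian_group ?A by (rule dual_algebra_abelian_group)
  \<comment> \<open>The subgroup axioms speak of the inverse in the additive monoid; uniqueness of
    negatives identifies it with the pointwise negative.\<close>
  have inv: "inv\<^bsub>add_monoid ?A\<^esub> f \<in> J" if f: "f \<in> J" for f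
  proof -
    have c: "f \<in> carrier ?A" using sub f by blast
    have "(\<lambda>c\<in>carrier C. \<ominus>\<^bsub>K\<^esub> f c) \<oplus>\<^bsub>?A\<^esub> f = \<zero>\<^bsub>?A\<^esub>"
      using dual_algebra_closed[OF c] by (auto simp: dual_algebra_simps K.l_neg restrict_def)
    then have "\<ominus>\<^bsub>?A\<^esub> f = (\<lambda>c\<in>carrier C. \<ominus>\<^bsub>K\<^esub> f c)"
      using A.minus_equality c dual_algebra_neg[OF c] by blast
    then show ?thesis using neg[OF f] by (simp add: a_inv_def)
  qed
  have "subgroup J (add_monoid ?A)"
    by (rule subgroup.intro) (use sub zero add inv in \<open>auto simp: dual_algebra_simps\<close>)
  then show ?thesis using mult by (auto simp: left_ideal_def additive_subgroup_def)
qed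

end

section \<open>Path coalgebras\<close>

lemma path_coalgebra_simps:
  "carrier (path_coalgebra K G) = carrier (free_module K (paths G))"
  "\<zero>\<^bsub>path_coalgebra K G\<^esub> = \<zero>\<^bsub>free_module K (paths G)\<^esub>"
  "add (path_coalgebra K G) = add (free_module K (paths G))"
  "smult (path_coalgebra K G) = smult (free_module K (paths G))"
  "comult (path_coalgebra K G) = path_comult K G"
  by (simp_all add: path_coalgebra_def module.extend_def coalgebra.fields_def)

lemma path_coalgebra_module: "cring K \<Longrightarrow> module K (path_coalgebra K G)"
  by (rule module_image[OF free_module_module[of K "paths G"], where h = "\<lambda>x. x"])
    (simp_all add: path_coalgebra_simps)

lemma path_coalgebra_lin_hom: "lin_hom K (path_coalgebra K G) P = lin_hom K (free_module K (paths G)) P"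
  by (simp add: lin_hom_def path_coalgebra_simps)

text \<open>Forms are linear maps into \<open>scalar_module K\<close>, so pushing a sum through a
  form produces a sum in that record; this brings it back to \<open>K\<close>.\<close>

lemma finsum_scalar_module:
  assumes "cring K" "finite A" "h \<in> A \<rightarrow> carrier K"
  shows "finsum (scalar_module K) h A = finsum K h A"
proof -
  interpret K: cring K by fact
  interpret S: module K "scalar_module K" by (rule scalar_module_module) fact
  show ?thesis
    using assms(2,3)
  proof (induction rule: finite_induct)
    case (insert a A)
    then have "h \<in> A \<rightarrow> carrier K" "h a \<in> carrier K" by auto
    then show ?case using insert by (simp add: S.M.finsum_insert K.finsum_insert)
  qed simp
qed

text \<open>A split of a given path is determined by the length of its first factor, since the
  vertex in the middle is where that factor ends.\<close>

lemma finite_path_splits: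
  assumes "wf_digraph G"
  shows "finite (path_splits G w)"
proof -
  interpret wf_digraph G by fact
  obtain u r v where w: "w = (u, r, v)" by (cases w)
  let ?f = "\<lambda>n. ((u, take n r, awlast u (take n r)), (awlast u (take n r), drop n r, v))"
  have "path_splits G w \<subseteq> ?f ` {..length r}"
  proof
    fix s assume "s \<in> path_splits G w"
    then obtain p x q where s: "s = ((u, p, x), (x, q, v))" "awalk u p x" "r = p @ q"
      using w by (auto simp: path_splits_def paths_def)
    moreover from s have "awlast u p = x" by (auto elim: awalkE)
    ultimately have "s = ?f (length p)" by simp
    then show "s \<in> ?f ` {..length r}" using s(3) by (intro image_eqI[of _ _ "length p"]) auto
  qed
  then show ?thesis by (rule finite_subset) simp
qed

lemma path_splits_paths:
  "s \<in> path_splits G w \<Longrightarrow> fst s \<in> paths G" "s \<in> path_splits G w \<Longrightarrow> snd s \<in> paths G"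
  by (auto simp: path_splits_def)

text \<open>As a linear extension from the basis of paths, the comultiplication inherits linearity
  and its values on basis vectors from \<open>free_lift\<close>.\<close>

lemma path_comult_conv:
  "path_comult K G = free_lift K (tensor K (free_module K (paths G)) (free_module K (paths G)))
    (\<lambda>w. \<Oplus>\<^bsub>tensor K (free_module K (paths G)) (free_module K (paths G))\<^esub>s\<in>path_splits G w.
      pure_tensor K (free_module K (paths G)) (free_module K (paths G))
        (basis_vec K (fst s)) (basis_vec K (snd s)))"
  by (simp add: path_comult_def free_lift_def fun_eq_iff Let_def)

lemma pure_split_closed:
  assumes "cring K" "s \<in> path_splits G w"
  shows "pure_tensor K (free_module K (paths G)) (free_module K (paths G))
      (basis_vec K (fst s)) (basis_vec K (snd s))
    \<in> carrier (tensor K (free_module K (paths G)) (free_module K (paths G)))"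
  using path_splits_paths[OF assms(2)]
  by (intro pure_tensor_closed free_module_module basis_vec_closed assms(1))

lemma path_comult_lin:
  assumes "cring K"
  shows "path_comult K G \<in> lin_hom K (free_module K (paths G))
    (tensor K (free_module K (paths G)) (free_module K (paths G)))"
proof -
  let ?F = "free_module K (paths G)"
  note F = free_module_module[OF assms, of "paths G"]
  interpret T: module K "tensor K ?F ?F" by (rule tensor_module[OF F F])
  show ?thesis
    unfolding path_comult_conv
    by (rule free_lift_lin[OF T.module_axioms])
      (auto intro!: T.M.finsum_closed pure_split_closed assms)
qed

lemma path_convolution:
  assumes "cring K" "wf_digraph G" "w \<in> paths G"
    and f: "f \<in> carrier (dual_algebra K (path_coalgebra K G))"
    and g: "g \<in> carrier (dual_algebra K (path_coalgebra K G))"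
  shows "(f \<otimes>\<^bsub>dual_algebra K (path_coalgebra K G)\<^esub> g) (basis_vec K w) =
    (\<Oplus>\<^bsub>K\<^esub>s\<in>path_splits G w. f (basis_vec K (fst s)) \<otimes>\<^bsub>K\<^esub> g (basis_vec K (snd s)))"
proof -
  interpret K: cring K by fact
  let ?F = "free_module K (paths G)"
  let ?S = "scalar_module K"
  let ?T = "tensor K ?F ?F"
  let ?pt = "\<lambda>s. pure_tensor K ?F ?F (basis_vec K (fst s)) (basis_vec K (snd s))"
  let ?\<beta> = "\<lambda>x y. f x \<otimes>\<^bsub>K\<^esub> g y"
  note F = free_module_module[OF assms(1), of "paths G"]
  note S = scalar_module_module[OF assms(1)]
  note T = tensor_module[OF F F]
  interpret T: module K ?T by (rule T)
  have fg: "f \<in> lin_hom K ?F ?S" "g \<in> lin_hom K ?F ?S"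
    using f g by (auto simp: dual_algebra_carrier path_coalgebra_lin_hom)
  have \<beta>: "bilinear_map K ?F ?F ?S ?\<beta>"
    by (rule dual_mult_bilinear[OF F fg])
  have e: "basis_vec K w \<in> carrier ?F" if "w \<in> paths G" for w
    by (rule basis_vec_closed[OF assms(1) that])
  interpret S: module K ?S by (rule S)
  have h: "(\<lambda>s. f (basis_vec K (fst s)) \<otimes>\<^bsub>K\<^esub> g (basis_vec K (snd s))) \<in> path_splits G w \<rightarrow> carrier K"
  proof
    fix s assume s: "s \<in> path_splits G w"
    show "f (basis_vec K (fst s)) \<otimes>\<^bsub>K\<^esub> g (basis_vec K (snd s)) \<in> carrier K"
      using lin_hom_closed[OF fg(1) e[OF path_splits_paths(1)[OF s]]]
        lin_hom_closed[OF fg(2) e[OF path_splits_paths(2)[OF s]]] by simp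
  qed
  note pt = pure_split_closed[OF assms(1), of _ G]
  have "path_comult K G (basis_vec K w) = (\<Oplus>\<^bsub>?T\<^esub>s\<in>path_splits G w. ?pt s)"
    unfolding path_comult_conv
    by (rule free_lift_basis[OF T _ assms(3)]) (auto intro!: T.M.finsum_closed pt)
  then have "tensor_lift K ?S ?\<beta> (path_comult K G (basis_vec K w)) =
      (\<Oplus>\<^bsub>?S\<^esub>s\<in>path_splits G w. tensor_lift K ?S ?\<beta> (?pt s))"
    using lin_hom_finsum[OF tensor_lift_lin[OF F F S \<beta>] T S finite_path_splits[OF assms(2)], of ?pt w] pt
    by auto
  also have "\<dots> = (\<Oplus>\<^bsub>?S\<^esub>s\<in>path_splits G w. f (basis_vec K (fst s)) \<otimes>\<^bsub>K\<^esub> g (basis_vec K (snd s)))"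
    using h by (intro S.M.finsum_cong') (auto simp: tensor_lift_pure[OF F F S \<beta>] e path_splits_paths)
  also have "\<dots> = (\<Oplus>\<^bsub>K\<^esub>s\<in>path_splits G w. f (basis_vec K (fst s)) \<otimes>\<^bsub>K\<^esub> g (basis_vec K (snd s)))"
    by (rule finsum_scalar_module[OF assms(1) finite_path_splits[OF assms(2)] h])
  finally show ?thesis using e[OF assms(3)] by (simp add: dual_algebra_simps path_coalgebra_simps)
qed

text \<open>A form is determined by its values on paths, so a non-zero one is non-zero on some path,
  and one of least length can be chosen. Minimality later kills all splits but one.\<close>

lemma path_dual_nonzero:
  assumes "cring K" "f \<in> carrier (dual_algebra K (path_coalgebra K G))"
    "f \<noteq> \<zero>\<^bsub>dual_algebra K (path_coalgebra K G)\<^esub>"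
  obtains u p v where "(u, p, v) \<in> paths G" "f (basis_vec K (u, p, v)) \<noteq> \<zero>\<^bsub>K\<^esub>"
    "\<And>u' p' v'. (u', p', v') \<in> paths G \<Longrightarrow> length p' < length p \<Longrightarrow> f (basis_vec K (u', p', v')) = \<zero>\<^bsub>K\<^esub>"
proof -
  let ?A = "dual_algebra K (path_coalgebra K G)"
  note C = path_coalgebra_module[OF assms(1), of G]
  interpret K: cring K by fact
  interpret A: abelian_group ?A by (rule dual_algebra_abelian_group[OF assms(1) C])
  have "\<exists>w. w \<in> paths G \<and> f (basis_vec K w) \<noteq> \<zero>\<^bsub>K\<^esub>"
  proof (rule ccontr)
    assume none: "\<nexists>w. w \<in> paths G \<and> f (basis_vec K w) \<noteq> \<zero>\<^bsub>K\<^esub>"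
    have "f = \<zero>\<^bsub>?A\<^esub>"
    proof (rule dual_algebra_eqI[OF assms(2) A.zero_closed])
      fix c assume c: "c \<in> carrier (path_coalgebra K G)"
      show "f c = \<zero>\<^bsub>?A\<^esub> c"
        by (rule free_hom_ext[OF assms(1) scalar_module_module[OF assms(1)],
              where I = "paths G" and f = f and g = "\<zero>\<^bsub>?A\<^esub>"])
          (use assms(2) A.zero_closed c none basis_vec_closed[OF assms(1), of _ "paths G"] in
            \<open>auto simp: dual_algebra_carrier path_coalgebra_lin_hom path_coalgebra_simps dual_algebra_simps\<close>)
    qed
    then show False using assms(3) by simp
  qed
  then obtain w where w: "w \<in> paths G \<and> f (basis_vec K w) \<noteq> \<zero>\<^bsub>K\<^esub>" by blast
  obtain w where w: "w \<in> paths G \<and> f (basis_vec K w) \<noteq> \<zero>\<^bsub>K\<^esub>"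
    and least: "\<forall>w'. w' \<in> paths G \<and> f (basis_vec K w') \<noteq> \<zero>\<^bsub>K\<^esub> \<longrightarrow> length (fst (snd w)) \<le> length (fst (snd w'))"
    using ex_has_least_nat[of "\<lambda>w. w \<in> paths G \<and> f (basis_vec K w) \<noteq> \<zero>\<^bsub>K\<^esub>", OF w,
        of "\<lambda>w. length (fst (snd w))"] by blast
  obtain u p v where w_eq: "w = (u, p, v)" by (cases w) auto
  show thesis
  proof (rule that[of u p v])
    fix u' p' v' assume "(u', p', v') \<in> paths G" "length p' < length p"
    then show "f (basis_vec K (u', p', v')) = \<zero>\<^bsub>K\<^esub>"
      using spec[OF least, of "(u', p', v')"] w_eq by auto
  qed (use w w_eq in auto)
qed

theorem path_coalgebra_nonsingular:
  assumes "field K" "wf_digraph G"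
  shows "nonsingular_coalgebra K (path_coalgebra K G)"
  unfolding nonsingular_coalgebra_def
proof (rule left_nonsingularI)
  let ?C = "path_coalgebra K G"
  let ?A = "dual_algebra K ?C"
  interpret K: field K by fact
  interpret G: wf_digraph G by fact
  note C = path_coalgebra_module[OF K.cring_axioms, of G]
  interpret A: abelian_group ?A by (rule dual_algebra_abelian_group[OF K.cring_axioms C])
  have e: "basis_vec K w \<in> carrier ?C" if "w \<in> paths G" for w
    using basis_vec_closed[OF K.cring_axioms that] by (simp add: path_coalgebra_simps)
  note closed = dual_algebra_closed[OF _ e]
  fix x assume x: "x \<in> carrier ?A" "x \<noteq> \<zero>\<^bsub>?A\<^esub>"
  obtain s p t where w: "(s, p, t) \<in> paths G" "x (basis_vec K (s, p, t)) \<noteq> \<zero>\<^bsub>K\<^esub>"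
    and x_min: "\<And>u' p' v'. (u', p', v') \<in> paths G \<Longrightarrow> length p' < length p \<Longrightarrow>
      x (basis_vec K (u', p', v')) = \<zero>\<^bsub>K\<^esub>"
    using path_dual_nonzero[OF K.cring_axioms x] by metis
  \<comment> \<open>These are the forms supported on paths ending at \<open>s\<close>, that is, the
    left ideal generated by the idempotent form reading the coefficient of the trivial path at
    \<open>s\<close>.\<close>
  define J where "J = {f \<in> carrier ?A. \<forall>u q v. (u, q, v) \<in> paths G \<longrightarrow> v \<noteq> s \<longrightarrow>
    f (basis_vec K (u, q, v)) = \<zero>\<^bsub>K\<^esub>}"
  have "left_ideal J ?A"
  proof (rule dual_left_idealI[OF K.cring_axioms C])
    show "J \<subseteq> carrier ?A" by (auto simp: J_def)
    show "(\<lambda>c\<in>carrier ?C. \<zero>\<^bsub>K\<^esub>) \<in> J"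
      using A.zero_closed e by (auto simp: J_def dual_algebra_simps)
    show "(\<lambda>c\<in>carrier ?C. f c \<oplus>\<^bsub>K\<^esub> g c) \<in> J" if "f \<in> J" "g \<in> J" for f g
      using that A.a_closed[of f g] e by (auto simp: J_def dual_algebra_simps)
    show "(\<lambda>c\<in>carrier ?C. \<ominus>\<^bsub>K\<^esub> f c) \<in> J" if "f \<in> J" for f
      using that dual_algebra_neg[OF K.cring_axioms C, of f] e by (auto simp: J_def)
    fix r f assume r: "r \<in> carrier ?A" and f: "f \<in> J"
    then have f': "f \<in> carrier ?A" by (auto simp: J_def)
    have "(r \<otimes>\<^bsub>?A\<^esub> f) (basis_vec K (u, q, v)) = \<zero>\<^bsub>K\<^esub>" if uqv: "(u, q, v) \<in> paths G" "v \<noteq> s" for u q v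
    proof -
      \<comment> \<open>The second factor of every split of a path ends where the path ends, here
        away from \<open>s\<close>, so \<open>f\<close> vanishes on it.\<close>
      have "r (basis_vec K (fst s')) \<otimes>\<^bsub>K\<^esub> f (basis_vec K (snd s')) = \<zero>\<^bsub>K\<^esub>"
        if s': "s' \<in> path_splits G (u, q, v)" for s'
        using f closed[OF r path_splits_paths(1)[OF s']] s' uqv(2)
        by (auto simp: path_splits_def J_def)
      then show ?thesis
        unfolding path_convolution[OF K.cring_axioms assms(2) uqv(1) r f']
        by (rule K.add.finprod_one_eqI)
    qed
    moreover have "r \<otimes>\<^bsub>?A\<^esub> f \<in> carrier ?A"
      using r f' path_comult_lin[OF K.cring_axioms]
      by (intro dual_mult_closed[OF C free_module_module[OF K.cring_axioms, of "paths G"]])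
        (auto simp: dual_algebra_carrier path_coalgebra_lin_hom path_coalgebra_simps)
    ultimately show "r \<otimes>\<^bsub>?A\<^esub> f \<in> J" by (auto simp: J_def)
  qed
  moreover have "J \<noteq> {\<zero>\<^bsub>?A\<^esub>}"
  proof -
    have s: "(s, [], s) \<in> paths G" using w(1) by (auto simp: paths_def G.awalk_def)
    \<comment> \<open>The idempotent that generates \<open>J\<close>; its value on the trivial path
      at \<open>s\<close> is one.\<close>
    define f where "f = (\<lambda>\<phi>\<in>carrier ?C. \<phi> (s, [], s))"
    have "f \<in> carrier ?A"
      unfolding f_def
      by (rule restrict_dual[OF lin_homI C])
        (auto simp: path_coalgebra_simps free_module_simps free_module_eval_closed[OF K.cring_axioms])
    then have "f \<in> J" using e by (auto simp: J_def f_def basis_vec_def)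
    moreover have "f (basis_vec K (s, [], s)) = \<one>\<^bsub>K\<^esub>" using e[OF s] by (simp add: f_def basis_vec_def)
    then have "f \<noteq> \<zero>\<^bsub>?A\<^esub>" using e[OF s] by (auto simp: dual_algebra_simps)
    ultimately show ?thesis by blast
  qed
  moreover have "f = \<zero>\<^bsub>?A\<^esub>" if f: "f \<in> J" and fx: "f \<otimes>\<^bsub>?A\<^esub> x = \<zero>\<^bsub>?A\<^esub>" for f
  proof (rule ccontr)
    assume "f \<noteq> \<zero>\<^bsub>?A\<^esub>"
    have fA: "f \<in> carrier ?A" using f by (simp add: J_def)
    obtain a q b where u: "(a, q, b) \<in> paths G" "f (basis_vec K (a, q, b)) \<noteq> \<zero>\<^bsub>K\<^esub>"
      and f_min: "\<And>u' p' v'. (u', p', v') \<in> paths G \<Longrightarrow> length p' < length q \<Longrightarrow>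
        f (basis_vec K (u', p', v')) = \<zero>\<^bsub>K\<^esub>"
      using path_dual_nonzero[OF K.cring_axioms fA \<open>f \<noteq> _\<close>] by metis
    have b: "b = s" using f u by (auto simp: J_def)
    let ?w = "(a, q @ p, t)" and ?s = "((a, q, s), (s, p, t))"
    let ?h = "\<lambda>s. f (basis_vec K (fst s)) \<otimes>\<^bsub>K\<^esub> x (basis_vec K (snd s))"
    have w': "?w \<in> paths G"
      using u(1) w(1) b by (auto simp: paths_def intro: G.awalk_appendI)
    have split: "?s \<in> path_splits G ?w" using u(1) w(1) b by (auto simp: path_splits_def)
    have h: "?h \<in> path_splits G ?w \<rightarrow> carrier K"
    proof
      fix s' assume s': "s' \<in> path_splits G ?w"
      show "?h s' \<in> carrier K"
        using closed[OF fA path_splits_paths(1)[OF s']] closed[OF x(1) path_splits_paths(2)[OF s']]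
        by simp
    qed
    \<comment> \<open>The two lengths of a split have a fixed sum. If the first factor is shorter
      than \<open>q\<close>, then \<open>f\<close> vanishes on it; if the second is shorter than
      \<open>p\<close>, then \<open>x\<close> vanishes on it. Otherwise the arc lists agree and only
      the middle vertex could differ from \<open>s\<close>, which is excluded by \<open>f\<close>
      being in \<open>J\<close>.\<close>
    have others: "?h s' = \<zero>\<^bsub>K\<^esub>" if s': "s' \<in> path_splits G ?w" "s' \<noteq> ?s" for s'
    proof -
      obtain q' y p' where s'_eq: "s' = ((a, q', y), (y, p', t))" and eq: "q' @ p' = q @ p"
        and P: "(a, q', y) \<in> paths G" "(y, p', t) \<in> paths G"
        using s'(1) by (auto simp: path_splits_def)
      note cl = closed[OF fA P(1)] closed[OF x(1) P(2)]
      consider "length q' < length q" | "length p' < length p" | "q' = q" "p' = p"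
      proof -
        have "length q' + length p' = length q + length p" using eq by (metis length_append)
        then consider "length q' < length q" | "length p' < length p" | "length q' = length q" by linarith
        then show ?thesis using eq that by cases auto
      qed
      then show ?thesis
      proof cases
        case 1
        then show ?thesis using f_min[OF P(1)] cl s'_eq by simp
      next
        case 2
        then show ?thesis using x_min[OF P(2)] cl s'_eq by simp
      next
        case 3
        then have "y \<noteq> s" using s'(2) s'_eq by auto
        then show ?thesis using f P(1) cl s'_eq by (auto simp: J_def)
      qed
    qed
    have "(f \<otimes>\<^bsub>?A\<^esub> x) (basis_vec K ?w) = (\<Oplus>\<^bsub>K\<^esub>s\<in>path_splits G ?w. ?h s)"
      by (rule path_convolution[OF K.cring_axioms assms(2) w' fA x(1)])
    also have "\<dots> = (\<Oplus>\<^bsub>K\<^esub>s\<in>{?s}. ?h s)"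
      by (rule K.add.finprod_mono_neutral_cong_right)
        (use finite_path_splits[OF assms(2)] split others h in auto)
    also have "\<dots> = ?h ?s" using h split by (auto simp: Pi_iff)
    moreover have "(f \<otimes>\<^bsub>?A\<^esub> x) (basis_vec K ?w) = \<zero>\<^bsub>K\<^esub>"
      unfolding fx using e[OF w'] by (simp add: dual_algebra_simps(1))
    ultimately have "?h ?s = \<zero>\<^bsub>K\<^esub>" by simp
    then show False
      using K.integral u w b closed[OF fA u(1)] closed[OF x(1) w(1)] by auto
  qed
  ultimately show "\<exists>J. left_ideal J ?A \<and> J \<noteq> {\<zero>\<^bsub>?A\<^esub>} \<and> (\<forall>r\<in>J. r \<otimes>\<^bsub>?A\<^esub> x = \<zero>\<^bsub>?A\<^esub> \<longrightarrow> r = \<zero>\<^bsub>?A\<^esub>)"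
    by (intro exI[of _ J]) simp
qed

section \<open>Associativity of the tensor product\<close>

text \<open>\<open>tensor_assoc\<close> nests two lifts, so two maps must be bilinear. In the outer
  one, linearity in \<open>t\<close> is that of the inner lift, while linearity in \<open>z\<close>
  concerns a parameter of that lift and has to be derived from pure tensors.\<close>

lemma tensor_assoc_inner:
  assumes L: "module K L" and M: "module K M" and N: "module K N"
  shows tensor_assoc_inner_bilinear: "z \<in> carrier N \<Longrightarrow> bilinear_map K L M (tensor K L (tensor K M N))
      (\<lambda>x y. pure_tensor K L (tensor K M N) x (pure_tensor K M N y z))"
    and tensor_assoc_bilinear: "bilinear_map K (tensor K L M) N (tensor K L (tensor K M N))
      (\<lambda>t z. tensor_lift K (tensor K L (tensor K M N))
        (\<lambda>x y. pure_tensor K L (tensor K M N) x (pure_tensor K M N y z)) t)"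
proof -
  let ?MN = "tensor K M N"
  let ?T = "tensor K L ?MN"
  note MN = tensor_module[OF M N]
  note T = tensor_module[OF L MN]
  note LM = tensor_module[OF L M]
  interpret T: module K ?T by (rule T)
  let ?\<beta> = "\<lambda>z x y. pure_tensor K L ?MN x (pure_tensor K M N y z)"
  note MN_pure = bilinear_mapD[OF pure_tensor_bilinear[OF M N]]
  note T_pure = bilinear_mapD[OF pure_tensor_bilinear[OF L MN]]
  show \<beta>: "bilinear_map K L M ?T (?\<beta> z)" if "z \<in> carrier N" for z
    using bilinear_map_pre[OF pure_tensor_bilinear[OF L MN] lin_hom_id MN_pure(1)[OF that]] .
  have z_lin: "(\<lambda>z. ?\<beta> z x y) \<in> lin_hom K N ?T" if "x \<in> carrier L" "y \<in> carrier M" for x y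
    using lin_hom_comp[OF MN_pure(2)[OF that(2)] T_pure(2)[OF that(1)]] .
  note lift = tensor_lift_lin[OF L M T \<beta>]
  note lift_pure = tensor_lift_pure[OF L M T \<beta>]
  interpret N: module K N by (rule N)
  \<comment> \<open>Induction on \<open>t\<close>: the inner lift has an explicit value only at pure
    tensors, and linearity in \<open>z\<close> survives addition.\<close>
  have "(\<lambda>z. tensor_lift K ?T (?\<beta> z) t) \<in> lin_hom K N ?T" if "t \<in> carrier (tensor K L M)" for t
    using that
  proof (induction rule: tensor_induct[OF L M, consumes 1, case_names zero pure add])
    case zero
    show ?case
      using lin_hom_zero[OF lift LM T] by (intro lin_homI) auto
  next
    case (pure x y)
    show ?case by (rule lin_hom_cong[OF z_lin[OF pure] N]) (simp add: lift_pure pure)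
  next
    case (add t u)
    have cl: "tensor_lift K ?T (?\<beta> z) t \<in> carrier ?T" "tensor_lift K ?T (?\<beta> z) u \<in> carrier ?T"
      if "z \<in> carrier N" for z
      using add that lin_hom_closed[OF lift] by auto
    have "(\<lambda>z. tensor_lift K ?T (?\<beta> z) t \<oplus>\<^bsub>?T\<^esub> tensor_lift K ?T (?\<beta> z) u) \<in> lin_hom K N ?T"
      by (intro lin_homI)
        (simp_all add: cl lin_hom_add[OF add.IH(1)] lin_hom_add[OF add.IH(2)] lin_hom_smult[OF add.IH(1)]
          lin_hom_smult[OF add.IH(2)] T.M.a_ac T.smult_r_distr)
    then show ?case
      by (rule lin_hom_cong[OF _ N]) (simp add: lin_hom_add[OF lift] add)
  qed
  then show "bilinear_map K (tensor K L M) N ?T (\<lambda>t z. tensor_lift K ?T (?\<beta> z) t)"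
    using lift by (simp add: bilinear_map_def)
qed

lemma tensor_assoc_lin:
  assumes L: "module K L" and M: "module K M" and N: "module K N"
  shows "tensor_assoc K L M N \<in> lin_hom K (tensor K (tensor K L M) N) (tensor K L (tensor K M N))"
  unfolding tensor_assoc_def Let_def
  by (rule tensor_lift_lin[OF tensor_module[OF L M] N tensor_module[OF L tensor_module[OF M N]]
        tensor_assoc_bilinear[OF assms]])

lemma tensor_assoc_pure:
  assumes "module K L" "module K M" "module K N" "t \<in> carrier (tensor K L M)" "z \<in> carrier N"
  shows "tensor_assoc K L M N (pure_tensor K (tensor K L M) N t z) =
    tensor_lift K (tensor K L (tensor K M N))
      (\<lambda>x y. pure_tensor K L (tensor K M N) x (pure_tensor K M N y z)) t"
  unfolding tensor_assoc_def Let_def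
  by (rule tensor_lift_pure[OF tensor_module[OF assms(1,2)] assms(3)
        tensor_module[OF assms(1) tensor_module[OF assms(2,3)]]
        tensor_assoc_bilinear[OF assms(1-3)] assms(4,5)])

section \<open>Comodule homomorphisms\<close>

text \<open>The form touches the left factor and \<open>h\<close> the right one, so they commute:
  both sides send x \<otimes> y to f(x) h(y).\<close>

lemma contract_tensor_map:
  assumes "module K C" "module K M" "module K N" "f \<in> lin_hom K C (scalar_module K)"
    "h \<in> lin_hom K M N" "t \<in> carrier (tensor K C M)"
  shows "contract K N f (tensor_map K C N (\<lambda>x. x) h t) = h (contract K M f t)"
proof -
  interpret C: module K C by fact
  note N = contract_bilinear[OF assms(1,3,4)]
  note M = contract_bilinear[OF assms(1,2,4)]
  have "contract K N f (tensor_map K C N (\<lambda>x. x) h t) = tensor_lift K N (\<lambda>x y. f x \<odot>\<^bsub>N\<^esub> h y) t"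
    unfolding contract_def
    by (rule tensor_lift_map[OF assms(1,2,1,3,3) lin_hom_id assms(5) N assms(6)])
  also have "\<dots> = tensor_lift K N (\<lambda>x y. h (f x \<odot>\<^bsub>M\<^esub> y)) t"
    by (rule tensor_lift_cong[OF assms(1,2,3) smult_form_bilinear(1)[OF assms(1-5)]
          bilinear_map_post[OF M assms(5)] _ assms(6)])
      (use lin_hom_closed[OF assms(4)] in \<open>simp add: lin_hom_smult[OF assms(5)]\<close>)
  also have "\<dots> = h (contract K M f t)"
    unfolding contract_def
    by (rule lin_hom_tensor_lift[OF assms(1,2,2,3) M assms(5,6), symmetric])
  finally show ?thesis .
qed

text \<open>A left comodule is a module over the dual algebra, \<open>f\<close> acting by \<open>contract K M f \<circ> coact M\<close>,
  and its homomorphisms are the maps that are linear for this action.\<close>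

lemma comodule_hom_iff_contract:
  assumes "field K" "module K C" "module K M" "module K N"
    and M: "coact M \<in> lin_hom K M (tensor K C M)" and N: "coact N \<in> lin_hom K N (tensor K C N)"
    and h: "h \<in> lin_hom K M N"
  shows "h \<in> comodule_hom K C M N \<longleftrightarrow> (\<forall>f\<in>lin_hom K C (scalar_module K). \<forall>m\<in>carrier M.
    contract K N f (coact N (h m)) = h (contract K M f (coact M m)))"
proof -
  note map = contract_tensor_map[OF assms(2-4) _ h lin_hom_closed[OF M]]
  note map_closed = lin_hom_closed[OF tensor_map_lin[OF assms(2,3,2,4) lin_hom_id h] lin_hom_closed[OF M]]
  have "coact N (h m) = tensor_map K C N (\<lambda>x. x) h (coact M m) \<longleftrightarrow>
      (\<forall>f\<in>lin_hom K C (scalar_module K). contract K N f (coact N (h m)) = h (contract K M f (coact M m)))"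
    if m: "m \<in> carrier M" for m
  proof
    assume "\<forall>f\<in>lin_hom K C (scalar_module K). contract K N f (coact N (h m)) = h (contract K M f (coact M m))"
    then show "coact N (h m) = tensor_map K C N (\<lambda>x. x) h (coact M m)"
      using map m
      by (intro tensor_eqI[OF assms(1,2,4) lin_hom_closed[OF N lin_hom_closed[OF h m]] map_closed[OF m]])
        simp
  qed (use map m in simp)
  then show ?thesis using h by (auto simp: comodule_hom_def)
qed

section \<open>Translations of a coalgebra\<close>

lemma (in coalgebra) coalgebra_modules:
  "field K" "module K C" "module K (scalar_module K)"
  by (rule field_axioms module_axioms scalar_module_module is_cring)+

context coalgebra
begin

text \<open>In Sweedler notation \<open>left_act f c\<close> is f(c_1) c_2,
  \<open>right_act f c\<close> is c_1 f(c_2), and \<open>convolution f g c\<close> is f(c_1) g(c_2).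
  The first is the action of forms on the regular left comodule; the second is the endomorphism
  attached to f.\<close>

definition left_act :: "('c \<Rightarrow> 'k) \<Rightarrow> 'c \<Rightarrow> 'c"
  where "left_act f c = contract K C f (comult C c)"

definition right_act :: "('c \<Rightarrow> 'k) \<Rightarrow> 'c \<Rightarrow> 'c"
  where "right_act f c = tensor_lift K C (\<lambda>x y. f y \<odot>\<^bsub>C\<^esub> x) (comult C c)"

definition convolution :: "('c \<Rightarrow> 'k) \<Rightarrow> ('c \<Rightarrow> 'k) \<Rightarrow> 'c \<Rightarrow> 'k"
  where "convolution f g c = tensor_lift K (scalar_module K) (\<lambda>x y. f x \<otimes>\<^bsub>K\<^esub> g y) (comult C c)"

lemmas comult_closed = lin_hom_closed[OF comult_linear]

lemma right_bilinear:
  "f \<in> lin_hom K C (scalar_module K) \<Longrightarrow> bilinear_map K C C C (\<lambda>x y. f y \<odot>\<^bsub>C\<^esub> x)"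
  using smult_form_bilinear(2)[OF _ _ _ _ lin_hom_id] coalgebra_modules by blast

lemma left_act_lin: "f \<in> lin_hom K C (scalar_module K) \<Longrightarrow> left_act f \<in> lin_hom K C C"
  unfolding left_act_def
  by (rule lin_hom_comp[OF comult_linear contract_lin]) (simp_all add: coalgebra_modules)

lemma right_act_lin: "f \<in> lin_hom K C (scalar_module K) \<Longrightarrow> right_act f \<in> lin_hom K C C"
  unfolding right_act_def
  by (rule lin_hom_comp[OF comult_linear tensor_lift_lin]) (simp_all add: coalgebra_modules right_bilinear)

lemma form_closed: "f \<in> lin_hom K C (scalar_module K) \<Longrightarrow> c \<in> carrier C \<Longrightarrow> f c \<in> carrier K"
  using lin_hom_closed[of f K C "scalar_module K"] by simp

lemma form_smult: "f \<in> lin_hom K C (scalar_module K) \<Longrightarrow> a \<in> carrier K \<Longrightarrow> c \<in> carrier C \<Longrightarrow>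
    f (a \<odot>\<^bsub>C\<^esub> c) = a \<otimes>\<^bsub>K\<^esub> f c"
  using lin_hom_smult[of f K C "scalar_module K"] by simp

lemma convolution_left_act:
  assumes f: "f \<in> lin_hom K C (scalar_module K)" and g: "g \<in> lin_hom K C (scalar_module K)"
    and c: "c \<in> carrier C"
  shows "g (left_act f c) = convolution f g c"
proof -
  note mods = coalgebra_modules
  note \<beta> = contract_bilinear[OF mods(2,2) f]
  have "g (left_act f c) = tensor_lift K (scalar_module K) (\<lambda>x y. g (f x \<odot>\<^bsub>C\<^esub> y)) (comult C c)"
    unfolding left_act_def contract_def
    by (rule lin_hom_tensor_lift[OF mods(2,2,2,3) \<beta> g comult_closed[OF c]])
  also have "\<dots> = convolution f g c"
    unfolding convolution_def
    by (rule tensor_lift_cong[OF mods(2,2,3) bilinear_map_post[OF \<beta> g] dual_mult_bilinear[OF mods(2) f g] _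
          comult_closed[OF c]])
      (simp add: form_smult[OF g] form_closed[OF f])
  finally show ?thesis .
qed

lemma convolution_right_act:
  assumes f: "f \<in> lin_hom K C (scalar_module K)" and g: "g \<in> lin_hom K C (scalar_module K)"
    and c: "c \<in> carrier C"
  shows "f (right_act g c) = convolution f g c"
proof -
  note mods = coalgebra_modules
  note \<beta> = right_bilinear[OF g]
  have "f (right_act g c) = tensor_lift K (scalar_module K) (\<lambda>x y. f (g y \<odot>\<^bsub>C\<^esub> x)) (comult C c)"
    unfolding right_act_def
    by (rule lin_hom_tensor_lift[OF mods(2,2,2,3) \<beta> f comult_closed[OF c]])
  also have "\<dots> = convolution f g c"
    unfolding convolution_def
    by (rule tensor_lift_cong[OF mods(2,2,3) bilinear_map_post[OF \<beta> f] dual_mult_bilinear[OF mods(2) f g] _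
          comult_closed[OF c]])
      (simp add: form_smult[OF f] form_closed[OF g] form_closed[OF f] m_comm)
  finally show ?thesis .
qed

text \<open>Both sides are the convolution of the counit with \<open>f\<close>. Hence
  \<open>right_act f\<close> determines \<open>f\<close>, which is how x \<noteq> 0 yields a
  non-zero image.\<close>

lemma counit_right_act:
  assumes f: "f \<in> lin_hom K C (scalar_module K)" and c: "c \<in> carrier C"
  shows "counit C (right_act f c) = f c"
proof -
  have "counit C (right_act f c) = f (left_act (counit C) c)"
    using convolution_left_act[OF counit_linear f c] convolution_right_act[OF counit_linear f c] by simp
  also have "left_act (counit C) c = c"
    using counit_left[OF c] by (simp add: left_act_def contract_def)
  finally show ?thesis .
qed

text \<open>Both sides are \<open>c \<mapsto> (f \<otimes> id \<otimes> g)\<close> applied to the twofold comultiplication.\<close>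

lemma right_act_left_act:
  assumes f: "f \<in> lin_hom K C (scalar_module K)" and g: "g \<in> lin_hom K C (scalar_module K)"
    and c: "c \<in> carrier C"
  shows "right_act g (left_act f c) = left_act f (right_act g c)"
proof -
  note C = coalgebra_modules(2)
  let ?T = "tensor K C C"
  note T = tensor_module[OF C C]
  note TC = tensor_module[OF T C] and CT = tensor_module[OF C T]
  note t = comult_closed[OF c]
  define r where "r = tensor_lift K C (\<lambda>x y. g y \<odot>\<^bsub>C\<^esub> x)"
  have r: "r \<in> lin_hom K ?T C"
    unfolding r_def by (rule tensor_lift_lin[OF C C C right_bilinear[OF g]])
  have r_pure: "r (pure_tensor K C C x y) = g y \<odot>\<^bsub>C\<^esub> x" if "x \<in> carrier C" "y \<in> carrier C" for x y
    unfolding r_def using that by (rule tensor_lift_pure[OF C C C right_bilinear[OF g]])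
  have r_comult: "r (comult C d) = right_act g d" for d by (simp add: r_def right_act_def)
  \<comment> \<open>\<Theta> is f \<otimes> id \<otimes> g on C \<otimes> (C \<otimes> C), and the
    lift of \<open>?\<kappa>\<close> below is the same map on (C \<otimes> C) \<otimes> C. That the
    associativity isomorphism matches them is tested on pure tensors, first of the outer and then of
    the inner product.\<close>
  let ?\<theta> = "\<lambda>x s. f x \<odot>\<^bsub>C\<^esub> r s"
  define \<Theta> where "\<Theta> = tensor_lift K C ?\<theta>"
  have \<theta>: "bilinear_map K C ?T C ?\<theta>" by (rule smult_form_bilinear(1)[OF C T C f r])
  have \<Theta>: "\<Theta> \<in> lin_hom K (tensor K C ?T) C" unfolding \<Theta>_def by (rule tensor_lift_lin[OF C T C \<theta>])
  let ?\<kappa> = "\<lambda>s y. g y \<odot>\<^bsub>C\<^esub> contract K C f s"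
  have \<kappa>: "bilinear_map K ?T C C ?\<kappa>"
    by (rule smult_form_bilinear(2)[OF C T C g contract_lin[OF C C f]])
  have assoc: "\<Theta> (tensor_assoc K C C C u) = tensor_lift K C ?\<kappa> u" if "u \<in> carrier (tensor K ?T C)" for u
  proof (rule tensor_ext[OF T C C lin_hom_comp[OF tensor_assoc_lin[OF C C C] \<Theta>] tensor_lift_lin[OF T C C \<kappa>] _ that])
    fix s z assume s: "s \<in> carrier ?T" and z: "z \<in> carrier C"
    note inner = tensor_assoc_inner_bilinear[OF C C C z]
    have \<kappa>z: "(\<lambda>s. ?\<kappa> s z) \<in> lin_hom K ?T C" by (rule bilinear_mapD(1)[OF \<kappa> z])
    have "\<Theta> (tensor_lift K (tensor K C ?T) (\<lambda>x y. pure_tensor K C ?T x (pure_tensor K C C y z)) s) =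
        g z \<odot>\<^bsub>C\<^esub> contract K C f s"
    proof (rule tensor_ext[OF C C C lin_hom_comp[OF tensor_lift_lin[OF C C CT inner] \<Theta>] \<kappa>z _ s])
      fix x y assume xy: "x \<in> carrier C" "y \<in> carrier C"
      have "\<Theta> (pure_tensor K C ?T x (pure_tensor K C C y z)) = f x \<odot>\<^bsub>C\<^esub> (g z \<odot>\<^bsub>C\<^esub> y)"
        unfolding \<Theta>_def using xy z
        by (simp add: tensor_lift_pure[OF C T C \<theta>] pure_tensor_closed[OF C C] r_pure)
      also have "\<dots> = g z \<odot>\<^bsub>C\<^esub> (f x \<odot>\<^bsub>C\<^esub> y)"
        using xy z form_closed[OF f] form_closed[OF g]
        by (simp add: smult_assoc1[symmetric] m_comm)
      finally show "\<Theta> (tensor_lift K (tensor K C ?T) (\<lambda>x y. pure_tensor K C ?T x (pure_tensor K C C y z))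
          (pure_tensor K C C x y)) = g z \<odot>\<^bsub>C\<^esub> contract K C f (pure_tensor K C C x y)"
        using xy by (simp add: tensor_lift_pure[OF C C CT inner] contract_pure[OF C C f])
    qed
    then show "\<Theta> (tensor_assoc K C C C (pure_tensor K ?T C s z)) = tensor_lift K C ?\<kappa> (pure_tensor K ?T C s z)"
      using s z by (simp add: tensor_assoc_pure[OF C C C] tensor_lift_pure[OF T C C \<kappa>])
  qed
  have "left_act f (right_act g c) = tensor_lift K C (\<lambda>x y. left_act f (g y \<odot>\<^bsub>C\<^esub> x)) (comult C c)"
    unfolding right_act_def
    by (rule lin_hom_tensor_lift[OF C C C C right_bilinear[OF g] left_act_lin[OF f] t])
  also have "\<dots> = tensor_lift K C (\<lambda>x y. ?\<kappa> (comult C x) y) (comult C c)"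
    by (rule tensor_lift_cong[OF C C C bilinear_map_post[OF right_bilinear[OF g] left_act_lin[OF f]]
          bilinear_map_pre[OF \<kappa> comult_linear lin_hom_id] _ t])
      (simp add: lin_hom_smult[OF left_act_lin[OF f]] form_closed[OF g] left_act_def[symmetric])
  also have "\<dots> = tensor_lift K C ?\<kappa> (tensor_map K ?T C (comult C) (\<lambda>x. x) (comult C c))"
    by (rule tensor_lift_map[OF C C T C C comult_linear lin_hom_id \<kappa> t, symmetric])
  also have "\<dots> = \<Theta> (tensor_assoc K C C C (tensor_map K ?T C (comult C) (\<lambda>x. x) (comult C c)))"
    by (rule assoc[symmetric], rule lin_hom_closed[OF tensor_map_lin[OF C C T C comult_linear lin_hom_id] t])
  \<comment> \<open>Coassociativity of \<open>C\<close> enters here.\<close>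
  also have "\<dots> = \<Theta> (tensor_map K C ?T (\<lambda>x. x) (comult C) (comult C c))"
    by (simp add: coassoc[OF c])
  also have "\<dots> = tensor_lift K C (\<lambda>x y. f x \<odot>\<^bsub>C\<^esub> r (comult C y)) (comult C c)"
    unfolding \<Theta>_def by (rule tensor_lift_map[OF C C C T C lin_hom_id comult_linear \<theta> t])
  also have "\<dots> = tensor_lift K C (\<lambda>x y. right_act g (f x \<odot>\<^bsub>C\<^esub> y)) (comult C c)"
    by (rule tensor_lift_cong[OF C C C bilinear_map_pre[OF \<theta> lin_hom_id comult_linear]
          bilinear_map_post[OF contract_bilinear[OF C C f] right_act_lin[OF g]] _ t])
      (simp add: lin_hom_smult[OF right_act_lin[OF g]] form_closed[OF f] r_comult)
  also have "\<dots> = right_act g (left_act f c)"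
    unfolding left_act_def contract_def
    by (rule lin_hom_tensor_lift[OF C C C C contract_bilinear[OF C C f] right_act_lin[OF g] t, symmetric])
  finally show ?thesis by simp
qed

end

section \<open>Left ideals obtained from comodule projections\<close>

context coalgebra
begin

lemma convolution_eq:
  "c \<in> carrier C \<Longrightarrow> (f \<otimes>\<^bsub>dual_algebra K C\<^esub> g) c = convolution f g c"
  by (simp add: dual_algebra_simps convolution_def)

text \<open>If \<open>e\<close> is a comodule projection onto the image of \<open>right_act x\<close>, then \<open>e\<close> is
  \<open>right_act (\<epsilon> \<circ> e)\<close> and \<open>J\<close> is the left ideal generated by the idempotent \<open>\<epsilon> \<circ> e\<close>, which
  has the same left annihilator as \<open>x\<close>.\<close>

lemma left_ideal_of_projection:
  assumes x: "x \<in> carrier (dual_algebra K C)" "x \<noteq> \<zero>\<^bsub>dual_algebra K C\<^esub>"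
    and e: "e \<in> lin_hom K C C"
    and e_act: "\<And>f c. f \<in> lin_hom K C (scalar_module K) \<Longrightarrow> c \<in> carrier C \<Longrightarrow>
      e (left_act f c) = left_act f (e c)"
    and e_image: "\<And>c. c \<in> carrier C \<Longrightarrow> \<exists>d\<in>carrier C. e c = right_act x d"
    and e_fix: "\<And>c. c \<in> carrier C \<Longrightarrow> e (right_act x c) = right_act x c"
  shows "\<exists>J. left_ideal J (dual_algebra K C) \<and> J \<noteq> {\<zero>\<^bsub>dual_algebra K C\<^esub>} \<and>
    (\<forall>r\<in>J. r \<otimes>\<^bsub>dual_algebra K C\<^esub> x = \<zero>\<^bsub>dual_algebra K C\<^esub> \<longrightarrow> r = \<zero>\<^bsub>dual_algebra K C\<^esub>)"
proof -
  let ?A = "dual_algebra K C"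
  note C = coalgebra_modules(2)
  note e_closed = lin_hom_closed[OF e]
  interpret A: abelian_group ?A by (rule dual_algebra_abelian_group[OF is_cring C])
  have form: "f \<in> lin_hom K C (scalar_module K)" if "f \<in> carrier ?A" for f
    using that by (simp add: dual_algebra_carrier)
  have right_closed: "right_act x c \<in> carrier C" if "c \<in> carrier C" for c
    using lin_hom_closed[OF right_act_lin[OF form[OF x(1)]] that] .
  define J where "J = {f \<in> carrier ?A. \<forall>c\<in>carrier C. f (e c) = f c}"
  have J: "left_ideal J ?A"
  proof (rule dual_left_idealI[OF is_cring C])
    show "(\<lambda>c\<in>carrier C. \<zero>\<^bsub>K\<^esub>) \<in> J"
      using A.zero_closed by (simp add: J_def dual_algebra_simps(1) e_closed)
    show "(\<lambda>c\<in>carrier C. f c \<oplus>\<^bsub>K\<^esub> g c) \<in> J" if "f \<in> J" "g \<in> J" for f g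
      using that A.a_closed[of f g] by (simp add: J_def dual_algebra_simps(2) e_closed)
    show "(\<lambda>c\<in>carrier C. \<ominus>\<^bsub>K\<^esub> f c) \<in> J" if "f \<in> J" for f
      using that dual_algebra_neg[OF is_cring C, of f] by (simp add: J_def e_closed)
    fix r f assume r: "r \<in> carrier ?A" and f: "f \<in> J"
    then have f': "f \<in> carrier ?A" by (simp add: J_def)
    note lin = form[OF r] form[OF f']
    \<comment> \<open>The product r f is f composed with \<open>left_act r\<close>, and
      \<open>e\<close> commutes with \<open>left_act r\<close>; hence fixing by \<open>e\<close>
      passes from f to r f.\<close>
    have "convolution r f (e c) = convolution r f c" if c: "c \<in> carrier C" for c
      using f c lin_hom_closed[OF left_act_lin[OF lin(1)] c]
      by (simp add: convolution_left_act[OF lin, symmetric] e_closed e_act[OF lin(1), symmetric] J_def)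
    then show "r \<otimes>\<^bsub>?A\<^esub> f \<in> J"
      using dual_mult_closed[OF C C comult_linear lin] by (simp add: J_def convolution_eq e_closed)
  qed (auto simp: J_def)
  define y where "y = (\<lambda>c\<in>carrier C. counit C (e c))"
  have "y \<in> carrier ?A"
    unfolding y_def by (rule restrict_dual[OF lin_hom_comp[OF e counit_linear] C])
  \<comment> \<open>\<open>e\<close> is idempotent: its values lie in the image of
    \<open>right_act x\<close>, on which it is the identity.\<close>
  then have "y \<in> J"
    using e_image e_fix by (fastforce simp: J_def y_def e_closed)
  moreover have "y \<noteq> \<zero>\<^bsub>?A\<^esub>"
  proof
    assume y: "y = \<zero>\<^bsub>?A\<^esub>"
    have "x c = \<zero>\<^bsub>?A\<^esub> c" if c: "c \<in> carrier C" for c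
    proof -
      have "x c = y (right_act x c)"
        using counit_right_act[OF form[OF x(1)] c] right_closed[OF c] e_fix[OF c] by (simp add: y_def)
      then show ?thesis using y c right_closed[OF c] by (simp add: dual_algebra_simps(1))
    qed
    then show False using dual_algebra_eqI[OF x(1) A.zero_closed] x(2) by blast
  qed
  ultimately have "J \<noteq> {\<zero>\<^bsub>?A\<^esub>}" by blast
  moreover have "r = \<zero>\<^bsub>?A\<^esub>" if r: "r \<in> J" and rx: "r \<otimes>\<^bsub>?A\<^esub> x = \<zero>\<^bsub>?A\<^esub>" for r
  proof -
    have rA: "r \<in> carrier ?A" using r by (simp add: J_def)
    show ?thesis
    proof (rule dual_algebra_eqI[OF rA A.zero_closed])
      fix c assume c: "c \<in> carrier C"
      then obtain d where d: "d \<in> carrier C" "e c = right_act x d" using e_image by blast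
      have "r c = r (e c)" using r c by (simp add: J_def)
      also have "\<dots> = convolution r x d"
        using d convolution_right_act[OF form[OF rA] form[OF x(1)] d(1)] by simp
      also have "\<dots> = (r \<otimes>\<^bsub>?A\<^esub> x) d" by (simp add: convolution_eq[OF d(1)])
      finally show "r c = \<zero>\<^bsub>?A\<^esub> c" using rx c d by (simp add: dual_algebra_simps(1))
    qed
  qed
  ultimately show ?thesis using J by blast
qed

end

section \<open>Quotient comodules\<close>

text \<open>Adding or changing a coaction leaves the tensor product literally the same set of
  cosets, so tensors over a comodule record and over its underlying module can be exchanged.\<close>

lemma tensor_cong_right:
  assumes "carrier N = carrier N'" "add N = add N'" "smult N = smult N'"
  shows "tensor K M N = tensor K M N'" "pure_tensor K M N = pure_tensor K M N'"
  using assms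
  by (simp_all add: tensor_def pure_tensor_def tensor_kernel_def tensor_relators_def fun_eq_iff)

text \<open>The two contractions are sums formed in different records; the identity map from
  \<open>N\<close> to \<open>N'\<close> is linear and therefore carries one to the other.\<close>

lemma contract_cong:
  assumes "module K M" "module K N" "module K N'"
    "carrier N = carrier N'" "add N = add N'" "smult N = smult N'"
    and "f \<in> lin_hom K M (scalar_module K)" "t \<in> carrier (tensor K M N)"
  shows "contract K N f t = contract K N' f t"
proof -
  have id: "(\<lambda>y. y) \<in> lin_hom K N N'" using assms by (simp add: lin_hom_def)
  show ?thesis
    using lin_hom_tensor_lift[OF assms(1,2,2,3) contract_bilinear[OF assms(1,2,7)] id assms(8)] assms(6)
    by (simp add: contract_def)
qed

lemma quot_comodule_simps:
  "carrier (quot_comodule K C M D) = carrier (quot_module M D)"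
  "\<zero>\<^bsub>quot_comodule K C M D\<^esub> = \<zero>\<^bsub>quot_module M D\<^esub>"
  "add (quot_comodule K C M D) = add (quot_module M D)"
  "smult (quot_comodule K C M D) = smult (quot_module M D)"
  "coact (quot_comodule K C M D) X =
    tensor_map K C (quot_module M D) (\<lambda>x. x) (\<lambda>x. D +>\<^bsub>M\<^esub> x) (coact M (SOME x. x \<in> X))"
  by (simp_all add: quot_comodule_def module.extend_def comodule.fields_def)

lemma quot_comodule_module:
  "module K M \<Longrightarrow> submodule D K M \<Longrightarrow> module K (quot_comodule K C M D)"
  by (rule module_image[OF quot_module_module, where h = "\<lambda>x. x"]) (simp_all add: quot_comodule_simps)

lemma quot_comodule_proj_lin:
  "module K M \<Longrightarrow> submodule D K M \<Longrightarrow> (\<lambda>x. D +>\<^bsub>M\<^esub> x) \<in> lin_hom K M (quot_comodule K C M D)"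
  using quot_proj_lin[of K M D] by (simp add: lin_hom_def quot_comodule_simps)

lemma coset_rep:
  assumes "module K M" "submodule D K M" "x \<in> carrier M"
  shows "(SOME z. z \<in> D +>\<^bsub>M\<^esub> x) \<in> carrier M" "D +>\<^bsub>M\<^esub> (SOME z. z \<in> D +>\<^bsub>M\<^esub> x) = D +>\<^bsub>M\<^esub> x"
proof -
  have "(SOME z. z \<in> D +>\<^bsub>M\<^esub> x) \<in> D +>\<^bsub>M\<^esub> x"
    unfolding some_in_eq using coset_self[OF assms] by auto
  then show "(SOME z. z \<in> D +>\<^bsub>M\<^esub> x) \<in> carrier M" "D +>\<^bsub>M\<^esub> (SOME z. z \<in> D +>\<^bsub>M\<^esub> x) = D +>\<^bsub>M\<^esub> x"
    using mem_coset_iff[OF assms] by auto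
qed

text \<open>The coaction of the quotient is evaluated at a chosen representative. Stability of
  \<open>D\<close> under \<open>f\<close> makes the results for two representatives differ by an
  element of \<open>D\<close>, so the action is the expected one on cosets.\<close>

lemma quot_comodule_contract:
  assumes C: "module K C" and M: "module K M" and coact: "coact M \<in> lin_hom K M (tensor K C M)"
    and D: "submodule D K M" and f: "f \<in> lin_hom K C (scalar_module K)" and m: "m \<in> carrier M"
    and stable: "\<And>d. d \<in> D \<Longrightarrow> contract K M f (coact M d) \<in> D"
  shows "contract K (quot_comodule K C M D) f (coact (quot_comodule K C M D) (D +>\<^bsub>M\<^esub> m)) =
    D +>\<^bsub>M\<^esub> contract K M f (coact M m)"
proof -
  interpret M: module K M by (rule M)
  let ?Q = "quot_module M D"
  note Q = quot_module_module[OF M D]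
  note proj = quot_proj_lin[OF M D]
  note act = lin_hom_comp[OF coact contract_lin[OF C M f]]
  define n where "n = (SOME z. z \<in> D +>\<^bsub>M\<^esub> m)"
  have n: "n \<in> carrier M" "D +>\<^bsub>M\<^esub> n = D +>\<^bsub>M\<^esub> m"
    unfolding n_def by (rule coset_rep[OF M D m])+
  have "contract K (quot_comodule K C M D) f (coact (quot_comodule K C M D) (D +>\<^bsub>M\<^esub> m)) =
      contract K ?Q f (tensor_map K C ?Q (\<lambda>x. x) (\<lambda>x. D +>\<^bsub>M\<^esub> x) (coact M n))"
    unfolding quot_comodule_simps n_def[symmetric]
    by (rule contract_cong[OF C Q quot_comodule_module[OF M D], symmetric])
      (simp_all add: quot_comodule_simps f
        lin_hom_closed[OF tensor_map_lin[OF C M C Q lin_hom_id proj] lin_hom_closed[OF coact n(1)]])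
  also have "\<dots> = D +>\<^bsub>M\<^esub> contract K M f (coact M n)"
    by (rule contract_tensor_map[OF C M Q f proj lin_hom_closed[OF coact n(1)]])
  also have "\<dots> = D +>\<^bsub>M\<^esub> contract K M f (coact M m)"
  proof -
    have "n \<ominus>\<^bsub>M\<^esub> m \<in> D" using n coset_eq_iff[OF M D n(1) m] by simp
    then have "contract K M f (coact M n) \<ominus>\<^bsub>M\<^esub> contract K M f (coact M m) \<in> D"
      using stable lin_hom_minus[OF act M M n(1) m] by metis
    then show ?thesis
      using coset_eq_iff[OF M D lin_hom_closed[OF act n(1)] lin_hom_closed[OF act m]] by simp
  qed
  finally show ?thesis .
qed

lemma minus_eq_zero_iff:
  assumes "module K M" "x \<in> carrier M" "y \<in> carrier M"
  shows "x \<ominus>\<^bsub>M\<^esub> y = \<zero>\<^bsub>M\<^esub> \<longleftrightarrow> x = y"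
proof -
  interpret M: module K M by fact
  have "x = (x \<ominus>\<^bsub>M\<^esub> y) \<oplus>\<^bsub>M\<^esub> y" using assms by (simp add: a_minus_def M.M.a_assoc M.M.l_neg)
  then show ?thesis using assms by (auto simp: a_minus_def M.M.r_neg)
qed

text \<open>This makes the map induced on cosets of the kernel well defined and injective at once.
  The kernel is written as a preimage of the zero subspace so that \<open>submodule_vimage\<close>
  applies to it.\<close>

lemma coset_kernel_eq_iff:
  assumes h: "h \<in> lin_hom K M P" and M: "module K M" and P: "module K P"
    and xy: "x \<in> carrier M" "y \<in> carrier M"
  defines "D \<equiv> {x \<in> carrier M. h x \<in> {\<zero>\<^bsub>P\<^esub>}}"
  shows "D +>\<^bsub>M\<^esub> x = D +>\<^bsub>M\<^esub> y \<longleftrightarrow> h x = h y"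
proof -
  interpret M: module K M by (rule M)
  have "D +>\<^bsub>M\<^esub> x = D +>\<^bsub>M\<^esub> y \<longleftrightarrow> x \<ominus>\<^bsub>M\<^esub> y \<in> D"
    unfolding D_def by (rule coset_eq_iff[OF M submodule_vimage[OF h M P submodule_zero[OF P]] xy])
  also have "\<dots> \<longleftrightarrow> h x \<ominus>\<^bsub>P\<^esub> h y = \<zero>\<^bsub>P\<^esub>"
    using xy by (simp add: D_def lin_hom_minus[OF h M P xy])
  also have "\<dots> \<longleftrightarrow> h x = h y"
    by (rule minus_eq_zero_iff[OF P]) (use xy lin_hom_closed[OF h] in auto)
  finally show ?thesis .
qed

lemma regular_comodule_simps:
  "carrier (regular_comodule C) = carrier C" "\<zero>\<^bsub>regular_comodule C\<^esub> = \<zero>\<^bsub>C\<^esub>"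
  "add (regular_comodule C) = add C" "smult (regular_comodule C) = smult C"
  "coact (regular_comodule C) = comult C"
  by (simp_all add: regular_comodule_def module.extend_def module.truncate_def comodule.fields_def)

lemma regular_comodule_module: "module K C \<Longrightarrow> module K (regular_comodule C)"
  by (rule module_image[of K C, where h = "\<lambda>x. x"]) (simp_all add: regular_comodule_simps)

lemma regular_comodule_lin_hom:
  "lin_hom K (regular_comodule C) P = lin_hom K C P" "lin_hom K P (regular_comodule C) = lin_hom K P C"
  by (simp_all add: lin_hom_def regular_comodule_simps)

lemma regular_comodule_tensor: "tensor K M (regular_comodule C) = tensor K M C"
  by (rule tensor_cong_right) (simp_all add: regular_comodule_simps)

lemma (in coalgebra) regular_comodule_contract:
  assumes "f \<in> lin_hom K C (scalar_module K)" "c \<in> carrier C"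
  shows "contract K (regular_comodule C) f (comult C c) = left_act f c"
  unfolding left_act_def
  by (rule contract_cong[OF coalgebra_modules(2) regular_comodule_module[OF coalgebra_modules(2)] coalgebra_modules(2)])
    (simp_all add: regular_comodule_simps regular_comodule_tensor assms comult_closed)

text \<open>The elements \<open>left_act f d\<close> are exactly the contractions of the coaction at
  \<open>d\<close>, so \<open>tensor_separation\<close> moves the right factors into
  \<open>D\<close>.\<close>

lemma (in coalgebra) subcomodule_regularI:
  assumes "submodule D K (regular_comodule C)"
    and "\<And>f d. f \<in> lin_hom K C (scalar_module K) \<Longrightarrow> d \<in> D \<Longrightarrow> left_act f d \<in> D"
  shows "subcomodule D K C (regular_comodule C)"
proof -
  note R = regular_comodule_module[OF coalgebra_modules(2)]
  have "d \<in> carrier C" if "d \<in> D" for d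
    using submoduleD(1)[OF R assms(1) that] by (simp add: regular_comodule_simps)
  then have "coact (regular_comodule C) d \<in> lin_span K (tensor K C (regular_comodule C))
      {pure_tensor K C (regular_comodule C) c y | c y. c \<in> carrier C \<and> y \<in> D}" if "d \<in> D" for d
    using that assms(2)
    by (intro tensor_separation[OF coalgebra_modules(1,2) R assms(1)])
      (simp_all add: regular_comodule_simps(5) regular_comodule_tensor comult_closed regular_comodule_contract)
  then show ?thesis using assms(1) by (simp add: subcomodule_def)
qed

section \<open>Hereditary coalgebras\<close>

theorem hereditary_coalgebra_nonsingular:
  assumes "hereditary_coalgebra K C"
  shows "nonsingular_coalgebra K C"
  unfolding nonsingular_coalgebra_def
proof (rule left_nonsingularI)
  interpret coalgebra K C using assms by (simp add: hereditary_coalgebra_def)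
  let ?A = "dual_algebra K C" and ?R = "regular_comodule C" and ?S = "scalar_module K"
  note C = coalgebra_modules(2)
  note R = regular_comodule_module[OF C]
  have coact: "coact ?R \<in> lin_hom K ?R (tensor K C ?R)"
    using comult_linear by (simp add: regular_comodule_simps regular_comodule_lin_hom regular_comodule_tensor)
  fix x assume x: "x \<in> carrier ?A" "x \<noteq> \<zero>\<^bsub>?A\<^esub>"
  let ?r = "right_act x"
  have x_lin: "x \<in> lin_hom K C ?S" using x by (simp add: dual_algebra_carrier)
  have r: "?r \<in> lin_hom K ?R ?R" using right_act_lin[OF x_lin] by (simp add: regular_comodule_lin_hom)
  note r_closed = lin_hom_closed[OF right_act_lin[OF x_lin]]
  note act_closed = lin_hom_closed[OF left_act_lin]
  define D where "D = {c \<in> carrier ?R. ?r c \<in> {\<zero>\<^bsub>?R\<^esub>}}"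
  \<comment> \<open>The quotient by \<open>Z\<close> is a copy of \<open>C\<close> carried by the
    type \<open>'c set\<close>, as the test comodules for injectivity must be.\<close>
  define Z where "Z = {\<zero>\<^bsub>?R\<^esub>}"
  have D: "submodule D K ?R"
    unfolding D_def by (rule submodule_vimage[OF r R R submodule_zero[OF R]])
  have Z: "submodule Z K ?R" unfolding Z_def by (rule submodule_zero[OF R])
  have act_zero: "left_act f \<zero>\<^bsub>C\<^esub> = \<zero>\<^bsub>C\<^esub>" if "f \<in> lin_hom K C ?S" for f
    by (rule lin_hom_zero[OF left_act_lin[OF that] C C])
  \<comment> \<open>The kernel is stable because \<open>right_act x\<close> commutes with every
    \<open>left_act f\<close>.\<close>
  have D_stable: "left_act f d \<in> D" if "f \<in> lin_hom K C ?S" "d \<in> D" for f d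
    using that by (simp add: D_def regular_comodule_simps act_closed right_act_left_act[OF _ x_lin] act_zero)
  have Z_stable: "left_act f d \<in> Z" if "f \<in> lin_hom K C ?S" "d \<in> Z" for f d
    using that by (simp add: Z_def regular_comodule_simps act_zero)
  let ?Q = "quot_comodule K C ?R D" and ?N = "quot_comodule K C ?R Z"
  let ?\<pi> = "\<lambda>c. D +>\<^bsub>?R\<^esub> c" and ?\<zeta> = "\<lambda>c. Z +>\<^bsub>?R\<^esub> c"
  have inj_comod: "injective_comodule K C ?Q" "injective_comodule K C ?N"
    using assms subcomodule_regularI[OF D D_stable] subcomodule_regularI[OF Z Z_stable]
    by (auto simp: hereditary_coalgebra_def)
  \<comment> \<open>The comodule laws of both quotients are part of their injectivity, which
    heredity supplies.\<close>
  then have comod: "left_comodule K C ?Q" "left_comodule K C ?N" by (auto simp: injective_comodule_def)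
  note Q = quot_comodule_module[OF R D, of C] and N = quot_comodule_module[OF R Z, of C]
  note Q_coact = left_comodule.coact_linear[OF comod(1)] and N_coact = left_comodule.coact_linear[OF comod(2)]
  note \<pi> = quot_comodule_proj_lin[OF R D, of C, unfolded regular_comodule_lin_hom]
    and \<zeta> = quot_comodule_proj_lin[OF R Z, of C, unfolded regular_comodule_lin_hom]
  have Q_cases: "\<exists>c\<in>carrier C. X = ?\<pi> c" if "X \<in> carrier ?Q" for X
    using that by (auto simp: quot_comodule_simps quot_module_carrier regular_comodule_simps)
  have Q_act: "contract K ?Q f (coact ?Q (?\<pi> c)) = ?\<pi> (left_act f c)"
    if "f \<in> lin_hom K C ?S" "c \<in> carrier C" for f c
    using quot_comodule_contract[OF C R coact D that(1), of c] that D_stable submoduleD(1)[OF R D]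
    by (simp add: regular_comodule_simps regular_comodule_contract)
  have N_act: "contract K ?N f (coact ?N (?\<zeta> c)) = ?\<zeta> (left_act f c)"
    if "f \<in> lin_hom K C ?S" "c \<in> carrier C" for f c
    using quot_comodule_contract[OF C R coact Z that(1), of c] that Z_stable submoduleD(1)[OF R Z]
    by (simp add: regular_comodule_simps regular_comodule_contract)
  have \<pi>_eq: "?\<pi> c = ?\<pi> d \<longleftrightarrow> ?r c = ?r d" if "c \<in> carrier C" "d \<in> carrier C" for c d
    unfolding D_def by (rule coset_kernel_eq_iff[OF r R R]) (simp_all add: regular_comodule_simps that)
  have \<zeta>_eq: "?\<zeta> c = ?\<zeta> d \<longleftrightarrow> c = d" if "c \<in> carrier C" "d \<in> carrier C" for c d
    using coset_eq_iff[OF R Z, of c d] minus_eq_zero_iff[OF R, of c d] that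
    by (simp add: regular_comodule_simps(1) Z_def)
  \<comment> \<open>The injective map C/D \<rightarrow> C induced by \<open>right_act x\<close>,
    with the same image.\<close>
  define \<rho> where "\<rho> X = ?r (SOME c. c \<in> X)" for X
  have \<rho>: "\<rho> (?\<pi> c) = ?r c" if "c \<in> carrier C" for c
    using coset_rep[OF R D, of c] \<pi>_eq[of "SOME d. d \<in> ?\<pi> c" c] that
    by (simp add: \<rho>_def regular_comodule_simps(1))
  have \<rho>_lin: "\<rho> \<in> lin_hom K ?Q C"
  proof (rule lin_homI)
    fix X assume "X \<in> carrier ?Q"
    then show "\<rho> X \<in> carrier C" using Q_cases \<rho> r_closed by fastforce
  next
    fix X Y assume "X \<in> carrier ?Q" "Y \<in> carrier ?Q"
    then obtain c d where cd: "c \<in> carrier C" "d \<in> carrier C" "X = ?\<pi> c" "Y = ?\<pi> d" using Q_cases by meson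
    then show "\<rho> (X \<oplus>\<^bsub>?Q\<^esub> Y) = \<rho> X \<oplus>\<^bsub>C\<^esub> \<rho> Y"
      by (simp add: lin_hom_add[OF \<pi>, symmetric] \<rho> lin_hom_add[OF right_act_lin[OF x_lin]])
  next
    fix a X assume a: "a \<in> carrier K" "X \<in> carrier ?Q"
    then obtain c where c: "c \<in> carrier C" "X = ?\<pi> c" using Q_cases by meson
    then show "\<rho> (a \<odot>\<^bsub>?Q\<^esub> X) = a \<odot>\<^bsub>C\<^esub> \<rho> X"
      using a by (simp add: lin_hom_smult[OF \<pi>, symmetric] \<rho> lin_hom_smult[OF right_act_lin[OF x_lin]])
  qed
  have \<rho>_act: "\<rho> (contract K ?Q f (coact ?Q X)) = left_act f (\<rho> X)"
    if f: "f \<in> lin_hom K C ?S" and X: "X \<in> carrier ?Q" for f X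
  proof -
    obtain c where c: "c \<in> carrier C" "X = ?\<pi> c" using Q_cases X by meson
    then show ?thesis
      using f by (simp add: Q_act \<rho> act_closed right_act_left_act[OF f x_lin])
  qed
  \<comment> \<open>The embedding of C/D into the copy C/0 of C.\<close>
  let ?i = "\<lambda>X. ?\<zeta> (\<rho> X)"
  have i: "?i \<in> comodule_hom K C ?Q ?N"
    using lin_hom_closed[OF \<rho>_lin]
    by (simp add: comodule_hom_iff_contract[OF coalgebra_modules(1) C Q N Q_coact N_coact lin_hom_comp[OF \<rho>_lin \<zeta>]]
        \<rho>_act N_act)
  have i_inj: "inj_on ?i (carrier ?Q)"
  proof (rule inj_onI)
    fix X Y assume XY: "X \<in> carrier ?Q" "Y \<in> carrier ?Q" "?i X = ?i Y"
    obtain c d where cd: "c \<in> carrier C" "d \<in> carrier C" "X = ?\<pi> c" "Y = ?\<pi> d"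
      using Q_cases XY(1,2) by meson
    then have "?\<zeta> (?r c) = ?\<zeta> (?r d)" using XY(3) by (simp add: \<rho>)
    then have "?r c = ?r d" using \<zeta>_eq[OF r_closed r_closed, OF cd(1,2)] by simp
    then show "X = Y" using cd \<pi>_eq by simp
  qed
  have id: "(\<lambda>X. X) \<in> comodule_hom K C ?Q ?Q"
    by (simp add: comodule_hom_iff_contract[OF coalgebra_modules(1) C Q Q Q_coact Q_coact lin_hom_id])
  \<comment> \<open>Injectivity of C/D, applied to its identity along the embedding, gives a
    retraction of C/0 onto C/D.\<close>
  obtain g where g: "g \<in> comodule_hom K C ?N ?Q" and gi: "\<And>X. X \<in> carrier ?Q \<Longrightarrow> g (?i X) = X"
    using inj_comod(1) comod i i_inj id unfolding injective_comodule_def by meson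
  have g_lin: "g \<in> lin_hom K ?N ?Q" using g by (simp add: comodule_hom_def)
  have g_act: "g (contract K ?N f (coact ?N Y)) = contract K ?Q f (coact ?Q (g Y))"
    if "f \<in> lin_hom K C ?S" "Y \<in> carrier ?N" for f Y
    using g that by (simp add: comodule_hom_iff_contract[OF coalgebra_modules(1) C N Q N_coact Q_coact g_lin])
  let ?e = "\<lambda>c. \<rho> (g (?\<zeta> c))"
  show "\<exists>J. left_ideal J ?A \<and> J \<noteq> {\<zero>\<^bsub>?A\<^esub>} \<and> (\<forall>r\<in>J. r \<otimes>\<^bsub>?A\<^esub> x = \<zero>\<^bsub>?A\<^esub> \<longrightarrow> r = \<zero>\<^bsub>?A\<^esub>)"
  proof (rule left_ideal_of_projection[OF x, of ?e])
    show "?e \<in> lin_hom K C C" by (rule lin_hom_comp[OF lin_hom_comp[OF \<zeta> g_lin] \<rho>_lin])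
  next
    fix f c assume f: "f \<in> lin_hom K C ?S" and c: "c \<in> carrier C"
    have "g (?\<zeta> c) \<in> carrier ?Q" using lin_hom_closed[OF g_lin lin_hom_closed[OF \<zeta> c]] .
    then show "?e (left_act f c) = left_act f (?e c)"
      using N_act[OF f c] g_act[OF f lin_hom_closed[OF \<zeta> c]] \<rho>_act[OF f] by simp
  next
    fix c assume c: "c \<in> carrier C"
    have "g (?\<zeta> c) \<in> carrier ?Q" using lin_hom_closed[OF g_lin lin_hom_closed[OF \<zeta> c]] .
    then show "\<exists>d\<in>carrier C. ?e c = ?r d" using Q_cases \<rho> by metis
    \<comment> \<open>\<open>right_act x c\<close> is \<rho> of the coset of \<open>c\<close>, and
      \<open>g\<close> undoes the embedding of that coset.\<close>
    show "?e (?r c) = ?r c"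
      using gi[OF lin_hom_closed[OF \<pi> c]] \<rho>[OF c] by simp
  qed
qed

theorem mainTheorem4:
  fixes K :: "('k, 'r) ring_scheme"
  assumes "field K"
  shows "(\<forall>C :: ('k, 'c) coalgebra. hereditary_coalgebra K C \<longrightarrow> nonsingular_coalgebra K C) \<and>
         (\<forall>G :: ('v, 'e) pre_digraph. wf_digraph G \<longrightarrow>
            nonsingular_coalgebra K (path_coalgebra K G))"
  using hereditary_coalgebra_nonsingular path_coalgebra_nonsingular[OF assms] by blast

end
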